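(* Let $N$ be a positive integer and let $A,B$ be finite multisets of complex numbers. Suppose that $A$ equals the multiset sum $A=A_1+A_2$ and $B$ equals the multiset sum $B=B_1+B_2$ (finite multisets $A_1,A_2,B_1,B_2$). Then $$\mathcal{M}_N(A,B;0)=\sum_{\lambda}\mathcal{M}_N(A_1,B_1;\lambda)\,\mathcal{M}_N(A_2,B_2;-\lambda),$$ where the sum is over all dominant weights $\lambda$ of length $N$, and for $\lambda=(\lambda_1,\dots,\lambda_N)$ we write $-\lambda=(-\lambda_N,-\lambda_{N-1},\dots,-\lambda_1)$. Moreover, the summand on the right-hand side is nonzero for at most finitely many $\lambda$.
   Context: A dominant weight of length $n$ is an $n$-tuple $\lambda=(\lambda_1,\dots,\lambda_n)$ of integers with $\lambda_1\ge\lambda_2\ge\cdots\ge\lambda_n$. The generalized Schur function is $s_\lambda(x_1,\dots,x_n)=\det\big(x_j^{n-k+\lambda_k}\big)_{1\le j,k\le n}/\det\big(x_j^{n-k}\big)_{1\le j,k\le n}$. For a positive integer $N$, finite multisets $A,B$ of complex numbers and a dominant weight $\lambda$ of length $N$, the twisted moment is $$\mathcal{M}_N(A,B;\lambda)=\int_{U(N)}\prod_{\alpha\in A}\det(I-\alpha g^* )\prod_{\beta\in B}\det(I-\beta g)\, s_\lambda(t_1,\dots,t_N)\,dg,$$ where products count multiplicity, $dg$ is the Haar probability measure on the unitary group $U(N)$, $I$ is the $N\times N$ identity, $g^*$ the conjugate transpose, and $t_1,\dots,t_N$ are the eigenvalues of $g$ with multiplicity. $0$ denotes the zero dominant weight $(0,\dots,0)$.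 The multiset sum $C+D$ has multiplicity of each element equal to the sum of its multiplicities in $C$ and $D$. *)

theory Defs
  imports "Jordan_Normal_Form.Determinant" "HOL-Analysis.Analysis"
begin

no_notation Matrix.vec_index (infixl \<open>$\<close> 100)

text \<open>The group U(N) is modelled on matrices indexed by a finite type \<open>'n\<close>, with
  \<open>N = CARD('n)\<close>. Weights and variables of Schur functions are indexed from 0, so the exponent
  \<open>n - k\<close> of the 1-based formula becomes \<open>n - 1 - k\<close>.\<close>

definition dominant_weights :: "nat \<Rightarrow> int list set" where
  "dominant_weights n = {l. length l = n \<and> sorted_wrt (\<ge>) l}"

definition neg_weight :: "int list \<Rightarrow> int list" where
  "neg_weight l = rev (map uminus l)"

definition schur_num :: "int list \<Rightarrow> (nat \<Rightarrow> complex) \<Rightarrow> complex" where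
  "schur_num l x = (let n = length l in
     Determinant.det (Matrix.mat n n (\<lambda>(j, k). x j powi (int (n - 1 - k) + l ! k))))"

definition schur_den :: "nat \<Rightarrow> (nat \<Rightarrow> complex) \<Rightarrow> complex" where
  "schur_den n x = Determinant.det (Matrix.mat n n (\<lambda>(j, k). x j ^ (n - 1 - k)))"

text \<open>The quotient of determinants is a Laurent polynomial. Where two variables coincide the
  quotient reads 0/0, and the value of the Laurent polynomial is the limit of the quotient along
  points with pairwise distinct variables. Only the first \<open>length l\<close> variables matter.\<close>

definition schur :: "int list \<Rightarrow> (nat \<Rightarrow> complex) \<Rightarrow> complex" where
  "schur l x =
     (if inj_on x {..<length l} then schur_num l x / schur_den (length l) x
      else Lim (at x within {y. inj_on y {..<length l}})
             (\<lambda>y. schur_num l y / schur_den (length l) y))"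

definition conj_transpose :: "complex^'n^'n \<Rightarrow> complex^'n^'n" where
  "conj_transpose g = (\<chi> i j. cnj (g $ j $ i))"

definition unitary_group :: "(complex^'n^'n) set" where
  "unitary_group = {g. g ** conj_transpose g = Finite_Cartesian_Product.mat 1 \<and>
                       conj_transpose g ** g = Finite_Cartesian_Product.mat 1}"

definition haar_prob_measure :: "(complex^'n^'n) measure \<Rightarrow> bool" where
  "haar_prob_measure \<mu> \<longleftrightarrow>
     sets \<mu> = sets (restrict_space borel unitary_group) \<and>
     emeasure \<mu> (space \<mu>) = 1 \<and>
     (\<forall>h\<in>unitary_group. \<forall>E\<in>sets \<mu>. emeasure \<mu> ((\<lambda>g. h ** g) ` E) = emeasure \<mu> E)"

text \<open>The eigenvalues with algebraic multiplicity: the roots of \<open>det (X I - g)\<close>.\<close>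

definition eigenvalue_mset :: "complex^'n^'n \<Rightarrow> complex multiset" where
  "eigenvalue_mset g =
     proots (Determinants.det (Finite_Cartesian_Product.mat [:0, 1:] - (\<chi> i j. [:g $ i $ j:])))"

text \<open>As \<open>schur l\<close> is symmetric in its variables, the chosen enumeration is irrelevant.\<close>

definition schur_eigenvalues :: "int list \<Rightarrow> complex^'n^'n \<Rightarrow> complex" where
  "schur_eigenvalues l g = schur l ((!) (SOME ts. mset ts = eigenvalue_mset g))"

definition twisted_moment ::
  "(complex^'n^'n) measure \<Rightarrow> complex multiset \<Rightarrow> complex multiset \<Rightarrow> int list \<Rightarrow> complex" where
  "twisted_moment \<mu> A B l =
     (LINT g|\<mu>.
        (\<Prod>\<alpha>\<in>#A. Determinants.det (Finite_Cartesian_Product.mat 1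
                     - Finite_Cartesian_Product.mat \<alpha> ** conj_transpose g)) *
        (\<Prod>\<beta>\<in>#B. Determinants.det (Finite_Cartesian_Product.mat 1
                     - Finite_Cartesian_Product.mat \<beta> ** g)) *
        schur_eigenvalues l g)"

end

theory Submission
  imports Defs "HOL-Computational_Algebra.Fundamental_Theorem_Algebra"
begin

text \<open>
  Write \<open>\<rho> = (N - 1, \<dots>, 0)\<close>. The twisted moment \<open>M(A, B; \<lambda>)\<close> is the Toeplitz minor
  \<open>det q(\<rho>\<^sub>j - \<rho>\<^sub>k - \<lambda>\<^sub>k)\<close>, where \<open>q\<close> are the Laurent coefficients of the product of all
  \<open>1 - \<alpha> / x\<close> and \<open>1 - \<beta> x\<close>. These coefficients are multiplicative (as a convolution) in
  \<open>(A, B)\<close>, so the theorem is the Cauchy--Binet formula for a product of two banded Toeplitz matrices.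

  The Toeplitz formula follows, by multilinear expansion of alternants, from the fact that a Schur
  function has Haar integral 0 unless its exponents \<open>\<lambda> + \<rho>\<close> are a permutation of \<open>\<rho>\<close>. To prove this
  without the Weyl integration formula, a Schur function is written as a combination of the functions
  \<open>F(g) = det(g)\<^sup>-\<^sup>m det(w\<^sub>1 - g) \<cdots> det(w\<^sub>r - g)\<close>, by Fourier inversion of a Vandermonde determinant of
  size \<open>N + r\<close>. For the rank one reflection \<open>h = 1 + (z - 1) v v*\<close> and for \<open>h = z\<close>, \<open>z\<^sup>m F(h g)\<close>
  (respectively \<open>z\<^sup>m\<^sup>N F(h g)\<close>) is a polynomial in \<open>z\<close>, so invariance of Haar measure yields identities
  between its Taylor coefficients at \<open>z = 1\<close>; averaged over suitable \<open>v\<close>, they say that the Casimir operator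
  annihilates the integral. On functions of the eigenvalues this operator is \<open>\<Sum> (x\<^sub>a \<partial>\<^sub>a)\<^sup>2\<close> conjugated
  by the Vandermonde determinant, so it multiplies the Schur function by
  \<open>|\<lambda> + \<rho>|\<^sup>2 - |\<rho>|\<^sup>2\<close>.
\<close>

subsection \<open>Determinants of natural-number-indexed families\<close>

text \<open>The enumeration \<open>eigs\<close> of the eigenvalues is an arbitrary choice, so
  functions of it are not visibly continuous or measurable in the matrix. They are therefore handled
  through determinants and polynomial coefficients, which are continuous in the entries, and
  rewritten in eigenvalues only pointwise. The points w_i lie on the circle of radius 2, away from
  the spectrum of every unitary g, so w_i - g is invertible. They must be distinct within one
  product: a second Taylor coefficient of a product of linear factors involves only pairs of
  different indices, and for different points the resolvent identity reduces the trace of a product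
  of two resolvents to single traces, which are logarithmic derivatives of the characteristic
  polynomial. No matrix is ever diagonalised. Coinciding eigenvalues, where the quotient defining a
  Schur function degenerates, are reached by continuity from distinct ones. Schur functions are
  treated for arbitrary integer lists, because multiplication by the Laurent product leads out of
  the dominant weights.\<close>

definition fdet :: "nat \<Rightarrow> (nat \<Rightarrow> nat \<Rightarrow> 'a::comm_ring_1) \<Rightarrow> 'a" where
  "fdet n f = Determinant.det (Matrix.mat n n (\<lambda>(j, k). f j k))"

lemma fdet_leibniz:
  "fdet n f = (\<Sum>p | p permutes {0..<n}. signof p * (\<Prod>j<n. f j (p j)))"
proof -
  have "fdet n f = (\<Sum>p | p permutes {0..<n}. signof p *
      (\<Prod>i = 0..<n. Matrix.mat n n (\<lambda>(j, k). f j k) $$ (i, p i)))"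
    unfolding fdet_def by (rule det_def') simp
  also have "\<dots> = (\<Sum>p | p permutes {0..<n}. signof p * (\<Prod>j<n. f j (p j)))"
  proof (intro sum.cong refl arg_cong2[where f = "(*)"])
    fix p assume "p \<in> {p. p permutes {0..<n}}"
    then have p: "p permutes {0..<n}" by simp
    have "p i < n" if "i < n" for i using permutes_in_image[OF p, of i] that by simp
    then show "(\<Prod>i = 0..<n. Matrix.mat n n (\<lambda>(j, k). f j k) $$ (i, p i)) = (\<Prod>j<n. f j (p j))"
      unfolding atLeast0LessThan by (intro prod.cong) auto
  qed
  finally show ?thesis .
qed

lemma fdet_cong:
  assumes "\<And>j k. j < n \<Longrightarrow> k < n \<Longrightarrow> f j k = g j k"
  shows "fdet n f = fdet n g"
  unfolding fdet_def by (rule arg_cong[where f = Determinant.det], rule eq_matI) (auto simp: assms)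

lemma fdet_transpose: "fdet n (\<lambda>j k. f k j) = fdet n f"
proof -
  have "transpose_mat (Matrix.mat n n (\<lambda>(j, k). f j k)) = Matrix.mat n n (\<lambda>(j, k). f k j)"
    by (rule eq_matI) auto
  then show ?thesis
    unfolding fdet_def using Determinant.det_transpose[of "Matrix.mat n n (\<lambda>(j, k). f j k)" n] by simp
qed

lemma fdet_permute_rows:
  assumes p: "p permutes {0..<n}"
  shows "fdet n (\<lambda>j k. f (p j) k) = signof p * fdet n f"
proof -
  have *: "p i < n" if "i < n" for i using permutes_in_image[OF p, of i] that by simp
  have "Matrix.mat n n (\<lambda>(i, j). Matrix.mat n n (\<lambda>(j, k). f j k) $$ (p i, j)) =
      Matrix.mat n n (\<lambda>(j, k). f (p j) k)"
    by (rule eq_matI) (auto simp: *)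
  then show ?thesis
    unfolding fdet_def using Determinant.det_permute_rows[OF _ p, of "Matrix.mat n n (\<lambda>(j, k). f j k)"]
    by simp
qed

lemma fdet_permute_cols:
  assumes p: "p permutes {0..<n}"
  shows "fdet n (\<lambda>j k. f j (p k)) = signof p * fdet n f"
  using fdet_permute_rows[OF p, of "\<lambda>j k. f k j"]
    fdet_transpose[of n "\<lambda>j k. f j (p k)"] fdet_transpose[of n f] by simp

lemma fdet_identical_cols:
  assumes "i < n" "k < n" "i \<noteq> k" "\<And>j. j < n \<Longrightarrow> f j i = f j k"
  shows "fdet n f = 0"
  unfolding fdet_def
  by (rule Determinant.det_identical_columns[of _ n i k]) (use assms in \<open>auto intro!: eq_vecI\<close>)

lemma fdet_identical_rows:
  assumes "i < n" "k < n" "i \<noteq> k" "\<And>j. j < n \<Longrightarrow> f i j = f k j"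
  shows "fdet n f = 0"
  using fdet_identical_cols[of i n k "\<lambda>j k. f k j"] fdet_transpose[of n f] assms by simp

lemma fdet_mult:
  "fdet n (\<lambda>j k. \<Sum>l<n. f j l * g l k) = fdet n f * fdet n g"
proof -
  have "Matrix.mat n n (\<lambda>(j, k). f j k) * Matrix.mat n n (\<lambda>(j, k). g j k) =
    Matrix.mat n n (\<lambda>(j, k). \<Sum>l<n. f j l * g l k)"
    by (rule eq_matI) (auto simp: scalar_prod_def atLeast0LessThan)
  then show ?thesis
    unfolding fdet_def
    using Determinant.det_mult[of "Matrix.mat n n (\<lambda>(j, k). f j k)" n "Matrix.mat n n (\<lambda>(j, k). g j k)"]
    by simp
qed

lemma fdet_scale_rows: "fdet n (\<lambda>j k. c j * f j k) = (\<Prod>j<n. c j) * fdet n f"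
  unfolding fdet_leibniz by (simp add: prod.distrib sum_distrib_left mult_ac)

lemma fdet_sum_rows:
  assumes "finite S"
  shows "fdet n (\<lambda>j k. \<Sum>s\<in>S. f s j k) = (\<Sum>\<phi>\<in>PiE {..<n} (\<lambda>_. S). fdet n (\<lambda>j k. f (\<phi> j) j k))"
proof -
  have "fdet n (\<lambda>j k. \<Sum>s\<in>S. f s j k) = (\<Sum>p | p permutes {0..<n}. signof p *
     (\<Sum>\<phi>\<in>PiE {..<n} (\<lambda>_. S). \<Prod>j<n. f (\<phi> j) j (p j)))"
    unfolding fdet_leibniz using assms by (subst prod_sum_PiE) auto
  also have "\<dots> = (\<Sum>\<phi>\<in>PiE {..<n} (\<lambda>_. S). fdet n (\<lambda>j k. f (\<phi> j) j k))"
    unfolding fdet_leibniz sum_distrib_left by (rule sum.swap)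
  finally show ?thesis .
qed

lemma fdet_sum_cols:
  assumes "finite S"
  shows "fdet n (\<lambda>j k. \<Sum>s\<in>S. f s j k) = (\<Sum>\<phi>\<in>PiE {..<n} (\<lambda>_. S). fdet n (\<lambda>j k. f (\<phi> k) j k))"
  using fdet_sum_rows[OF assms, of n "\<lambda>s j k. f s k j"]
    fdet_transpose[of n "\<lambda>j k. \<Sum>s\<in>S. f s j k"]
    fdet_transpose[of n "\<lambda>j k. f (_ k) j k"] by (simp add: fdet_transpose[of n "\<lambda>j k. f (_ k) j k"])

lemma fdet_block_lower:
  fixes f :: "nat \<Rightarrow> nat \<Rightarrow> 'a::idom"
  assumes "\<And>j k. j < r \<Longrightarrow> r \<le> k \<Longrightarrow> k < r + n \<Longrightarrow> f j k = 0"
  shows "fdet (r + n) f = fdet r f * fdet n (\<lambda>j k. f (r + j) (r + k))"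
proof -
  let ?A = "Matrix.mat r r (\<lambda>(j, k). f j k)" and ?C = "Matrix.mat n r (\<lambda>(j, k). f (r + j) k)"
    and ?D = "Matrix.mat n n (\<lambda>(j, k). f (r + j) (r + k))"
  have "Matrix.mat (r + n) (r + n) (\<lambda>(j, k). f j k) = four_block_mat ?A (0\<^sub>m r n) ?C ?D"
    by (rule eq_matI) (auto simp: assms)
  then show ?thesis
    unfolding fdet_def by (simp add: det_four_block_mat_upper_right_zero[of _ r _ n])
qed

lemma fdet_upper_triangular:
  fixes f :: "nat \<Rightarrow> nat \<Rightarrow> 'a::comm_ring_1"
  assumes "\<And>j k. k < j \<Longrightarrow> j < n \<Longrightarrow> f j k = 0"
  shows "fdet n f = (\<Prod>j<n. f j j)"
proof -
  have "fdet n f = prod_list (diag_mat (Matrix.mat n n (\<lambda>(j, k). f j k)))"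
    unfolding fdet_def by (rule det_upper_triangular[of _ n]) (auto simp: assms upper_triangular_def)
  also have "diag_mat (Matrix.mat n n (\<lambda>(j, k). f j k)) = map (\<lambda>j. f j j) [0..<n]"
    by (auto simp: diag_mat_def)
  also have "prod_list \<dots> = (\<Prod>j<n. f j j)"
    by (simp add: prod.distinct_set_conv_list[symmetric] atLeast0LessThan)
  finally show ?thesis .
qed

text \<open>\<open>C a k\<close> does not involve row \<open>a\<close>, so along that row the
  determinant is a linear form with fixed coefficients and can be differentiated in one variable
  alone. Laplace expansion down column \<open>k\<close> serves later to add up the contributions of
  all rows.\<close>

lemma fdet_cofactors:
  fixes f :: "nat \<Rightarrow> nat \<Rightarrow> 'a::comm_ring_1"
  obtains C where
    "\<And>a g. a < n \<Longrightarrow> fdet n (f(a := g)) = (\<Sum>k<n. g k * C a k)"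
    "\<And>k. k < n \<Longrightarrow> (\<Sum>a<n. f a k * C a k) = fdet n f"
proof
  let ?M = "\<lambda>f. Matrix.mat n n (\<lambda>(j, k). f j k)"
  let ?C = "\<lambda>a k. cofactor (?M f) a k"
  show "(\<Sum>a<n. f a k * ?C a k) = fdet n f" if "k < n" for k
    unfolding fdet_def using laplace_expansion_column[of "?M f" n k] that by simp
  show "fdet n (f(a := g)) = (\<Sum>k<n. g k * ?C a k)" if a: "a < n" for a g
  proof -
    have "fdet n (f(a := g)) = (\<Sum>k<n. ?M (f(a := g)) $$ (a, k) * cofactor (?M (f(a := g))) a k)"
      unfolding fdet_def by (rule laplace_expansion_row) (use a in simp_all)
    also have "\<dots> = (\<Sum>k<n. g k * ?C a k)"
    proof (intro sum.cong refl arg_cong2[where f = "(*)"])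
      fix k assume k: "k \<in> {..<n}"
      show "?M (f(a := g)) $$ (a, k) = g k" using a k by simp
      have "mat_delete (?M (f(a := g))) a k = mat_delete (?M f) a k"
        unfolding mat_delete_def by (rule eq_matI) (use a k in auto)
      then show "cofactor (?M (f(a := g))) a k = cofactor (?M f) a k"
        by (simp add: cofactor_def)
    qed
    finally show ?thesis .
  qed
qed

subsection \<open>Vandermonde determinants\<close>

text \<open>Replace the monomials by the monic polynomials 1, ..., X^(r-1), P, X P, ... with P the
  product of the X - w_i. The change of basis is unitriangular, and P vanishes at the w_i, so the
  matrix becomes block triangular; in the lower right block row a is scaled by P(x_a).\<close>

lemma fdet_vandermonde_append:
  fixes w x :: "nat \<Rightarrow> 'a::idom"
  shows "fdet (r + n) (\<lambda>j k. (if j < r then w j else x (j - r)) ^ k) =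
    fdet r (\<lambda>j k. w j ^ k) * fdet n (\<lambda>j k. x j ^ k) * (\<Prod>a<n. \<Prod>i<r. x a - w i)"
proof -
  define y where "y = (\<lambda>j. if j < r then w j else x (j - r))"
  define P where "P = (\<Prod>i<r. [:- w i, 1:])"
  define p where "p = (\<lambda>k. if k < r then monom 1 k else monom 1 (k - r) * P)"
  have "lead_coeff P = 1" unfolding P_def lead_coeff_prod by simp
  moreover have "degree P = r" unfolding P_def by (simp add: degree_prod_eq_sum_degree)
  ultimately have P: "degree P = r" "lead_coeff P = 1" by auto
  have polyP: "poly P z = (\<Prod>i<r. z - w i)" for z
    unfolding P_def by (simp add: poly_prod)
  have "P \<noteq> 0" using P by auto
  have deg: "degree (p k) = k" for k
    using P \<open>P \<noteq> 0\<close> by (auto simp: p_def degree_monom_eq degree_mult_eq)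
  have lead: "coeff (p k) k = 1" for k
  proof -
    have "lead_coeff (p k) = 1"
      using P(2) by (cases "k < r") (simp_all only: p_def if_True if_False lead_coeff_mult lead_coeff_monom mult_1)
    then show ?thesis by (simp add: deg)
  qed
  have "fdet (r + n) (\<lambda>j k. poly (p k) (y j)) =
      fdet (r + n) (\<lambda>j k. \<Sum>l<r+n. y j ^ l * coeff (p k) l)"
  proof (rule fdet_cong)
    fix j k assume "j < r + n" "k < r + n"
    have "poly (p k) (y j) = (\<Sum>l\<le>k. coeff (p k) l * y j ^ l)"
      by (simp add: poly_altdef deg)
    also have "\<dots> = (\<Sum>l<r+n. coeff (p k) l * y j ^ l)"
      by (rule sum.mono_neutral_left) (use \<open>k < r + n\<close> in \<open>auto simp: coeff_eq_0 deg\<close>)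
    finally show "poly (p k) (y j) = (\<Sum>l<r+n. y j ^ l * coeff (p k) l)"
      by (simp add: mult.commute)
  qed
  also have "\<dots> = fdet (r + n) (\<lambda>j k. y j ^ k) * fdet (r + n) (\<lambda>l k. coeff (p k) l)"
    by (rule fdet_mult)
  also have "fdet (r + n) (\<lambda>l k. coeff (p k) l) = (\<Prod>j<r+n. coeff (p j) j)"
    by (rule fdet_upper_triangular) (simp add: coeff_eq_0 deg)
  also have "\<dots> = 1" by (simp add: lead)
  finally have "fdet (r + n) (\<lambda>j k. y j ^ k) = fdet (r + n) (\<lambda>j k. poly (p k) (y j))" by simp
  also have "\<dots> = fdet r (\<lambda>j k. poly (p k) (y j)) * fdet n (\<lambda>j k. poly (p (r + k)) (y (r + j)))"
    by (rule fdet_block_lower) (auto simp: p_def y_def polyP)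
  also have "fdet r (\<lambda>j k. poly (p k) (y j)) = fdet r (\<lambda>j k. w j ^ k)"
    by (rule fdet_cong) (auto simp: p_def y_def poly_monom)
  also have "fdet n (\<lambda>j k. poly (p (r + k)) (y (r + j))) = fdet n (\<lambda>j k. (\<Prod>i<r. x j - w i) * x j ^ k)"
    by (rule fdet_cong) (auto simp: p_def y_def poly_monom polyP)
  finally show ?thesis
    unfolding y_def fdet_scale_rows by (simp add: mult_ac)
qed

lemma fdet_vandermonde:
  fixes x :: "nat \<Rightarrow> 'a::idom"
  shows "fdet n (\<lambda>j k. x j ^ k) = (\<Prod>j<n. \<Prod>i<j. x j - x i)"
proof (induction n)
  case 0
  then show ?case by (simp add: fdet_leibniz)
next
  case (Suc n)
  have "fdet (Suc n) (\<lambda>j k. x j ^ k) =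
      fdet (n + 1) (\<lambda>j k. (if j < n then x j else (\<lambda>_. x n) (j - n)) ^ k)"
    unfolding Suc_eq_plus1 by (rule fdet_cong) (use less_antisym in fastforce)
  also have "\<dots> = fdet n (\<lambda>j k. x j ^ k) * fdet 1 (\<lambda>j k. x n ^ k) * (\<Prod>a<1::nat. \<Prod>i<n. x n - x i)"
    by (rule fdet_vandermonde_append)
  also have "fdet 1 (\<lambda>j k. x n ^ k) = 1"
    by (simp add: fdet_upper_triangular)
  finally show ?case by (simp add: Suc.IH)
qed

lemma vandermonde_nonzero:
  fixes x :: "nat \<Rightarrow> 'a::idom"
  assumes "inj_on x {..<n}"
  shows "fdet n (\<lambda>j k. x j ^ k) \<noteq> 0"
proof -
  have "x j - x i \<noteq> 0" if "j < n" "i < j" for i j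
    using inj_onD[OF assms, of j i] that by auto
  then show ?thesis unfolding fdet_vandermonde by auto
qed

text \<open>Among the factors x_j - x_i, those that avoid index \<open>a\<close> do not depend on z,
  and each of the others is z - x_b up to a sign, which is -1 exactly for b > a. Both contributions
  are collected in \<open>K\<close>.\<close>

lemma vandermonde_update:
  fixes x :: "nat \<Rightarrow> 'a::idom"
  assumes a: "a < n"
  obtains K where "\<And>z. fdet n (\<lambda>j k. (x(a := z)) j ^ k) = K * (\<Prod>b\<in>{..<n} - {a}. z - x b)"
proof -
  define P where "P = (SIGMA j:{..<n}. {..<j})"
  define Pa where "Pa = {(j, i) \<in> P. j = a \<or> i = a}"
  define c where "c = (\<lambda>b. if b < a then 1 else (-1 :: 'a))"
  define d where "d = (\<lambda>x (j :: nat, i :: nat). x j - x i :: 'a)"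
  define K where "K = (\<Prod>b\<in>{..<n} - {a}. c b) * prod (d x) (P - Pa)"
  have fin: "finite P" "Pa \<subseteq> P" unfolding P_def Pa_def by auto
  have "fdet n (\<lambda>j k. (x(a := z)) j ^ k) = K * (\<Prod>b\<in>{..<n} - {a}. z - x b)" for z
  proof -
    let ?x = "x(a := z)"
    have "fdet n (\<lambda>j k. ?x j ^ k) = prod (d ?x) P"
      unfolding fdet_vandermonde P_def d_def by (subst prod.Sigma) auto
    also have "\<dots> = prod (d ?x) (P - Pa) * prod (d ?x) Pa"
      using fin by (rule prod.subset_diff[OF _ _, rotated])
    also have "prod (d ?x) (P - Pa) = prod (d x) (P - Pa)"
      by (rule prod.cong) (auto simp: d_def Pa_def split: if_splits)
    also have "prod (d ?x) Pa = (\<Prod>b\<in>{..<n} - {a}. d ?x (max a b, min a b))"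
      by (rule prod.reindex_bij_witness[of _ "\<lambda>b. (max a b, min a b)" "\<lambda>(j, i). if j = a then i else j"])
        (use a in \<open>auto simp: Pa_def P_def max_def min_def split: if_splits\<close>)
    also have "\<dots> = (\<Prod>b\<in>{..<n} - {a}. c b * (z - x b))"
      by (rule prod.cong) (auto simp: d_def c_def)
    finally show ?thesis by (simp add: K_def prod.distrib mult_ac)
  qed
  then show ?thesis by (rule that)
qed

text \<open>Completes n exponents to all of 0, ..., r + n - 1, so that the alternant with these
  exponents is the determinant of the lower right block of a column-permuted matrix of powers of
  size r + n.\<close>

lemma permutes_extending_inj:
  fixes r n :: nat
  assumes E: "inj_on E {..<n}" "\<And>k. k < n \<Longrightarrow> E k < r + n"
  obtains p where "p permutes {0..<r+n}" "\<And>k. k < n \<Longrightarrow> p (r + k) = E k"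
proof -
  have sub: "E ` {..<n} \<subseteq> {0..<r+n}" using E(2) by auto
  have "card ({0..<r+n} - E ` {..<n}) = card {0..<r}"
    using sub by (simp add: card_Diff_subset card_image[OF E(1)])
  then obtain h where h: "bij_betw h {0..<r} ({0..<r+n} - E ` {..<n})"
    using finite_same_card_bij[of "{0..<r}" "{0..<r+n} - E ` {..<n}"] by auto
  define p where "p = (\<lambda>j. if j < r then h j else if j < r + n then E (j - r) else j)"
  have "bij_betw p {0..<r} ({0..<r+n} - E ` {..<n})"
    using h by (rule bij_betw_cong[THEN iffD1, rotated]) (simp add: p_def)
  moreover have "bij_betw p {r..<r+n} (E ` {..<n})"
  proof (rule bij_betw_imageI)
    show "inj_on p {r..<r+n}"
      by (rule inj_onI) (use inj_onD[OF E(1)] in \<open>fastforce simp: p_def\<close>)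
    have "{r..<r+n} = (+) r ` {..<n}"
      by (simp add: lessThan_atLeast0 add.commute)
    then have "p ` {r..<r+n} = (\<lambda>k. p (r + k)) ` {..<n}"
      by (simp add: image_image)
    also have "\<dots> = E ` {..<n}" by (rule image_cong) (auto simp: p_def)
    finally show "p ` {r..<r+n} = E ` {..<n}" .
  qed
  ultimately have "bij_betw p ({0..<r} \<union> {r..<r+n}) (({0..<r+n} - E ` {..<n}) \<union> E ` {..<n})"
    by (rule bij_betw_combine) auto
  moreover have "{0..<r} \<union> {r..<r+n} = {0..<r+n}" by auto
  moreover have "({0..<r+n} - E ` {..<n}) \<union> E ` {..<n} = {0..<r+n}" using sub by auto
  ultimately have "p permutes {0..<r+n}"
    by (intro bij_imp_permutes) (auto simp: p_def)
  then show ?thesis by (rule that) (simp add: p_def)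
qed

text \<open>Discrete Fourier inversion: the points are twice the M-th roots of unity, and distinct
  exponents below M give distinct characters. The radius 2 cancels when p = q.\<close>

lemma circle_average:
  fixes M p q :: nat
  assumes "p < M" "q < M"
  defines "W \<equiv> \<lambda>s. 2 * exp (2 * of_real pi * \<i> * of_nat s / of_nat M)"
  shows "(\<Sum>s<M. W s ^ p / W s ^ q / of_nat M) = (if p = q then 1 else 0)"
proof -
  have M: "M > 0" using assms by simp
  define \<xi> where "\<xi> = (\<lambda>p::nat. exp (2 * of_real pi * \<i> * of_nat p / of_nat M) :: complex)"
  have xi: "exp (2 * of_real pi * \<i> * of_nat s / of_nat M) ^ p = \<xi> p ^ s" for s p
    unfolding \<xi>_def by (simp add: exp_of_nat_mult[symmetric] mult_ac)
  have W: "W s ^ p / W s ^ q / of_nat M = 2 ^ p / 2 ^ q / of_nat M * (\<xi> p / \<xi> q) ^ s" for s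
    unfolding W_def power_mult_distrib xi power_divide by simp
  have sum: "(\<Sum>s<M. (\<xi> p / \<xi> q) ^ s) = (if p = q then of_nat M else 0)"
  proof (cases "p = q")
    case True
    have "\<xi> q \<noteq> 0" by (simp add: \<xi>_def)
    then show ?thesis using True by simp
  next
    case False
    have "\<xi> p \<noteq> \<xi> q"
      unfolding \<xi>_def using complex_root_unity_eq[of M p q] M False assms(1,2) by simp
    moreover have "\<xi> q \<noteq> 0" by (simp add: \<xi>_def)
    ultimately have ne: "\<xi> p / \<xi> q \<noteq> 1" by simp
    have one: "\<xi> p ^ M = 1" for p
    proof -
      have "\<xi> p ^ M = exp (2 * of_real pi * \<i> * of_nat p)"
        unfolding \<xi>_def using M by (simp add: exp_of_nat_mult[symmetric])
      also have "\<dots> = exp (2 * of_real pi * \<i>) ^ p"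
        by (simp add: exp_of_nat_mult[symmetric] mult_ac)
      finally show ?thesis by simp
    qed
    have "(\<Sum>s<M. (\<xi> p / \<xi> q) ^ s) = ((\<xi> p / \<xi> q) ^ M - 1) / (\<xi> p / \<xi> q - 1)"
      by (rule geometric_sum[OF ne])
    also have "\<dots> = 0" by (simp add: power_divide one)
    finally show ?thesis using False by simp
  qed
  have "(\<Sum>s<M. W s ^ p / W s ^ q / of_nat M) = 2 ^ p / 2 ^ q / of_nat M * (\<Sum>s<M. (\<xi> p / \<xi> q) ^ s)"
    unfolding W sum_distrib_left ..
  then show ?thesis using M unfolding sum by simp
qed

text \<open>Take the matrix of size r + n whose first r rows are unit vectors and whose other rows
  are the powers x_j^(p k), where \<open>p\<close> puts the exponents \<open>E\<close> into the last
  n columns. Its determinant is the alternant. Each unit vector is an average of rows of powers of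
  points on a circle, so multilinearity in the rows gives Vandermonde determinants in r such points
  and the n variables, and \<open>fdet_vandermonde_append\<close> factors them.\<close>

lemma polynomial_alternant_expansion:
  fixes E :: "nat \<Rightarrow> nat"
  assumes E: "inj_on E {..<n}" "\<And>k. k < n \<Longrightarrow> E k < r + n" and n: "n > 0"
  obtains T :: "(nat \<Rightarrow> nat) set" and c w where
    "finite T" "\<And>\<tau>. \<tau> \<in> T \<Longrightarrow> inj_on (w \<tau>) {..<r}" "\<And>\<tau> i. norm (w \<tau> i) = 2"
    "\<And>x. fdet n (\<lambda>j k. x j ^ E k) =
        fdet n (\<lambda>j k. x j ^ k) * (\<Sum>\<tau>\<in>T. c \<tau> * (\<Prod>a<n. \<Prod>i<r. w \<tau> i - x a :: complex))"
proof -
  obtain p where p: "p permutes {0..<r+n}" and pE: "\<And>k. k < n \<Longrightarrow> p (r + k) = E k"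
    using permutes_extending_inj[OF E] by blast
  have plt: "p j < r + n" if "j < r + n" for j
    using permutes_in_image[OF p, of j] that by simp
  define M where "M = r + n"
  have M: "M > 0" using n by (simp add: M_def)
  define W :: "nat \<Rightarrow> complex" where "W = (\<lambda>s. 2 * exp (2 * of_real pi * \<i> * of_nat s / of_nat M))"
  have W0: "W s \<noteq> 0" for s by (simp add: W_def)
  have Wn: "norm (W s) = 2" for s
  proof -
    have "norm (exp (2 * of_real pi * \<i> * of_nat s / of_nat M)) = 1"
      by (simp add: norm_exp_eq_Re)
    then show ?thesis unfolding W_def norm_mult by simp
  qed
  define T0 where "T0 = PiE {..<M} (\<lambda>_. {..<M})"
  \<comment> \<open>Choices in which two of the r points coincide have coefficient 0. Dropping them
    makes the points distinct, as the resolvent identity will require.\<close>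
  define T where "T = {\<tau> \<in> T0. inj_on (\<lambda>i. W (\<tau> i)) {..<r}}"
  define c0 where "c0 = (\<lambda>\<tau>. (\<Prod>j<M. (if j < r then inverse (W (\<tau> j) ^ p j) else 1) / of_nat M) *
      signof p * fdet r (\<lambda>j k. W (\<tau> j) ^ k))"
  define c where "c = (\<lambda>\<tau>. c0 \<tau> * (-1) ^ (r * n))"
  have finT0: "finite T0" unfolding T0_def by (rule finite_PiE) auto
  have main: "fdet n (\<lambda>j k. x j ^ E k) =
      fdet n (\<lambda>j k. x j ^ k) * (\<Sum>\<tau>\<in>T. c \<tau> * (\<Prod>a<n. \<Prod>i<r. W (\<tau> i) - x a))" for x :: "nat \<Rightarrow> complex"
  proof -
    \<comment> \<open>Summed over \<open>s\<close>, the rows j < r become unit vectors by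
      \<open>circle_average\<close>. The remaining rows do not depend on \<open>s\<close>; dividing
      them by M makes the sum over \<open>s\<close> return them unchanged, so that one index set
      serves all rows.\<close>
    define f where "f = (\<lambda>s j k. (if j < r then W s ^ p k / W s ^ p j else x (j - r) ^ p k) / of_nat M)"
    have Z: "(\<Sum>s<M. f s j k) = (if j < r then if j = k then 1 else 0 else x (j - r) ^ p k)"
      if "j < M" "k < M" for j k
    proof (cases "j < r")
      case True
      have "(\<Sum>s<M. f s j k) = (if p k = p j then 1 else 0)"
        unfolding f_def using True circle_average[of "p k" M "p j"] plt that
        by (simp add: W_def M_def)
      then show ?thesis using True permutes_inj[OF p] by (auto dest: injD)
    next
      case False
      then show ?thesis using M by (simp add: f_def)
    qed
    have "(\<Sum>\<tau>\<in>T0. fdet M (\<lambda>j k. f (\<tau> j) j k)) = fdet M (\<lambda>j k. \<Sum>s<M. f s j k)"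
      unfolding T0_def by (rule fdet_sum_rows[symmetric]) simp
    also have "\<dots> = fdet M (\<lambda>j k. if j < r then if j = k then 1 else 0 else x (j - r) ^ p k)"
      by (rule fdet_cong) (rule Z)
    also have "\<dots> = fdet r (\<lambda>j k. if j < r then if j = k then 1 else 0 else x (j - r) ^ p k) *
        fdet n (\<lambda>j k. if r + j < r then if r + j = r + k then 1 else 0 else x (r + j - r) ^ p (r + k))"
      unfolding M_def by (rule fdet_block_lower) auto
    also have "fdet r (\<lambda>j k. if j < r then if j = k then 1 else 0 else x (j - r) ^ p k) = 1"
      by (subst fdet_upper_triangular) auto
    also have "fdet n (\<lambda>j k. if r + j < r then if r + j = r + k then 1 else 0 else x (r + j - r) ^ p (r + k)) =
        fdet n (\<lambda>j k. x j ^ E k)"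
      by (rule fdet_cong) (simp add: pE)
    finally have 1: "fdet n (\<lambda>j k. x j ^ E k) = (\<Sum>\<tau>\<in>T0. fdet M (\<lambda>j k. f (\<tau> j) j k))"
      by simp
    have 2: "fdet M (\<lambda>j k. f (\<tau> j) j k) =
        fdet n (\<lambda>j k. x j ^ k) * (c \<tau> * (\<Prod>a<n. \<Prod>i<r. W (\<tau> i) - x a))" for \<tau>
    proof -
      define y where "y = (\<lambda>j. if j < r then W (\<tau> j) else x (j - r))"
      have "fdet M (\<lambda>j k. f (\<tau> j) j k) = fdet M (\<lambda>j k.
          (if j < r then inverse (W (\<tau> j) ^ p j) else 1) / of_nat M * (y j ^ p k))"
        by (rule fdet_cong) (auto simp: f_def y_def field_simps)
      also have "\<dots> = (\<Prod>j<M. (if j < r then inverse (W (\<tau> j) ^ p j) else 1) / of_nat M) *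
          (signof p * fdet M (\<lambda>j k. y j ^ k))"
        unfolding fdet_scale_rows using fdet_permute_cols[of p M "\<lambda>j k. y j ^ k"] p
        by (simp add: M_def)
      also have "fdet M (\<lambda>j k. y j ^ k) =
          fdet r (\<lambda>j k. W (\<tau> j) ^ k) * fdet n (\<lambda>j k. x j ^ k) * (\<Prod>a<n. \<Prod>i<r. x a - W (\<tau> i))"
        unfolding M_def y_def by (rule fdet_vandermonde_append)
      also have "(\<Prod>a<n. \<Prod>i<r. x a - W (\<tau> i)) = (\<Prod>a<n. \<Prod>i<r. (-1) * (W (\<tau> i) - x a))"
        by simp
      also have "\<dots> = (-1) ^ (r * n) * (\<Prod>a<n. \<Prod>i<r. W (\<tau> i) - x a)"
        unfolding prod.distrib by (simp add: power_mult)
      finally show ?thesis by (simp add: c_def c0_def mult_ac)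
    qed
    have "fdet n (\<lambda>j k. x j ^ E k) =
        (\<Sum>\<tau>\<in>T0. fdet n (\<lambda>j k. x j ^ k) * (c \<tau> * (\<Prod>a<n. \<Prod>i<r. W (\<tau> i) - x a)))"
      unfolding 1 2 ..
    also have "\<dots> = (\<Sum>\<tau>\<in>T. fdet n (\<lambda>j k. x j ^ k) * (c \<tau> * (\<Prod>a<n. \<Prod>i<r. W (\<tau> i) - x a)))"
    proof (rule sum.mono_neutral_right)
      show "\<forall>\<tau>\<in>T0 - T. fdet n (\<lambda>j k. x j ^ k) * (c \<tau> * (\<Prod>a<n. \<Prod>i<r. W (\<tau> i) - x a)) = 0"
      proof
        fix \<tau> assume "\<tau> \<in> T0 - T"
        then obtain i j where "i < r" "j < r" "i \<noteq> j" "W (\<tau> i) = W (\<tau> j)"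
          by (auto simp: T_def inj_on_def)
        then have "fdet r (\<lambda>j k. W (\<tau> j) ^ k) = 0"
          by (intro fdet_identical_rows[of i r j]) auto
        then show "fdet n (\<lambda>j k. x j ^ k) * (c \<tau> * (\<Prod>a<n. \<Prod>i<r. W (\<tau> i) - x a)) = 0"
          by (simp add: c_def c0_def)
      qed
    qed (use finT0 in \<open>auto simp: T_def\<close>)
    finally show ?thesis by (simp add: sum_distrib_left)
  qed
  show ?thesis
    by (rule that[of T "\<lambda>\<tau> i. W (\<tau> i)" c]) (use finT0 Wn main in \<open>auto simp: T_def\<close>)
qed

subsection \<open>Schur functions as combinations of products over the variables\<close>

definition staircase :: "nat \<Rightarrow> nat \<Rightarrow> int" where
  "staircase n k = int (n - 1 - k)"

definition alternant :: "nat \<Rightarrow> (nat \<Rightarrow> int) \<Rightarrow> (nat \<Rightarrow> complex) \<Rightarrow> complex" where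
  "alternant n e x = fdet n (\<lambda>j k. x j powi e k)"

text \<open>The contribution of a single eigenvalue z to the product of all det(w_i - g) times
  det(g)^(-m); see \<open>char_prod_eigs\<close>.\<close>

definition root_factor :: "nat \<Rightarrow> nat \<Rightarrow> (nat \<Rightarrow> complex) \<Rightarrow> complex \<Rightarrow> complex" where
  "root_factor m r w z = inverse z ^ m * (\<Prod>i<r. w i - z)"

abbreviation root_comb :: "nat \<Rightarrow> nat \<Rightarrow> nat \<Rightarrow> 't set \<Rightarrow> ('t \<Rightarrow> complex) \<Rightarrow> ('t \<Rightarrow> nat \<Rightarrow> complex) \<Rightarrow>
    (nat \<Rightarrow> complex) \<Rightarrow> complex" where
  "root_comb n m r T c w x \<equiv> \<Sum>\<tau>\<in>T. c \<tau> * (\<Prod>a<n. root_factor m r (w \<tau>) (x a))"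

lemma schur_num_alternant:
  "schur_num l = alternant (length l) (\<lambda>k. staircase (length l) k + l ! k)"
  by (rule ext) (simp add: schur_num_def alternant_def fdet_def staircase_def Let_def)

lemma schur_den_alternant: "schur_den n = alternant n (staircase n)"
  by (rule ext) (simp add: schur_den_def alternant_def fdet_def staircase_def)

lemma schur_den_vandermonde:
  obtains \<epsilon> :: complex where "\<epsilon> \<noteq> 0" "\<And>x. schur_den n x = \<epsilon> * fdet n (\<lambda>j k. x j ^ k)"
proof -
  define p where "p = (\<lambda>k. if k < n then n - 1 - k else k)"
  have "bij_betw p {0..<n} {0..<n}"
    by (rule bij_betwI[of _ _ _ p]) (auto simp: p_def)
  then have p: "p permutes {0..<n}"
    by (rule bij_imp_permutes) (simp add: p_def)
  show ?thesis
  proof (rule that[of "signof p"])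
    show "signof p \<noteq> (0 :: complex)" by (simp add: sign_def)
    fix x
    have "schur_den n x = fdet n (\<lambda>j k. x j ^ p k)"
      unfolding schur_den_def fdet_def[symmetric] by (rule fdet_cong) (simp add: p_def)
    then show "schur_den n x = signof p * fdet n (\<lambda>j k. x j ^ k)"
      using fdet_permute_cols[OF p, of "\<lambda>j k. x j ^ k"] by simp
  qed
qed

lemma schur_den_nonzero: "inj_on x {..<n} \<Longrightarrow> schur_den n x \<noteq> 0"
  by (rule schur_den_vandermonde[of n]) (simp add: vandermonde_nonzero)

lemma alternant_not_inj:
  assumes "\<not> inj_on e {..<n}"
  shows "alternant n e x = 0"
proof -
  from assms obtain i k where "i < n" "k < n" "i \<noteq> k" "e i = e k"
    by (auto simp: inj_on_def)
  then show ?thesis unfolding alternant_def by (intro fdet_identical_cols[of i n k]) auto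
qed

lemma alternant_expansion:
  assumes n: "n > 0"
  obtains T :: "(nat \<Rightarrow> nat) set" and c w m r where
    "finite T" "\<And>\<tau>. \<tau> \<in> T \<Longrightarrow> inj_on (w \<tau>) {..<r}" "\<And>\<tau> i. norm (w \<tau> i) = 2"
    "\<forall>x. (\<forall>a<n. x a \<noteq> 0) \<longrightarrow> alternant n e x =
        schur_den n x * root_comb n m r T c w x"
proof (cases "inj_on e {..<n}")
  case False
  show ?thesis
    by (rule that[of "{}" "\<lambda>_ _. 2" 0]) (auto simp: alternant_not_inj[OF False])
next
  case True
  \<comment> \<open>Scaling row j by x_j^m makes all exponents nonnegative. They are then at most 2
    m, hence below r + n for r = 2 m because n > 0.\<close>
  define m where "m = (\<Sum>k<n. nat \<bar>e k\<bar>)"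
  have m: "\<bar>e k\<bar> \<le> int m" if "k < n" for k
  proof -
    have "nat \<bar>e k\<bar> \<le> m" unfolding m_def by (rule member_le_sum) (use that in auto)
    then show ?thesis by simp
  qed
  define r where "r = 2 * m"
  define E where "E = (\<lambda>k. nat (e k + int m))"
  have Ee: "int (E k) = e k + int m" if "k < n" for k
    using m[OF that] by (simp add: E_def)
  have injE: "inj_on E {..<n}"
  proof (rule inj_onI)
    fix i k assume "i \<in> {..<n}" "k \<in> {..<n}" "E i = E k"
    then show "i = k" using Ee[of i] Ee[of k] inj_onD[OF True, of i k] by simp
  qed
  have Elt: "E k < r + n" if "k < n" for k
    using m[OF that] n by (simp add: E_def r_def)
  obtain \<epsilon> :: complex where eps: "\<epsilon> \<noteq> 0" "\<And>x. schur_den n x = \<epsilon> * fdet n (\<lambda>j k. x j ^ k)"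
    by (rule schur_den_vandermonde[of n]) (rule that)
  obtain T :: "(nat \<Rightarrow> nat) set" and c w where T:
    "finite T" "\<And>\<tau>. \<tau> \<in> T \<Longrightarrow> inj_on (w \<tau>) {..<r}" "\<And>\<tau> i. norm (w \<tau> i) = 2"
    "\<And>x. fdet n (\<lambda>j k. x j ^ E k) =
        fdet n (\<lambda>j k. x j ^ k) * (\<Sum>\<tau>\<in>T. c \<tau> * (\<Prod>a<n. \<Prod>i<r. w \<tau> i - x a :: complex))"
    by (rule polynomial_alternant_expansion[OF injE Elt n]) (assumption, rule that)
  show ?thesis
  proof (rule that[of T w r "\<lambda>\<tau>. c \<tau> / \<epsilon>" m], goal_cases)
    case 4
    show ?case
    proof (intro allI impI)
      fix x :: "nat \<Rightarrow> complex" assume "\<forall>a<n. x a \<noteq> 0"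
      then have x: "\<And>a. a < n \<Longrightarrow> x a \<noteq> 0" by simp
      have "alternant n e x = fdet n (\<lambda>j k. inverse (x j) ^ m * x j ^ E k)"
        unfolding alternant_def
      proof (rule fdet_cong)
        fix j k assume "j < n" "k < n"
        have "x j ^ E k = x j powi (e k + int m)"
          using Ee[OF \<open>k < n\<close>] by (metis power_int_of_nat)
        also have "\<dots> = x j powi e k * x j ^ m"
          using x[OF \<open>j < n\<close>] by (simp add: power_int_add)
        finally show "x j powi e k = inverse (x j) ^ m * x j ^ E k"
          using x[OF \<open>j < n\<close>] by (simp add: field_simps)
      qed
      also have "\<dots> = (\<Prod>j<n. inverse (x j) ^ m) * fdet n (\<lambda>j k. x j ^ E k)"
        by (rule fdet_scale_rows)
      also have "\<dots> = schur_den n x *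
          (\<Sum>\<tau>\<in>T. c \<tau> / \<epsilon> * ((\<Prod>j<n. inverse (x j) ^ m) * (\<Prod>a<n. \<Prod>i<r. w \<tau> i - x a)))"
        unfolding T(4) eps(2) using eps(1) by (simp add: sum_distrib_left mult_ac)
      finally show "alternant n e x =
          schur_den n x * (\<Sum>\<tau>\<in>T. c \<tau> / \<epsilon> * (\<Prod>a<n. root_factor m r (w \<tau>) (x a)))"
        by (simp add: root_factor_def prod.distrib)
    qed
  qed (use T in auto)
qed

section \<open>Limits at points with coinciding variables\<close>

lemma tendsto_coordinate:
  fixes x :: "'i \<Rightarrow> 'a::topological_space"
  shows "((\<lambda>y. y a) \<longlongrightarrow> x a) (at x within S)"
proof -
  have "continuous_on UNIV (\<lambda>y :: 'i \<Rightarrow> 'a. y a)" by simp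
  then have "((\<lambda>y. y a) \<longlongrightarrow> x a) (at x)" by (simp add: continuous_on_def)
  then show ?thesis by (rule tendsto_within_subset) simp
qed

text \<open>Move x in the direction (0, 1, 2, ...): two given coordinates of x_j + eps j coincide
  for at most one nonzero eps, so all small nonzero eps give pairwise distinct coordinates. This
  nontriviality makes the \<open>Lim\<close> in \<open>schur\<close> a well-determined
  value.\<close>

lemma inj_points_accumulate:
  fixes x :: "nat \<Rightarrow> complex"
  assumes "\<not> inj_on x {..<n}"
  shows "at x within {y. inj_on y {..<n}} \<noteq> bot"
proof -
  define h where "h = (\<lambda>(\<epsilon>::real) j. x j + of_real \<epsilon> * of_nat j)"
  have "continuous_on UNIV h"
    unfolding h_def by (intro continuous_on_coordinatewise_then_product continuous_intros)
  then have "(h \<longlongrightarrow> h 0) (at 0)" by (simp add: continuous_on_def)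
  then have lim: "(h \<longlongrightarrow> x) (at 0)" by (simp add: h_def)
  \<comment> \<open>Pairs with i = j contribute 0 through division by zero. The value 0 is removed
    below, since eps tends to 0 through nonzero values only.\<close>
  define Bad where "Bad = (\<lambda>(i, j). Re ((x i - x j) / (of_nat j - of_nat i))) ` ({..<n} \<times> {..<n})"
  have "finite (Bad - {0})" by (simp add: Bad_def)
  then have "open (- (Bad - {0}))" by (intro open_Compl finite_imp_closed)
  then have "\<forall>\<^sub>F \<epsilon> in nhds 0. \<epsilon> \<in> - (Bad - {0})"
    by (rule eventually_nhds_in_open) simp
  then have "\<forall>\<^sub>F \<epsilon> in at 0. \<epsilon> \<notin> Bad"
    unfolding eventually_at_filter by eventually_elim auto
  then have ev: "\<forall>\<^sub>F \<epsilon> in at 0. inj_on (h \<epsilon>) {..<n}"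
  proof eventually_elim
    case (elim \<epsilon>)
    show ?case
    proof (rule inj_onI, rule ccontr)
      fix i j assume ij: "i \<in> {..<n}" "j \<in> {..<n}" "h \<epsilon> i = h \<epsilon> j" "i \<noteq> j"
      have ne: "of_nat j - of_nat i \<noteq> (0 :: complex)" using ij(4) by simp
      have "x i - x j = of_real \<epsilon> * (of_nat j - of_nat i)"
        using ij(3) by (simp add: h_def algebra_simps)
      then have "(x i - x j) / (of_nat j - of_nat i) = of_real \<epsilon>" using ne by simp
      then have "\<epsilon> = Re ((x i - x j) / (of_nat j - of_nat i))" by simp
      then have "\<epsilon> \<in> Bad" unfolding Bad_def using ij(1,2) by (intro image_eqI[of _ _ "(i, j)"]) auto
      then show False using elim by simp
    qed
  qed
  have "filterlim h (at x within {y. inj_on y {..<n}}) (at 0)"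
    unfolding filterlim_at
  proof (intro conjI lim)
    show "\<forall>\<^sub>F \<epsilon> in at 0. h \<epsilon> \<in> {y. inj_on y {..<n}} \<and> h \<epsilon> \<noteq> x"
      using ev by eventually_elim (use assms in auto)
  qed
  then show ?thesis
    unfolding filterlim_def by (auto simp: bot_unique filtermap_bot_iff)
qed

text \<open>Points with pairwise distinct coordinates accumulate at every other point, and limits
  along them are unique. The open set \<open>U\<close> carries side conditions, such as being
  nonzero or off the circle of radius 2, from x to the nearby points.\<close>

lemma eq_by_density_of_inj:
  fixes f g :: "(nat \<Rightarrow> complex) \<Rightarrow> complex"
  assumes "(f \<longlongrightarrow> f x) (at x)" "(g \<longlongrightarrow> g x) (at x)"
    and U: "open U" "\<And>a. a < n \<Longrightarrow> x a \<in> U"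
    and eq: "\<And>y. inj_on y {..<n} \<Longrightarrow> (\<And>a. a < n \<Longrightarrow> y a \<in> U) \<Longrightarrow> f y = g y"
  shows "f x = g x"
proof (cases "inj_on x {..<n}")
  case True
  then show ?thesis using eq U by blast
next
  case False
  let ?F = "at x within {y. inj_on y {..<n}}"
  have "\<forall>\<^sub>F y in ?F. y a \<in> U" if "a < n" for a
    by (rule topological_tendstoD[OF tendsto_coordinate[of a x]]) (use U that in auto)
  then have "\<forall>\<^sub>F y in ?F. \<forall>a\<in>{..<n}. y a \<in> U"
    by (intro eventually_ball_finite) auto
  moreover have "\<forall>\<^sub>F y in ?F. inj_on y {..<n}"
    by (simp add: eventually_at_filter)
  ultimately have ev: "\<forall>\<^sub>F y in ?F. f y = g y"
    by eventually_elim (use eq in auto)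
  have "(g \<longlongrightarrow> f x) ?F"
    by (rule Lim_transform_eventually[OF tendsto_within_subset[OF assms(1)] ev]) auto
  moreover have "(g \<longlongrightarrow> g x) ?F"
    by (rule tendsto_within_subset[OF assms(2)]) auto
  ultimately show ?thesis
    using tendsto_unique[OF inj_points_accumulate[OF False]] by blast
qed

text \<open>Where variables coincide, \<open>schur\<close> is a limit of quotients; a solution
  \<open>f\<close> of the division problem at distinct variables that is continuous at x supplies
  this limit.\<close>

lemma schur_eqI:
  assumes n: "length l = n" and x: "\<And>a. a < n \<Longrightarrow> x a \<noteq> 0"
    and f: "(f \<longlongrightarrow> f x) (at x)"
    and eq: "\<And>y. inj_on y {..<n} \<Longrightarrow> (\<And>a. a < n \<Longrightarrow> y a \<noteq> 0) \<Longrightarrow>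
      schur_num l y = schur_den n y * f y"
  shows "schur l x = f x"
proof (cases "inj_on x {..<n}")
  case True
  then show ?thesis
    using eq[OF True x] schur_den_nonzero[OF True] n by (simp add: schur_def)
next
  case False
  let ?F = "at x within {y. inj_on y {..<n}}"
  have "\<forall>\<^sub>F y in ?F. y a \<in> - {0}" if "a < n" for a
    by (rule topological_tendstoD[OF tendsto_coordinate[of a x]]) (use x[OF that] in auto)
  then have "\<forall>\<^sub>F y in ?F. \<forall>a\<in>{..<n}. y a \<in> - {0}"
    by (intro eventually_ball_finite) auto
  moreover have "\<forall>\<^sub>F y in ?F. inj_on y {..<n}"
    by (simp add: eventually_at_filter)
  ultimately have "\<forall>\<^sub>F y in ?F. f y = schur_num l y / schur_den n y"
    by eventually_elim (use eq schur_den_nonzero in auto)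
  then have "((\<lambda>y. schur_num l y / schur_den n y) \<longlongrightarrow> f x) ?F"
    by (rule Lim_transform_eventually[OF tendsto_within_subset[OF f], rotated]) auto
  then have "Lim ?F (\<lambda>y. schur_num l y / schur_den n y) = f x"
    using inj_points_accumulate[OF False] by (intro tendsto_Lim) auto
  then show ?thesis using False n by (simp add: schur_def)
qed

lemma tendsto_root_factor:
  assumes "(f \<longlongrightarrow> z) F" "z \<noteq> 0"
  shows "((\<lambda>y. root_factor m r w (f y)) \<longlongrightarrow> root_factor m r w z) F"
  unfolding root_factor_def by (intro tendsto_intros assms)

text \<open>In \<open>alternant_expansion\<close> the denominator is an explicit factor, and the
  cofactor is continuous wherever all variables are nonzero, so it remains the value of
  \<open>schur\<close> at coinciding variables.\<close>

lemma schur_expansion: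
  assumes n: "length l = n" "n > 0"
  obtains T :: "(nat \<Rightarrow> nat) set" and c w m r where
    "finite T" "\<And>\<tau>. \<tau> \<in> T \<Longrightarrow> inj_on (w \<tau>) {..<r}" "\<And>\<tau> i. norm (w \<tau> i) = 2"
    "\<forall>x. (\<forall>a<n. x a \<noteq> 0) \<longrightarrow>
        schur l x = root_comb n m r T c w x"
proof -
  obtain T :: "(nat \<Rightarrow> nat) set" and c w m r where T:
    "finite T" "\<And>\<tau>. \<tau> \<in> T \<Longrightarrow> inj_on (w \<tau>) {..<r}" "\<And>\<tau> i. norm (w \<tau> i) = 2"
    "\<forall>x. (\<forall>a<n. x a \<noteq> 0) \<longrightarrow> alternant n (\<lambda>k. staircase n k + l ! k) x =
        schur_den n x * root_comb n m r T c w x"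
    by (rule alternant_expansion[OF n(2), where e = "\<lambda>k. staircase n k + l ! k"]) (rule that)
  show ?thesis
  proof (rule that[of T w r c m], goal_cases)
    case 4
    show ?case
    proof (intro allI impI)
      fix x :: "nat \<Rightarrow> complex" assume "\<forall>a<n. x a \<noteq> 0"
      then have x: "\<And>a. a < n \<Longrightarrow> x a \<noteq> 0" by simp
      show "schur l x = root_comb n m r T c w x"
      proof (rule schur_eqI[OF n(1) x])
        show "((\<lambda>x. \<Sum>\<tau>\<in>T. c \<tau> * (\<Prod>a<n. root_factor m r (w \<tau>) (x a))) \<longlongrightarrow>
          root_comb n m r T c w x) (at x)"
          by (intro tendsto_sum tendsto_mult tendsto_const tendsto_prod tendsto_root_factor
              tendsto_coordinate) (use x in auto)
        fix y :: "nat \<Rightarrow> complex" assume "\<And>a. a < n \<Longrightarrow> y a \<noteq> 0"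
        then show "schur_num l y =
            schur_den n y * root_comb n m r T c w y"
          using T(4) n by (simp add: schur_num_alternant)
      qed auto
    qed
  qed (use T in auto)
qed

subsection \<open>Euler operators acting on alternants\<close>

lemma has_field_derivative_prod_log:
  fixes f :: "'i \<Rightarrow> 'a::real_normed_field \<Rightarrow> 'a"
  assumes "\<And>b. b \<in> B \<Longrightarrow> (f b has_field_derivative f b z * L b) (at z)"
  shows "((\<lambda>z. \<Prod>b\<in>B. f b z) has_field_derivative (\<Prod>b\<in>B. f b z) * (\<Sum>b\<in>B. L b)) (at z)"
  using assms
proof (induction B rule: infinite_finite_induct)
  case (insert b B)
  have "((\<lambda>z. f b z * (\<Prod>b\<in>B. f b z)) has_field_derivative
      f b z * ((\<Prod>b\<in>B. f b z) * (\<Sum>b\<in>B. L b)) + f b z * L b * (\<Prod>b\<in>B. f b z)) (at z)"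
    using insert by (intro DERIV_mult') auto
  then show ?case using insert by (simp add: algebra_simps)
qed auto

text \<open>\<open>f1 z = z * f' z\<close> throughout, so equal functions have equal Euler derivatives.\<close>

lemma euler_derivative_unique:
  fixes f g f1 g1 :: "complex \<Rightarrow> complex"
  assumes "open U" "0 \<notin> U" "\<And>z. z \<in> U \<Longrightarrow> f z = g z"
    and "\<And>z. z \<in> U \<Longrightarrow> (f has_field_derivative f1 z / z) (at z)"
    and "\<And>z. z \<in> U \<Longrightarrow> (g has_field_derivative g1 z / z) (at z)"
    and "z \<in> U"
  shows "f1 z = g1 z"
proof -
  have "(g has_field_derivative f1 z / z) (at z)"
    by (rule has_field_derivative_transform_within_open[OF assms(4)[OF assms(6)] assms(1,6)])
      (rule assms(3))
  then have "f1 z / z = g1 z / z" using assms(5,6) DERIV_unique by blast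
  then show ?thesis using assms(2,6) by (cases "z = 0") auto
qed

lemma has_field_derivative_power_int_sum:
  fixes z :: complex
  assumes "z \<noteq> 0"
  shows "((\<lambda>z. \<Sum>k<n. of_int (e k) ^ p * z powi e k * C k) has_field_derivative
    (\<Sum>k<n. of_int (e k) ^ Suc p * z powi e k * C k) / z) (at z)"
proof -
  have "((\<lambda>z. z powi e k) has_field_derivative of_int (e k) * z powi e k / z) (at z)" for k
  proof -
    have "((\<lambda>z. z powi e k) has_field_derivative of_int (e k) * z powi (e k - 1) * 1) (at z)"
      by (rule DERIV_power_int[OF DERIV_ident]) (use assms in auto)
    then show ?thesis using assms by (simp add: power_int_diff)
  qed
  then have "((\<lambda>z. \<Sum>k<n. of_int (e k) ^ p * z powi e k * C k) has_field_derivative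
    (\<Sum>k<n. of_int (e k) ^ p * (of_int (e k) * z powi e k / z) * C k)) (at z)"
    by (intro DERIV_sum DERIV_cmult DERIV_cmult_right)
  then show ?thesis by (simp add: sum_divide_distrib mult_ac)
qed

text \<open>The logarithmic Euler derivative z p'(z) / p(z) of the product p(z) of all z - x_b with
  b different from \<open>a\<close> and of \<open>root_factor m r w z\<close>: up to a constant, p
  is the dependence on the variable x_a of the denominator times a product of root factors.
  \<open>log_euler2\<close> is its Euler derivative.\<close>

definition log_euler :: "nat \<Rightarrow> (nat \<Rightarrow> complex) \<Rightarrow> nat \<Rightarrow> nat \<Rightarrow> nat \<Rightarrow> (nat \<Rightarrow> complex) \<Rightarrow> complex \<Rightarrow> complex" where
  "log_euler n x a m r w z =
     (\<Sum>b\<in>{..<n} - {a}. z / (z - x b)) - of_nat m - (\<Sum>i<r. z / (w i - z))"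

definition log_euler2 :: "nat \<Rightarrow> (nat \<Rightarrow> complex) \<Rightarrow> nat \<Rightarrow> nat \<Rightarrow> (nat \<Rightarrow> complex) \<Rightarrow> complex \<Rightarrow> complex" where
  "log_euler2 n x a r w z =
     (\<Sum>b\<in>{..<n} - {a}. z / (z - x b) - (z / (z - x b))\<^sup>2) -
     (\<Sum>i<r. z / (w i - z) + (z / (w i - z))\<^sup>2)"

lemma has_field_derivative_log_euler:
  assumes "\<And>b. b \<in> {..<n} - {a} \<Longrightarrow> z \<noteq> x b" "\<And>i. i < r \<Longrightarrow> z \<noteq> w i" "z \<noteq> 0"
  shows "(log_euler n x a m r w has_field_derivative log_euler2 n x a r w z / z) (at z)"
proof -
  have 1: "((\<lambda>z. z / (z - c)) has_field_derivative (z / (z - c) - (z / (z - c))\<^sup>2) / z) (at z)"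
    if "z \<noteq> c" for c
  proof -
    have 0: "((\<lambda>z. z / (z - c)) has_field_derivative (1 * (z - c) - z * (1 - 0)) / ((z - c) * (z - c))) (at z)"
      using that by (intro DERIV_divide DERIV_ident DERIV_diff DERIV_const) auto
    have "(1 * u - z * (1 - 0)) / (u * u) = (z / u - (z / u)\<^sup>2) / z" if "u \<noteq> 0" for u
      using that assms(3) by (simp add: field_simps power2_eq_square)
    from this[of "z - c"] have *: "(1 * (z - c) - z * (1 - 0)) / ((z - c) * (z - c)) =
        (z / (z - c) - (z / (z - c))\<^sup>2) / z" using that by simp
    show ?thesis by (rule DERIV_cong[OF 0 *])
  qed
  have 2: "((\<lambda>z. z / (c - z)) has_field_derivative (z / (c - z) + (z / (c - z))\<^sup>2) / z) (at z)"
    if "z \<noteq> c" for c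
  proof -
    have 0: "((\<lambda>z. z / (c - z)) has_field_derivative (1 * (c - z) - z * (0 - 1)) / ((c - z) * (c - z))) (at z)"
      using that by (intro DERIV_divide DERIV_ident DERIV_diff DERIV_const) auto
    have "(1 * u - z * (0 - 1)) / (u * u) = (z / u + (z / u)\<^sup>2) / z" if "u \<noteq> 0" for u
      using that assms(3) by (simp add: field_simps power2_eq_square)
    from this[of "c - z"] have *: "(1 * (c - z) - z * (0 - 1)) / ((c - z) * (c - z)) =
        (z / (c - z) + (z / (c - z))\<^sup>2) / z" using that by simp
    show ?thesis by (rule DERIV_cong[OF 0 *])
  qed
  have "(log_euler n x a m r w has_field_derivative
     (\<Sum>b\<in>{..<n} - {a}. (z / (z - x b) - (z / (z - x b))\<^sup>2) / z) - 0 -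
     (\<Sum>i<r. (z / (w i - z) + (z / (w i - z))\<^sup>2) / z)) (at z)"
    unfolding log_euler_def[abs_def]
    by (intro DERIV_diff DERIV_sum DERIV_const 1 2) (use assms in auto)
  then show ?thesis
    by (simp only: log_euler2_def diff_divide_distrib sum_divide_distrib diff_0_right)
qed

lemma has_field_derivative_row_factor:
  assumes "\<And>b. b \<in> {..<n} - {a} \<Longrightarrow> z \<noteq> x b" "\<And>i. i < r \<Longrightarrow> z \<noteq> w i" "z \<noteq> 0"
  shows "((\<lambda>z. (\<Prod>b\<in>{..<n} - {a}. z - x b) * root_factor m r w z) has_field_derivative
     (\<Prod>b\<in>{..<n} - {a}. z - x b) * root_factor m r w z * log_euler n x a m r w z / z) (at z)"
proof -
  have 1: "((\<lambda>z. \<Prod>b\<in>{..<n} - {a}. z - x b) has_field_derivative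
      (\<Prod>b\<in>{..<n} - {a}. z - x b) * (\<Sum>b\<in>{..<n} - {a}. 1 / (z - x b))) (at z)"
  proof (rule has_field_derivative_prod_log)
    fix b assume "b \<in> {..<n} - {a}"
    then have "z \<noteq> x b" by (rule assms)
    then show "((\<lambda>z. z - x b) has_field_derivative (z - x b) * (1 / (z - x b))) (at z)"
      by (auto intro!: derivative_eq_intros)
  qed
  have 2: "((\<lambda>z. \<Prod>i<r. w i - z) has_field_derivative
      (\<Prod>i<r. w i - z) * (\<Sum>i<r. - 1 / (w i - z))) (at z)"
  proof (rule has_field_derivative_prod_log)
    fix i assume "i \<in> {..<r}"
    then have "z \<noteq> w i" using assms by auto
    then show "((\<lambda>z. w i - z) has_field_derivative (w i - z) * (- 1 / (w i - z))) (at z)"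
      by (auto intro!: derivative_eq_intros)
  qed
  have 3: "((\<lambda>z. inverse z ^ m) has_field_derivative inverse z ^ m * (- of_nat m / z)) (at z)"
  proof (cases m)
    case (Suc m')
    have "((\<lambda>z. inverse z ^ m) has_field_derivative
        of_nat m * (- (inverse z * 1 * inverse z) * inverse z ^ (m - Suc 0))) (at z)"
      by (intro DERIV_power DERIV_inverse' DERIV_ident) (use assms in auto)
    then show ?thesis by (rule DERIV_cong) (simp add: Suc divide_inverse algebra_simps)
  qed simp
  have "((\<lambda>z. (\<Prod>b\<in>{..<n} - {a}. z - x b) * root_factor m r w z) has_field_derivative
     (\<Prod>b\<in>{..<n} - {a}. z - x b) * root_factor m r w z *
     ((\<Sum>b\<in>{..<n} - {a}. 1 / (z - x b)) + (- of_nat m / z + (\<Sum>i<r. - 1 / (w i - z))))) (at z)"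
    unfolding root_factor_def
    by (rule DERIV_cong[OF DERIV_mult'[OF 1 DERIV_mult'[OF 3 2]]]) (simp add: algebra_simps)
  moreover have "(\<Sum>b\<in>{..<n} - {a}. 1 / (z - x b)) + (- of_nat m / z + (\<Sum>i<r. - 1 / (w i - z))) =
      log_euler n x a m r w z / z"
    using assms(3) unfolding log_euler_def
    by (simp add: diff_divide_distrib sum_divide_distrib sum_negf)
  ultimately show ?thesis by simp
qed

text \<open>Freeze all variables but x_a. Along row \<open>a\<close> the alternant is a combination
  of powers z^(e_k) with coefficients \<open>C k\<close>, and on the other side each summand is a
  constant times a product p(z). Applying z d/dz once and twice multiplies the powers by e_k and
  e_k^2, and turns p into p L and p (L^2 + L2), where L and L2 are \<open>log_euler\<close> and
  \<open>log_euler2\<close>.\<close>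

lemma alternant_euler_row:
  fixes T :: "'t set"
  assumes T: "finite T" and a: "a < n"
    and ex: "\<And>y. (\<forall>b<n. y b \<noteq> 0) \<Longrightarrow> alternant n e y =
        schur_den n y * root_comb n m r T c w y"
    and x: "inj_on x {..<n}" "\<And>b. b < n \<Longrightarrow> x b \<noteq> 0" "\<And>\<tau> i. \<tau> \<in> T \<Longrightarrow> i < r \<Longrightarrow> x a \<noteq> w \<tau> i"
    and C: "\<And>g. fdet n ((\<lambda>j k. x j powi e k)(a := g)) = (\<Sum>k<n. g k * C k)"
  defines "F \<equiv> \<lambda>\<tau>. schur_den n x * (c \<tau> * (\<Prod>b<n. root_factor m r (w \<tau>) (x b)))"
  shows "(\<Sum>k<n. of_int (e k) * x a powi e k * C k) =
      (\<Sum>\<tau>\<in>T. F \<tau> * log_euler n x a m r (w \<tau>) (x a))" (is ?thesis1)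
    and "(\<Sum>k<n. (of_int (e k))\<^sup>2 * x a powi e k * C k) =
      (\<Sum>\<tau>\<in>T. F \<tau> * ((log_euler n x a m r (w \<tau>) (x a))\<^sup>2 + log_euler2 n x a r (w \<tau>) (x a)))"
      (is ?thesis2)
proof -
  obtain \<epsilon> :: complex where eps: "\<And>x. schur_den n x = \<epsilon> * fdet n (\<lambda>j k. x j ^ k)"
    by (rule schur_den_vandermonde[of n]) (rule that)
  obtain K where K: "\<And>z. fdet n (\<lambda>j k. (x(a := z)) j ^ k) = K * (\<Prod>b\<in>{..<n} - {a}. z - x b)"
    by (rule vandermonde_update[OF a, of x]) (rule that)
  define p where "p = (\<lambda>\<tau> z. (\<Prod>b\<in>{..<n} - {a}. z - x b) * root_factor m r (w \<tau>) z)"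
  define d where "d = (\<lambda>\<tau>. \<epsilon> * K * c \<tau> * (\<Prod>b\<in>{..<n} - {a}. root_factor m r (w \<tau>) (x b)))"
  define \<Lambda> where "\<Lambda> = (\<lambda>\<tau>. log_euler n x a m r (w \<tau>))"
  define \<Lambda>2 where "\<Lambda>2 = (\<lambda>\<tau>. log_euler2 n x a r (w \<tau>))"
  \<comment> \<open>Derivatives can be compared only on an open set. This one avoids 0, the other
    variables and all roots; it contains x_a because the variables are distinct, nonzero and
    different from the roots.\<close>
  define U where "U = - (insert 0 (x ` ({..<n} - {a}) \<union> (\<Union>\<tau>\<in>T. w \<tau> ` {..<r})))"
  have U: "open U" unfolding U_def using T by (intro open_Compl finite_imp_closed) auto
  have xaU: "x a \<in> U"
    using x(1,2) a x(3) unfolding U_def inj_on_def by blast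
  have f0: "(\<Sum>k<n. of_int (e k) ^ 0 * z powi e k * C k) = (\<Sum>\<tau>\<in>T. d \<tau> * p \<tau> z)" if "z \<in> U" for z
  proof -
    have z: "z \<noteq> 0" using that by (auto simp: U_def)
    have "(\<Sum>k<n. of_int (e k) ^ 0 * z powi e k * C k) = fdet n ((\<lambda>j k. x j powi e k)(a := \<lambda>k. z powi e k))"
      by (simp add: C)
    also have "\<dots> = alternant n e (x(a := z))"
      unfolding alternant_def by (rule fdet_cong) simp
    also have "\<dots> = schur_den n (x(a := z)) * (\<Sum>\<tau>\<in>T. c \<tau> * (\<Prod>b<n. root_factor m r (w \<tau>) ((x(a := z)) b)))"
      by (rule ex) (use z x in auto)
    also have "\<dots> = (\<Sum>\<tau>\<in>T. d \<tau> * p \<tau> z)"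
    proof -
      have "(\<Prod>b<n. root_factor m r (w \<tau>) ((x(a := z)) b)) =
          root_factor m r (w \<tau>) z * (\<Prod>b\<in>{..<n} - {a}. root_factor m r (w \<tau>) (x b))" for \<tau>
        using a by (subst prod.remove[of _ a]) (auto intro!: prod.cong)
      then show ?thesis
        unfolding eps K sum_distrib_left by (intro sum.cong) (auto simp: d_def p_def)
    qed
    finally show ?thesis .
  qed
  have p_deriv: "(p \<tau> has_field_derivative p \<tau> z * \<Lambda> \<tau> z / z) (at z)"
    and L_deriv: "(\<Lambda> \<tau> has_field_derivative \<Lambda>2 \<tau> z / z) (at z)" if "z \<in> U" "\<tau> \<in> T" for z \<tau>
    using that unfolding p_def \<Lambda>_def \<Lambda>2_def
    by (intro has_field_derivative_row_factor has_field_derivative_log_euler; force simp: U_def)+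
  have f1: "(\<Sum>k<n. of_int (e k) ^ Suc 0 * z powi e k * C k) = (\<Sum>\<tau>\<in>T. d \<tau> * (p \<tau> z * \<Lambda> \<tau> z))"
    if "z \<in> U" for z
  proof (rule euler_derivative_unique[OF U _ f0 _ _ that])
    show "0 \<notin> U" by (simp add: U_def)
    fix z assume z: "z \<in> U"
    show "((\<lambda>z. \<Sum>k<n. of_int (e k) ^ 0 * z powi e k * C k) has_field_derivative
        (\<Sum>k<n. of_int (e k) ^ Suc 0 * z powi e k * C k) / z) (at z)"
      by (rule has_field_derivative_power_int_sum) (use z in \<open>auto simp: U_def\<close>)
    have "((\<lambda>z. \<Sum>\<tau>\<in>T. d \<tau> * p \<tau> z) has_field_derivative
        (\<Sum>\<tau>\<in>T. d \<tau> * (p \<tau> z * \<Lambda> \<tau> z / z))) (at z)"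
      by (intro DERIV_sum DERIV_cmult p_deriv z)
    then show "((\<lambda>z. \<Sum>\<tau>\<in>T. d \<tau> * p \<tau> z) has_field_derivative
        (\<Sum>\<tau>\<in>T. d \<tau> * (p \<tau> z * \<Lambda> \<tau> z)) / z) (at z)"
      by (simp add: sum_divide_distrib)
  qed
  have f2: "(\<Sum>k<n. of_int (e k) ^ Suc (Suc 0) * z powi e k * C k) =
      (\<Sum>\<tau>\<in>T. d \<tau> * (p \<tau> z * ((\<Lambda> \<tau> z)\<^sup>2 + \<Lambda>2 \<tau> z)))"
    if "z \<in> U" for z
  proof (rule euler_derivative_unique[OF U _ f1 _ _ that])
    show "0 \<notin> U" by (simp add: U_def)
    fix z assume z: "z \<in> U"
    show "((\<lambda>z. \<Sum>k<n. of_int (e k) ^ Suc 0 * z powi e k * C k) has_field_derivative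
        (\<Sum>k<n. of_int (e k) ^ Suc (Suc 0) * z powi e k * C k) / z) (at z)"
      by (rule has_field_derivative_power_int_sum) (use z in \<open>auto simp: U_def\<close>)
    have "((\<lambda>z. \<Sum>\<tau>\<in>T. d \<tau> * (p \<tau> z * \<Lambda> \<tau> z)) has_field_derivative
        (\<Sum>\<tau>\<in>T. d \<tau> * (p \<tau> z * (\<Lambda>2 \<tau> z / z) + p \<tau> z * \<Lambda> \<tau> z / z * \<Lambda> \<tau> z))) (at z)"
      by (intro DERIV_sum DERIV_cmult DERIV_mult' p_deriv L_deriv z)
    then show "((\<lambda>z. \<Sum>\<tau>\<in>T. d \<tau> * (p \<tau> z * \<Lambda> \<tau> z)) has_field_derivative
        (\<Sum>\<tau>\<in>T. d \<tau> * (p \<tau> z * ((\<Lambda> \<tau> z)\<^sup>2 + \<Lambda>2 \<tau> z))) / z) (at z)"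
      by (rule DERIV_cong) (simp add: sum_divide_distrib power2_eq_square algebra_simps add_divide_distrib)
  qed
  have dp: "d \<tau> * p \<tau> (x a) = F \<tau>" for \<tau>
  proof -
    have "(\<Prod>b<n. root_factor m r (w \<tau>) (x b)) =
        root_factor m r (w \<tau>) (x a) * (\<Prod>b\<in>{..<n} - {a}. root_factor m r (w \<tau>) (x b))"
      using a by (subst prod.remove[of _ a]) auto
    moreover have "schur_den n x = \<epsilon> * (K * (\<Prod>b\<in>{..<n} - {a}. x a - x b))"
      using K[of "x a"] eps[of x] by simp
    ultimately show ?thesis by (simp add: F_def d_def p_def)
  qed
  show ?thesis1
    using f1[OF xaU] unfolding mult.assoc[symmetric] dp by (simp add: \<Lambda>_def mult_ac)
  show ?thesis2
    using f2[OF xaU] unfolding mult.assoc[symmetric] dp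
    by (simp add: \<Lambda>_def \<Lambda>2_def power2_eq_square mult_ac)
qed

text \<open>Every monomial of an alternant carries the exponents e in some order, so the alternant
  is an eigenfunction of the sum over a of (x_a d/dx_a)^p, with eigenvalue the sum of the e_k^p;
  here p is 1 or 2. In cofactor form this is the fact \<open>col\<close>.\<close>

lemma alternant_euler:
  fixes T :: "'t set"
  assumes T: "finite T"
    and ex: "\<And>y. (\<forall>b<n. y b \<noteq> 0) \<Longrightarrow> alternant n e y =
        schur_den n y * root_comb n m r T c w y"
    and x: "inj_on x {..<n}" "\<And>b. b < n \<Longrightarrow> x b \<noteq> 0"
      "\<And>a \<tau> i. a < n \<Longrightarrow> \<tau> \<in> T \<Longrightarrow> i < r \<Longrightarrow> x a \<noteq> w \<tau> i"
  defines "F \<equiv> \<lambda>\<tau>. c \<tau> * (\<Prod>b<n. root_factor m r (w \<tau>) (x b))"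
  shows "of_int (\<Sum>k<n. e k) * (\<Sum>\<tau>\<in>T. F \<tau>) =
      (\<Sum>\<tau>\<in>T. F \<tau> * (\<Sum>a<n. log_euler n x a m r (w \<tau>) (x a)))" (is ?thesis1)
    and "of_int (\<Sum>k<n. (e k)\<^sup>2) * (\<Sum>\<tau>\<in>T. F \<tau>) =
      (\<Sum>\<tau>\<in>T. F \<tau> * (\<Sum>a<n. (log_euler n x a m r (w \<tau>) (x a))\<^sup>2 + log_euler2 n x a r (w \<tau>) (x a)))"
      (is ?thesis2)
proof -
  obtain C where C:
    "\<And>a g. a < n \<Longrightarrow> fdet n ((\<lambda>j k. x j powi e k)(a := g)) = (\<Sum>k<n. g k * C a k)"
    "\<And>k. k < n \<Longrightarrow> (\<Sum>a<n. x a powi e k * C a k) = fdet n (\<lambda>j k. x j powi e k)"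
    by (rule fdet_cofactors[of n "\<lambda>j k. x j powi e k"]) (rule that)
  have alt: "fdet n (\<lambda>j k. x j powi e k) = schur_den n x * (\<Sum>\<tau>\<in>T. F \<tau>)"
    using ex[of x] x unfolding alternant_def F_def by simp
  have den: "schur_den n x \<noteq> 0" by (rule schur_den_nonzero[OF x(1)])
  have col: "(\<Sum>a<n. \<Sum>k<n. g k * x a powi e k * C a k) = (\<Sum>k<n. g k) * fdet n (\<lambda>j k. x j powi e k)"
    for g :: "nat \<Rightarrow> complex"
  proof -
    have "(\<Sum>a<n. \<Sum>k<n. g k * x a powi e k * C a k) = (\<Sum>k<n. g k * (\<Sum>a<n. x a powi e k * C a k))"
      by (subst sum.swap) (simp add: sum_distrib_left mult_ac)
    then show ?thesis by (simp add: C(2) sum_distrib_right)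
  qed
  note row = alternant_euler_row[OF T _ ex x(1,2) x(3) C(1)]
  have "schur_den n x * (of_int (\<Sum>k<n. e k) * (\<Sum>\<tau>\<in>T. F \<tau>)) =
      (\<Sum>a<n. \<Sum>k<n. of_int (e k) * x a powi e k * C a k)"
    unfolding col alt by simp
  also have "\<dots> = (\<Sum>a<n. \<Sum>\<tau>\<in>T. schur_den n x * F \<tau> * log_euler n x a m r (w \<tau>) (x a))"
    unfolding F_def by (rule sum.cong) (simp_all add: row(1))
  also have "\<dots> = schur_den n x * (\<Sum>\<tau>\<in>T. F \<tau> * (\<Sum>a<n. log_euler n x a m r (w \<tau>) (x a)))"
    by (subst sum.swap) (simp add: sum_distrib_left mult_ac)
  finally show ?thesis1 using den by simp
  have "schur_den n x * (of_int (\<Sum>k<n. (e k)\<^sup>2) * (\<Sum>\<tau>\<in>T. F \<tau>)) =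
      (\<Sum>a<n. \<Sum>k<n. (of_int (e k))\<^sup>2 * x a powi e k * C a k)"
    unfolding col alt by simp
  also have "\<dots> = (\<Sum>a<n. \<Sum>\<tau>\<in>T. schur_den n x * F \<tau> *
      ((log_euler n x a m r (w \<tau>) (x a))\<^sup>2 + log_euler2 n x a r (w \<tau>) (x a)))"
    unfolding F_def by (rule sum.cong) (simp_all add: row(2))
  also have "\<dots> = schur_den n x * (\<Sum>\<tau>\<in>T. F \<tau> * (\<Sum>a<n. (log_euler n x a m r (w \<tau>) (x a))\<^sup>2 +
      log_euler2 n x a r (w \<tau>) (x a)))"
    by (subst sum.swap) (simp add: sum_distrib_left mult_ac)
  finally show ?thesis2 using den by simp
qed


section \<open>Closed form of the Euler operators on products of root factors\<close>

definition ratio_sum :: "nat \<Rightarrow> nat \<Rightarrow> (nat \<Rightarrow> complex) \<Rightarrow> (nat \<Rightarrow> complex) \<Rightarrow> complex" where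
  "ratio_sum n r w x = (\<Sum>a<n. \<Sum>i<r. x a / (w i - x a))"

text \<open>The terms with a single variable and a single root cancel. What is left is a sum over
  one variable and two distinct roots minus a sum over two distinct variables and one root.\<close>

definition ratio_quad :: "nat \<Rightarrow> nat \<Rightarrow> (nat \<Rightarrow> complex) \<Rightarrow> (nat \<Rightarrow> complex) \<Rightarrow> complex" where
  "ratio_quad n r w x =
     (\<Sum>a<n. (\<Sum>i<r. x a / (w i - x a))\<^sup>2) - (\<Sum>i<r. (\<Sum>a<n. x a / (w i - x a))\<^sup>2)"

text \<open>The multiplier by which the sum of the (x_a d/dx_a)^2, conjugated by the denominator and
  diminished by the sum of squares of the staircase, acts on one product of root factors; see
  \<open>sum_log_euler2\<close>.\<close>

definition casimir_factor :: "nat \<Rightarrow> nat \<Rightarrow> nat \<Rightarrow> (nat \<Rightarrow> complex) \<Rightarrow> (nat \<Rightarrow> complex) \<Rightarrow> complex" where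
  "casimir_factor n m r w x = of_nat m ^ 2 * of_nat n - of_nat m * of_nat n * (of_nat n - 1) +
     (2 * of_nat m - 2 * of_nat n + 1) * ratio_sum n r w x + ratio_quad n r w x"

lemma sum_log_euler:
  assumes "inj_on x {..<n}" "\<And>b. b < n \<Longrightarrow> x b \<noteq> 0"
  shows "(\<Sum>a<n. log_euler n x a m r w (x a)) =
      of_int (\<Sum>k<n. staircase n k) - of_nat m * of_nat n - ratio_sum n r w x"
proof -
  \<comment> \<open>The expansion with m = r = 0 and one term writes the staircase alternant as the
    denominator times 1. It evaluates the part that involves only differences of the
    variables.\<close>
  have "of_int (\<Sum>k<n. staircase n k) = (\<Sum>a<n. \<Sum>b\<in>{..<n} - {a}. x a / (x a - x b))"
    using alternant_euler(1)[of "{()}" n "staircase n" "\<lambda>_. 1" 0 0 "\<lambda>_. w" x] assms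
    by (simp add: root_factor_def schur_den_alternant log_euler_def)
  then show ?thesis
    by (simp add: log_euler_def sum_subtractf ratio_sum_def)
qed

lemma sum_off_diagonal:
  fixes f :: "nat \<Rightarrow> complex"
  shows "(\<Sum>a<n. \<Sum>b\<in>{..<n} - {a}. f a + f b + f a * f b) =
    2 * (of_nat n - 1) * (\<Sum>a<n. f a) + (\<Sum>a<n. f a)\<^sup>2 - (\<Sum>a<n. (f a)\<^sup>2)"
proof -
  have "(\<Sum>b\<in>{..<n} - {a}. f a + f b + f a * f b) =
      of_nat n * f a + (\<Sum>b<n. f b) + f a * (\<Sum>b<n. f b) - (2 * f a + (f a)\<^sup>2)" if "a < n" for a
    using that by (simp add: sum_diff1 sum.distrib sum_distrib_left power2_eq_square algebra_simps)
  then have "(\<Sum>a<n. \<Sum>b\<in>{..<n} - {a}. f a + f b + f a * f b) =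
     (\<Sum>a<n. of_nat n * f a + (\<Sum>b<n. f b) + f a * (\<Sum>b<n. f b) - (2 * f a + (f a)\<^sup>2))"
    by (intro sum.cong) auto
  also have "\<dots> = of_nat n * (\<Sum>a<n. f a) + of_nat n * (\<Sum>b<n. f b) + (\<Sum>a<n. f a) * (\<Sum>b<n. f b)
     - (2 * (\<Sum>a<n. f a) + (\<Sum>a<n. (f a)\<^sup>2))"
    by (simp add: sum.distrib sum_subtractf sum_distrib_left[symmetric] sum_distrib_right[symmetric])
  finally show ?thesis by (simp add: algebra_simps power2_eq_square)
qed

text \<open>Symmetrising in \<open>a\<close> and \<open>b\<close> cancels the denominators \<open>x a - x b\<close>.\<close>

lemma sum_cross_terms:
  assumes x: "inj_on x {..<n}" "\<And>a i. a < n \<Longrightarrow> i < r \<Longrightarrow> x a \<noteq> w i"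
  shows "2 * (\<Sum>a<n. (\<Sum>b\<in>{..<n} - {a}. x a / (x a - x b)) * (of_nat m + (\<Sum>i<r. x a / (w i - x a)))) =
    of_nat m * of_nat n * (of_nat n - 1) + 2 * (of_nat n - 1) * ratio_sum n r w x +
    (\<Sum>i<r. (\<Sum>a<n. x a / (w i - x a))\<^sup>2) - (\<Sum>a<n. \<Sum>i<r. (x a / (w i - x a))\<^sup>2)"
proof -
  define q where "q = (\<lambda>a i. x a / (w i - x a))"
  define y where "y = (\<lambda>a. of_nat m + (\<Sum>i<r. q a i))"
  define S where "S = (\<Sum>a<n. \<Sum>b\<in>{..<n} - {a}. x a * y a / (x a - x b))"
  have "S = (\<Sum>(a, b)\<in>(SIGMA a:{..<n}. {..<n} - {a}). x a * y a / (x a - x b))"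
    unfolding S_def by (simp add: sum.Sigma)
  also have "\<dots> = (\<Sum>(a, b)\<in>(SIGMA a:{..<n}. {..<n} - {a}). x b * y b / (x b - x a))"
    by (rule sum.reindex_bij_witness[of _ "\<lambda>(a, b). (b, a)" "\<lambda>(a, b). (b, a)"]) auto
  also have "\<dots> = (\<Sum>a<n. \<Sum>b\<in>{..<n} - {a}. x b * y b / (x b - x a))"
    by (simp add: sum.Sigma)
  finally have "2 * S = (\<Sum>a<n. \<Sum>b\<in>{..<n} - {a}. x a * y a / (x a - x b) + x b * y b / (x b - x a))"
    by (simp add: sum.distrib S_def[symmetric])
  also have "\<dots> = (\<Sum>a<n. \<Sum>b\<in>{..<n} - {a}. of_nat m + (\<Sum>i<r. q a i + q b i + q a i * q b i))"
  proof (intro sum.cong refl)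
    fix a b assume ab: "a \<in> {..<n}" "b \<in> {..<n} - {a}"
    then have ne: "x a - x b \<noteq> 0" using inj_onD[OF x(1), of a b] by auto
    \<comment> \<open>After clearing (w - x_a)(w - x_b), both sides are x_a - x_b times w (x_a +
      x_b) - x_a x_b.\<close>
    have step: "x a * q a i / (x a - x b) - x b * q b i / (x a - x b) = q a i + q b i + q a i * q b i"
      if "i < r" for i
    proof -
      have nz: "w i - x a \<noteq> 0" "w i - x b \<noteq> 0" using x(2)[of a i] x(2)[of b i] ab that by auto
      have "(x a * q a i - x b * q b i) * ((w i - x a) * (w i - x b)) =
          (q a i + q b i + q a i * q b i) * (x a - x b) * ((w i - x a) * (w i - x b))"
        using nz unfolding q_def by (simp add: divide_simps) (simp add: algebra_simps)
      then have "x a * q a i - x b * q b i = (q a i + q b i + q a i * q b i) * (x a - x b)"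
        using nz by simp
      then show ?thesis using ne by (simp add: diff_divide_distrib[symmetric])
    qed
    have "x b * y b / (x b - x a) = - (x b * y b / (x a - x b))"
      using ne by (metis minus_diff_eq divide_minus_right)
    then have "x a * y a / (x a - x b) + x b * y b / (x b - x a) = (x a * y a - x b * y b) / (x a - x b)"
      by (simp add: diff_divide_distrib)
    also have "x a * y a - x b * y b = of_nat m * (x a - x b) + (\<Sum>i<r. x a * q a i - x b * q b i)"
      by (simp add: y_def algebra_simps sum_distrib_left sum_subtractf)
    also have "\<dots> / (x a - x b) = of_nat m + (\<Sum>i<r. x a * q a i / (x a - x b) - x b * q b i / (x a - x b))"
      using ne by (simp add: add_divide_distrib sum_divide_distrib diff_divide_distrib)
    also have "\<dots> = of_nat m + (\<Sum>i<r. q a i + q b i + q a i * q b i)"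
      by (simp add: step)
    finally show "x a * y a / (x a - x b) + x b * y b / (x b - x a) = \<dots>" .
  qed
  also have "\<dots> = (\<Sum>a<n. of_nat (n - 1) * of_nat m) +
      (\<Sum>i<r. \<Sum>a<n. \<Sum>b\<in>{..<n} - {a}. q a i + q b i + q a i * q b i)"
  proof -
    have "(\<Sum>b\<in>{..<n} - {a}. of_nat m + (\<Sum>i<r. q a i + q b i + q a i * q b i)) =
        of_nat (n - 1) * of_nat m + (\<Sum>i<r. \<Sum>b\<in>{..<n} - {a}. q a i + q b i + q a i * q b i)"
      if "a < n" for a
      using that by (subst sum.swap) (simp add: sum.distrib)
    then have "(\<Sum>a<n. \<Sum>b\<in>{..<n} - {a}. of_nat m + (\<Sum>i<r. q a i + q b i + q a i * q b i)) =
      (\<Sum>a<n. of_nat (n - 1) * of_nat m + (\<Sum>i<r. \<Sum>b\<in>{..<n} - {a}. q a i + q b i + q a i * q b i))"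
      by (intro sum.cong) auto
    also have "\<dots> = (\<Sum>a<n. of_nat (n - 1) * of_nat m) +
        (\<Sum>a<n. \<Sum>i<r. \<Sum>b\<in>{..<n} - {a}. q a i + q b i + q a i * q b i)"
      by (rule sum.distrib)
    also have "(\<Sum>a<n. \<Sum>i<r. \<Sum>b\<in>{..<n} - {a}. q a i + q b i + q a i * q b i) =
        (\<Sum>i<r. \<Sum>a<n. \<Sum>b\<in>{..<n} - {a}. q a i + q b i + q a i * q b i)"
      by (rule sum.swap)
    finally show ?thesis .
  qed
  also have "\<dots> = of_nat m * of_nat n * (of_nat n - 1) +
      (\<Sum>i<r. 2 * (of_nat n - 1) * (\<Sum>a<n. q a i) + (\<Sum>a<n. q a i)\<^sup>2 - (\<Sum>a<n. (q a i)\<^sup>2))"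
    unfolding sum_off_diagonal by (cases n) (auto simp: algebra_simps)
  also have "\<dots> = of_nat m * of_nat n * (of_nat n - 1) + 2 * (of_nat n - 1) * ratio_sum n r w x +
      (\<Sum>i<r. (\<Sum>a<n. q a i)\<^sup>2) - (\<Sum>a<n. \<Sum>i<r. (q a i)\<^sup>2)"
  proof -
    have "(\<Sum>i<r. \<Sum>a<n. q a i) = ratio_sum n r w x"
      unfolding ratio_sum_def q_def by (rule sum.swap)
    moreover have "(\<Sum>i<r. \<Sum>a<n. (q a i)\<^sup>2) = (\<Sum>a<n. \<Sum>i<r. (q a i)\<^sup>2)"
      by (rule sum.swap)
    ultimately show ?thesis
      by (simp add: sum.distrib sum_subtractf sum_distrib_left[symmetric])
  qed
  finally have "2 * S = \<dots>" .
  moreover have "S = (\<Sum>a<n. (\<Sum>b\<in>{..<n} - {a}. x a / (x a - x b)) * y a)"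
    unfolding S_def by (simp add: sum_distrib_right)
  ultimately show ?thesis by (simp only: y_def q_def)
qed

lemma sum_log_euler2:
  assumes x: "inj_on x {..<n}" "\<And>b. b < n \<Longrightarrow> x b \<noteq> 0" "\<And>a i. a < n \<Longrightarrow> i < r \<Longrightarrow> x a \<noteq> w i"
  shows "(\<Sum>a<n. (log_euler n x a m r w (x a))\<^sup>2 + log_euler2 n x a r w (x a)) =
      of_int (\<Sum>k<n. (staircase n k)\<^sup>2) + casimir_factor n m r w x"
proof -
  define \<delta> where "\<delta> = (\<lambda>a. \<Sum>b\<in>{..<n} - {a}. x a / (x a - x b))"
  define \<eta> where "\<eta> = (\<lambda>a. \<Sum>b\<in>{..<n} - {a}. x a / (x a - x b) - (x a / (x a - x b))\<^sup>2)"
  define y where "y = (\<lambda>a. of_nat m + (\<Sum>i<r. x a / (w i - x a)))"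
  define s where "s = (\<lambda>a. (\<Sum>i<r. x a / (w i - x a)) + (\<Sum>i<r. (x a / (w i - x a))\<^sup>2))"
  \<comment> \<open>Again the trivial expansion of the denominator: it evaluates all terms that are
    free of m and of the roots.\<close>
  have 1: "of_int (\<Sum>k<n. (staircase n k)\<^sup>2) = (\<Sum>a<n. (\<delta> a)\<^sup>2 + \<eta> a)"
    using alternant_euler(2)[of "{()}" n "staircase n" "\<lambda>_. 1" 0 0 "\<lambda>_. w" x] assms
    by (simp add: root_factor_def schur_den_alternant log_euler_def log_euler2_def \<delta>_def \<eta>_def)
  \<comment> \<open>Here \<open>log_euler\<close> is \<delta> - y. Squaring leaves the trivial part,
    the cross term of \<open>sum_cross_terms\<close>, and terms in the roots alone.\<close>
  have "(\<Sum>a<n. (log_euler n x a m r w (x a))\<^sup>2 + log_euler2 n x a r w (x a)) =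
      (\<Sum>a<n. ((\<delta> a)\<^sup>2 + \<eta> a) - 2 * (\<delta> a * y a) + (y a)\<^sup>2 - s a)"
    by (rule sum.cong) (simp_all add: log_euler_def log_euler2_def \<delta>_def \<eta>_def y_def s_def
        power2_eq_square algebra_simps sum.distrib)
  also have "\<dots> = of_int (\<Sum>k<n. (staircase n k)\<^sup>2) - 2 * (\<Sum>a<n. \<delta> a * y a) +
      (\<Sum>a<n. (y a)\<^sup>2) - (\<Sum>a<n. s a)"
    unfolding 1 by (simp add: sum.distrib sum_subtractf sum_distrib_left)
  also have "2 * (\<Sum>a<n. \<delta> a * y a) = of_nat m * of_nat n * (of_nat n - 1) + 2 * (of_nat n - 1) * ratio_sum n r w x +
    (\<Sum>i<r. (\<Sum>a<n. x a / (w i - x a))\<^sup>2) - (\<Sum>a<n. \<Sum>i<r. (x a / (w i - x a))\<^sup>2)"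
    unfolding \<delta>_def y_def by (rule sum_cross_terms[OF x(1,3)])
  also have "(\<Sum>a<n. (y a)\<^sup>2) = of_nat m ^ 2 * of_nat n + 2 * of_nat m * ratio_sum n r w x +
      (\<Sum>a<n. (\<Sum>i<r. x a / (w i - x a))\<^sup>2)"
    unfolding y_def ratio_sum_def by (simp add: power2_sum sum.distrib sum_distrib_left mult_ac)
  also have "(\<Sum>a<n. s a) = ratio_sum n r w x + (\<Sum>a<n. \<Sum>i<r. (x a / (w i - x a))\<^sup>2)"
    by (simp add: s_def ratio_sum_def sum.distrib)
  finally show ?thesis
    by (simp add: casimir_factor_def ratio_quad_def algebra_simps)
qed


text \<open>\<open>alternant_euler\<close> needs distinct variables. Both sides are continuous at
  points of the torus, where no root of absolute value 2 is met, so the identities extend to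
  coinciding variables. Subtracting the staircase values leaves on the right terms whose Haar
  integrals will turn out to be 0.\<close>

lemma schur_euler:
  fixes T :: "'t set"
  assumes T: "finite T" "\<And>\<tau> i. norm (w \<tau> i) = 2" and n: "length l = n"
    and ex: "\<And>y. (\<forall>b<n. y b \<noteq> 0) \<Longrightarrow>
        schur l y = root_comb n m r T c w y"
    and x: "\<And>b. b < n \<Longrightarrow> norm (x b) = 1"
  defines "F \<equiv> \<lambda>\<tau>. c \<tau> * (\<Prod>b<n. root_factor m r (w \<tau>) (x b))"
    and "e \<equiv> \<lambda>k. staircase n k + l ! k"
  shows "of_int ((\<Sum>k<n. e k) - (\<Sum>k<n. staircase n k)) * schur l x =
      (\<Sum>\<tau>\<in>T. F \<tau> * (- of_nat m * of_nat n - ratio_sum n r (w \<tau>) x))" (is ?thesis1)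
    and "of_int ((\<Sum>k<n. (e k)\<^sup>2) - (\<Sum>k<n. (staircase n k)\<^sup>2)) * schur l x =
      (\<Sum>\<tau>\<in>T. F \<tau> * casimir_factor n m r (w \<tau>) x)" (is ?thesis2)
proof -
  define G where "G = (\<lambda>y \<tau>. c \<tau> * (\<Prod>b<n. root_factor m r (w \<tau>) (y b)))"
  define U :: "complex set" where "U = - {0} \<inter> - sphere 0 2"
  have U: "open U" unfolding U_def by (intro open_Int open_Compl) auto
  have xU: "x b \<in> U" if "b < n" for b using x[OF that] by (auto simp: U_def)
  have x0: "x b \<noteq> 0" if "b < n" for b using x[OF that] by auto
  have xw: "w \<tau> i - x b \<noteq> 0" if "b < n" for b \<tau> i
    using x[OF that] T(2)[of \<tau> i] by auto
  have exA: "alternant n e y = schur_den n y * (\<Sum>\<tau>\<in>T. G y \<tau>)"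
    if "\<forall>b<n. y b \<noteq> 0" "inj_on y {..<n}" for y
    using ex[OF that(1)] schur_den_nonzero[OF that(2)] that(2) n
    by (simp add: G_def schur_def schur_num_alternant e_def divide_eq_eq mult_ac)
  have exB: "alternant n e y = schur_den n y * (\<Sum>\<tau>\<in>T. G y \<tau>)" if "\<forall>b<n. y b \<noteq> 0" for y
  proof (cases "inj_on y {..<n}")
    case False
    then obtain i k where ik: "i < n" "k < n" "i \<noteq> k" "y i = y k" by (auto simp: inj_on_def)
    then have "alternant n f y = 0" for f
      unfolding alternant_def by (intro fdet_identical_rows[of i n k]) auto
    then show ?thesis by (simp add: schur_den_alternant)
  qed (use exA that in auto)
  have tend: "((\<lambda>y. y b) \<longlongrightarrow> x b) (at x)" for b by (rule tendsto_coordinate)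
  have tG: "((\<lambda>y. G y \<tau>) \<longlongrightarrow> G x \<tau>) (at x)" for \<tau>
    unfolding G_def
    by (intro tendsto_mult tendsto_const tendsto_prod tendsto_root_factor tend) (use x0 in auto)
  have t1: "((\<lambda>y. ratio_sum n r (w \<tau>) y) \<longlongrightarrow> ratio_sum n r (w \<tau>) x) (at x)" for \<tau>
    unfolding ratio_sum_def by (intro tendsto_intros tend) (use xw in auto)
  have t2: "((\<lambda>y. ratio_quad n r (w \<tau>) y) \<longlongrightarrow> ratio_quad n r (w \<tau>) x) (at x)" for \<tau>
    unfolding ratio_quad_def by (intro tendsto_intros tend) (use xw in auto)
  have Gf: "c \<tau> * (\<Prod>b<n. root_factor m r (w \<tau>) (y b)) = G y \<tau>" for y \<tau>
    by (simp add: G_def)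
  have shift: "of_int (P - Q) * sum g T = (\<Sum>\<tau>\<in>T. g \<tau> * k \<tau>)"
    if "of_int P * sum g T = (\<Sum>\<tau>\<in>T. g \<tau> * h \<tau>)" "\<And>\<tau>. \<tau> \<in> T \<Longrightarrow> h \<tau> = of_int Q + k \<tau>"
    for P Q :: int and g h k :: "'t \<Rightarrow> complex"
  proof -
    have "(\<Sum>\<tau>\<in>T. g \<tau> * h \<tau>) = of_int Q * sum g T + (\<Sum>\<tau>\<in>T. g \<tau> * k \<tau>)"
      unfolding sum_distrib_left sum.distrib[symmetric]
      by (rule sum.cong) (simp_all add: that(2) algebra_simps)
    then show ?thesis using that(1) by (simp add: algebra_simps)
  qed
  have FG: "F = G x" by (simp add: F_def G_def)
  have sx: "schur l x = (\<Sum>\<tau>\<in>T. G x \<tau>)" using ex x0 by (simp add: G_def)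
  have transfer: "of_int P * (\<Sum>\<tau>\<in>T. G x \<tau>) = (\<Sum>\<tau>\<in>T. G x \<tau> * k \<tau> x)"
    if k: "\<And>\<tau>. (k \<tau> \<longlongrightarrow> k \<tau> x) (at x)"
      and eq: "\<And>y. inj_on y {..<n} \<Longrightarrow> (\<And>b. b < n \<Longrightarrow> y b \<noteq> 0) \<Longrightarrow>
        (\<And>a \<tau> i. a < n \<Longrightarrow> \<tau> \<in> T \<Longrightarrow> i < r \<Longrightarrow> y a \<noteq> w \<tau> i) \<Longrightarrow>
        of_int P * (\<Sum>\<tau>\<in>T. G y \<tau>) = (\<Sum>\<tau>\<in>T. G y \<tau> * k \<tau> y)" for P k
  proof (rule eq_by_density_of_inj[where U = U and n = n and x = x and
      f = "\<lambda>x. of_int P * (\<Sum>\<tau>\<in>T. G x \<tau>)" and g = "\<lambda>x. \<Sum>\<tau>\<in>T. G x \<tau> * k \<tau> x"])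
    fix y assume y: "inj_on y {..<n}" "\<And>a. a < n \<Longrightarrow> y a \<in> U"
    show "of_int P * (\<Sum>\<tau>\<in>T. G y \<tau>) = (\<Sum>\<tau>\<in>T. G y \<tau> * k \<tau> y)"
    proof (rule eq[OF y(1)])
      show "y b \<noteq> 0" if "b < n" for b using y(2)[OF that] by (simp add: U_def)
      show "y a \<noteq> w \<tau> i" if "a < n" for a \<tau> i using y(2)[OF that] T(2)[of \<tau> i] by (auto simp: U_def)
    qed
  qed (intro tendsto_intros tG k U xU; assumption)+
  show ?thesis1
    unfolding sx FG
  proof (rule transfer)
    show "((\<lambda>x. - of_nat m * of_nat n - ratio_sum n r (w \<tau>) x) \<longlongrightarrow>
        - of_nat m * of_nat n - ratio_sum n r (w \<tau>) x) (at x)" for \<tau>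
      by (intro tendsto_intros t1)
    fix y assume y: "inj_on y {..<n}" "\<And>b. b < n \<Longrightarrow> y b \<noteq> 0"
      "\<And>a \<tau> i. a < n \<Longrightarrow> \<tau> \<in> T \<Longrightarrow> i < r \<Longrightarrow> y a \<noteq> w \<tau> i"
    show "of_int ((\<Sum>k<n. e k) - (\<Sum>k<n. staircase n k)) * (\<Sum>\<tau>\<in>T. G y \<tau>) =
        (\<Sum>\<tau>\<in>T. G y \<tau> * (- of_nat m * of_nat n - ratio_sum n r (w \<tau>) y))"
      by (rule shift[OF alternant_euler(1)[OF T(1) exB[unfolded G_def] y, unfolded Gf]])
        (simp_all add: sum_log_euler[OF y(1,2)])
  qed
  show ?thesis2
    unfolding sx FG
  proof (rule transfer)
    show "(casimir_factor n m r (w \<tau>) \<longlongrightarrow> casimir_factor n m r (w \<tau>) x) (at x)" for \<tau>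
      unfolding casimir_factor_def by (intro tendsto_intros t1 t2)
    fix y assume y: "inj_on y {..<n}" "\<And>b. b < n \<Longrightarrow> y b \<noteq> 0"
      "\<And>a \<tau> i. a < n \<Longrightarrow> \<tau> \<in> T \<Longrightarrow> i < r \<Longrightarrow> y a \<noteq> w \<tau> i"
    show "of_int ((\<Sum>k<n. (e k)\<^sup>2) - (\<Sum>k<n. (staircase n k)\<^sup>2)) * (\<Sum>\<tau>\<in>T. G y \<tau>) =
        (\<Sum>\<tau>\<in>T. G y \<tau> * casimir_factor n m r (w \<tau>) y)"
      by (rule shift[OF alternant_euler(2)[OF T(1) exB[unfolded G_def] y, unfolded Gf]])
        (simp_all add: sum_log_euler2[OF y(1,2)] y(3))
  qed
qed

subsection \<open>Determinants of matrices over a finite type\<close>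

abbreviation smat :: "'a::zero \<Rightarrow> 'a^'n^'n" where "smat \<equiv> Finite_Cartesian_Product.mat"
abbreviation mrow :: "'m \<Rightarrow> 'a^'n^'m \<Rightarrow> 'a^'n" where "mrow \<equiv> Finite_Cartesian_Product.row"
abbreviation mdet :: "'a::comm_ring_1^'n^'n \<Rightarrow> 'a" where "mdet \<equiv> Determinants.det"

lemma smat_nth: "smat c $ i $ j = (if i = j then c else 0)"
  by (simp add: Finite_Cartesian_Product.mat_def)

lemma smat_mult_nth [simp]: "(smat c ** (g :: 'a::semiring_1^'n^'m)) $ i $ j = c * g $ i $ j"
  by (simp add: matrix_matrix_mult_def Finite_Cartesian_Product.mat_def if_distrib if_distribR sum.delta cong: if_cong)

lemma mult_smat_nth [simp]: "((g :: 'a::comm_semiring_1^'n^'m) ** smat c) $ i $ j = c * g $ i $ j"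
  by (simp add: matrix_matrix_mult_def Finite_Cartesian_Product.mat_def if_distrib if_distribR sum.delta mult.commute cong: if_cong)

lemma matrix_diff_mult:
  fixes A B :: "'a::ring_1^'n^'m"
  shows "(A - B) ** C = A ** C - B ** C"
  by (simp add: matrix_matrix_mult_def vec_eq_iff left_diff_distrib sum_subtractf)

lemma mdet_smult: "mdet (smat c ** (g :: 'a::comm_ring_1^'n^'n)) = c ^ CARD('n) * mdet g"
  by (simp add: Determinants.det_def prod.distrib sum_distrib_left mult_ac)

lemma mdet_smat: "mdet (smat c :: 'a::comm_ring_1^'n^'n) = c ^ CARD('n)"
  using mdet_smult[of c "smat 1 :: 'a^'n^'n"] by simp

definition outer :: "'a::times^'m \<Rightarrow> 'a^'n \<Rightarrow> 'a^'n^'m" where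
  "outer u y = (\<chi> i j. u $ i * y $ j)"

lemma mdet_identity_replace_row:
  fixes y :: "'a::field^'n"
  shows "mdet (\<chi> i. if i = k then y else axis i 1) = y $ k"
proof -
  have row: "mrow i (smat 1 :: 'a^'n^'n) = axis i 1" for i
    by (auto simp: Finite_Cartesian_Product.row_def axis_def smat_nth vec_eq_iff)
  have e: "(\<Sum>i\<in>UNIV. y $ i *s axis i 1) = y" by (simp add: basis_expansion)
  show ?thesis
    using cramer_lemma_transpose[of k y "smat 1 :: 'a^'n^'n"] unfolding row e by simp
qed

text \<open>Add the rank one part row by row. The newly changed row splits off a multiple of y; in
  that determinant row operations remove the multiples of y from the other rows, leaving the
  identity with one row replaced by y (fact \<open>B\<close>).\<close>

lemma mdet_identity_plus_rank_one:
  fixes u y :: "'a::field^'n"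
  shows "mdet (smat 1 + outer u y) = 1 + (\<Sum>i\<in>UNIV. u $ i * y $ i)"
proof -
  define R where "R = (\<lambda>S i. if i \<in> S then axis i 1 + u $ i *s y else (axis i 1 :: 'a^'n))"
  have B: "mdet (\<chi> i. if i = k then y else R S i) = y $ k" if "finite S" "k \<notin> S" for k S
    using that
  proof (induction S rule: finite_induct)
    case empty
    show ?case unfolding R_def by (simp only: empty_iff if_False mdet_identity_replace_row)
  next
    case (insert j S)
    let ?A = "\<chi> i. if i = k then y else R S i"
    have row: "mrow i ?A = (if i = k then y else R S i)" for i
      by (simp add: Finite_Cartesian_Product.row_def vec_eq_iff)
    have "(\<chi> i. if i = k then y else R (insert j S) i) =
        (\<chi> i. if i = j then mrow j ?A + u $ j *s mrow k ?A
          else mrow i ?A)"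
      unfolding row using insert by (auto simp: vec_eq_iff R_def)
    then have "mdet (\<chi> i. if i = k then y else R (insert j S) i) =
        mdet (\<chi> i. if i = j then mrow j ?A + u $ j *s mrow k ?A
          else mrow i ?A)"
      by (rule arg_cong)
    also have "\<dots> = mdet ?A"
      using insert.prems by (intro det_row_operation) auto
    finally show ?case using insert by simp
  qed
  have A: "mdet (\<chi> i. R S i) = 1 + (\<Sum>i\<in>S. u $ i * y $ i)" if "finite S" for S
    using that
  proof (induction S rule: finite_induct)
    case empty
    have "(\<chi> i. R {} i) = smat 1"
      by (simp add: R_def vec_eq_iff axis_def smat_nth)
    then show ?case by simp
  next
    case (insert k S)
    have 1: "(\<chi> i. R (insert k S) i) = (\<chi> i. if i = k then R S i + u $ k *s y else R S i)"
      using insert by (auto simp: R_def vec_eq_iff)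
    have 2: "(\<chi> i. if i = k then R S i else R S i) = (\<chi> i. R S i)"
      by (simp add: vec_eq_iff)
    have 3: "mdet (\<chi> i. if i = k then u $ k *s y else R S i) = u $ k * y $ k"
      unfolding det_row_mul[where a = "\<lambda>_. y"] B[OF insert(1,2)] ..
    show ?case
      unfolding 1 det_row_add 3 2 insert.IH using insert by simp
  qed
  have "smat 1 + outer u y = (\<chi> i. R UNIV i)"
    by (simp add: vec_eq_iff R_def outer_def axis_def smat_nth)
  then show ?thesis using A[of UNIV] by simp
qed

subsection \<open>Eigenvalues\<close>

definition char_poly_mat :: "complex^'n^'n \<Rightarrow> complex poly" where
  "char_poly_mat g = mdet (smat [:0, 1:] - (\<chi> i j. [:g $ i $ j:]))"

lemma poly_mdet: "poly (mdet M) x = mdet (\<chi> i j. poly (M $ i $ j) x)"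
  by (simp add: Determinants.det_def poly_sum poly_prod of_int_poly)

lemma poly_char_poly_mat: "poly (char_poly_mat g) x = mdet (smat x - g)"
proof -
  have "(\<chi> i j. poly ((smat [:0, 1:] - (\<chi> i j. [:g $ i $ j:])) $ i $ j) x) = smat x - g"
    by (simp add: vec_eq_iff smat_nth)
  then show ?thesis by (simp add: char_poly_mat_def poly_mdet)
qed

text \<open>A permutation other than the identity picks at least one constant entry, so only the
  diagonal product reaches degree N, and it is monic.\<close>

lemma monic_char_poly_mat:
  fixes g :: "complex^'n^'n"
  shows "degree (char_poly_mat g) = CARD('n)" "lead_coeff (char_poly_mat g) = 1"
proof -
  define A :: "complex poly^'n^'n" where "A = smat [:0, 1:] - (\<chi> i j. [:g $ i $ j:])"
  have A: "A $ i $ j = (if i = j then [:- g $ i $ j, 1:] else [:- g $ i $ j:])" for i j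
    by (simp add: A_def smat_nth)
  define D where "D = (\<Prod>i\<in>UNIV. A $ i $ i)"
  define Rest where "Rest = (\<Sum>p \<in> {p. p permutes UNIV} - {id}. of_int (sign p) * (\<Prod>i\<in>UNIV. A $ i $ p i))"
  have "char_poly_mat g = D + Rest"
    unfolding char_poly_mat_def A_def[symmetric] Determinants.det_def D_def Rest_def
    by (subst sum.remove[of _ id]) (auto simp: permutes_id)
  have "degree D = CARD('n)"
    unfolding D_def A by (subst degree_prod_eq_sum_degree) auto
  have "lead_coeff D = 1" unfolding D_def A lead_coeff_prod by simp
  have "degree (of_int (sign p) * (\<Prod>i\<in>UNIV. A $ i $ p i)) < CARD('n)"
    if "p \<in> {p. p permutes UNIV} - {id}" for p
  proof -
    from that obtain k where k: "p k \<noteq> k" by (auto simp: fun_eq_iff)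
    have "degree (of_int (sign p) * (\<Prod>i\<in>UNIV. A $ i $ p i)) \<le> degree (\<Prod>i\<in>UNIV. A $ i $ p i)"
      by (simp add: sign_def)
    also have "\<dots> \<le> (\<Sum>i\<in>UNIV. degree (A $ i $ p i))"
      using degree_prod_sum_le[of UNIV "\<lambda>i. A $ i $ p i"] by (simp add: o_def)
    also have "\<dots> \<le> (\<Sum>i\<in>UNIV - {k}. degree (A $ i $ p i))"
      using k by (subst sum.remove[of _ k]) (auto simp: A)
    also have "\<dots> \<le> (\<Sum>i\<in>UNIV - {k}. 1)"
      by (rule sum_mono) (simp add: A)
    also have "\<dots> < CARD('n)" by (simp add: card_Diff_singleton card_gt_0_iff)
    finally show ?thesis .
  qed
  then have "degree Rest < CARD('n)"
    unfolding Rest_def by (intro degree_sum_less) auto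
  with \<open>char_poly_mat g = D + Rest\<close> \<open>degree D = CARD('n)\<close> \<open>lead_coeff D = 1\<close>
  show "degree (char_poly_mat g) = CARD('n)" "lead_coeff (char_poly_mat g) = 1"
    by (simp_all add: degree_add_eq_left coeff_eq_0)
qed

definition eigs :: "complex^'n^'n \<Rightarrow> nat \<Rightarrow> complex" where
  "eigs g = (!) (SOME ts. mset ts = eigenvalue_mset g)"

lemma schur_eigenvalues_eigs: "schur_eigenvalues l g = schur l (eigs g)"
  by (simp add: schur_eigenvalues_def eigs_def)

lemma poly_char_poly_eigs:
  fixes g :: "complex^'n^'n"
  shows "poly (char_poly_mat g) x = (\<Prod>a<CARD('n). x - eigs g a)"
proof -
  define ts where "ts = (SOME ts. mset ts = eigenvalue_mset g)"
  have ts: "mset ts = proots (char_poly_mat g)"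
    unfolding ts_def using someI_ex[OF ex_mset[of "eigenvalue_mset g"]]
    by (simp add: eigenvalue_mset_def char_poly_mat_def)
  have len: "length ts = CARD('n)"
    using arg_cong[OF ts, of size] by (simp add: size_proots_complex monic_char_poly_mat)
  have "char_poly_mat g = (\<Prod>t\<in>#mset ts. [:- t, 1:])"
    using complex_poly_decompose_multiset[of "char_poly_mat g"]
    unfolding monic_char_poly_mat(2) ts by simp
  then have "poly (char_poly_mat g) x = poly (\<Prod>t\<in>#mset ts. [:- t, 1:]) x" by simp
  also have "\<dots> = (\<Prod>t\<leftarrow>ts. x - t)"
    by (induction ts) (simp_all add: left_diff_distrib)
  also have "\<dots> = (\<Prod>a<length ts. x - ts ! a)"
    by (simp add: prod.list_conv_set_nth atLeast0LessThan)
  finally show ?thesis by (simp add: len eigs_def ts_def[symmetric])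
qed

lemma mdet_smat_minus:
  fixes g :: "complex^'n^'n"
  shows "mdet (smat x - g) = (\<Prod>a<CARD('n). x - eigs g a)"
  using poly_char_poly_eigs[of g x] by (simp add: poly_char_poly_mat)

lemma mdet_eigs:
  fixes g :: "complex^'n^'n"
  shows "mdet g = (\<Prod>a<CARD('n). eigs g a)"
proof -
  have "mdet (smat 0 - g) = mdet (smat (-1) ** g)"
    by (rule arg_cong[where f = mdet]) (simp add: vec_eq_iff smat_nth)
  also have "\<dots> = (-1) ^ CARD('n) * mdet g" by (rule mdet_smult)
  finally have "(-1) ^ CARD('n) * mdet g = mdet (smat 0 - g)" ..
  also have "\<dots> = (\<Prod>a<CARD('n). (-1) * eigs g a)"
    unfolding mdet_smat_minus by simp
  also have "\<dots> = (-1) ^ CARD('n) * (\<Prod>a<CARD('n). eigs g a)"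
    unfolding prod.distrib by simp
  finally show ?thesis by simp
qed

lemma mdet_smat_minus_smult:
  fixes g :: "complex^'n^'n"
  shows "mdet (smat x - smat c ** g) = (\<Prod>a<CARD('n). x - c * eigs g a)"
proof (cases "c = 0")
  case True
  then have "smat x - smat c ** g = smat x ** smat 1"
    by (simp add: vec_eq_iff smat_nth)
  then have "mdet (smat x - smat c ** g) = x ^ CARD('n) * mdet (smat 1 :: complex^'n^'n)"
    by (simp only: mdet_smult)
  then show ?thesis using True by simp
next
  case False
  then have "smat x - smat c ** g = smat c ** (smat (x / c) - g)"
    by (simp add: vec_eq_iff smat_nth algebra_simps)
  then have "mdet (smat x - smat c ** g) = c ^ CARD('n) * (\<Prod>a<CARD('n). x / c - eigs g a)"
    by (simp only: mdet_smult mdet_smat_minus)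
  also have "\<dots> = (\<Prod>a<CARD('n). c * (x / c - eigs g a))"
    unfolding prod.distrib by simp
  also have "\<dots> = (\<Prod>a<CARD('n). x - c * eigs g a)"
    using False by (simp add: algebra_simps)
  finally show ?thesis .
qed

subsection \<open>The unitary group\<close>

lemma conj_transpose_mult: "conj_transpose (A ** B) = conj_transpose B ** conj_transpose A"
  by (simp add: conj_transpose_def matrix_matrix_mult_def vec_eq_iff mult.commute)

lemma conj_transpose_conj_transpose [simp]: "conj_transpose (conj_transpose A) = A"
  by (simp add: conj_transpose_def vec_eq_iff)

lemma unitary_mult: "g \<in> unitary_group \<Longrightarrow> h \<in> unitary_group \<Longrightarrow> g ** h \<in> unitary_group"
  unfolding unitary_group_def mem_Collect_eq conj_transpose_mult
  by (metis matrix_mul_assoc matrix_mul_lid)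

lemma unitary_conj_transpose: "g \<in> unitary_group \<Longrightarrow> conj_transpose g \<in> unitary_group"
  by (simp add: unitary_group_def)

lemma unitary_smat:
  assumes "norm z = 1"
  shows "(smat z :: complex^'n^'n) \<in> unitary_group"
proof -
  have "z * cnj z = 1" using assms by (simp add: complex_norm_square[symmetric])
  then have "smat z ** conj_transpose (smat z :: complex^'n^'n) = smat 1"
    "conj_transpose (smat z :: complex^'n^'n) ** smat z = smat 1"
    by (simp_all add: vec_eq_iff conj_transpose_def smat_nth)
  then show ?thesis by (simp add: unitary_group_def)
qed

text \<open>For a unit vector v, this matrix multiplies v by z and fixes the orthogonal complement
  of v.\<close>

lemma unitary_reflection:
  fixes v :: "complex^'n"
  assumes v: "(\<Sum>a\<in>UNIV. v $ a * cnj (v $ a)) = 1" and z: "norm z = 1"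
  defines "h \<equiv> smat 1 + outer v (\<chi> j. (z - 1) * cnj (v $ j))"
  shows "h \<in> unitary_group" "mdet h = z"
proof -
  have zz: "z * cnj z = 1" using z by (simp add: complex_norm_square[symmetric])
  have h: "h $ i $ j = (if i = j then 1 else 0) + (z - 1) * (v $ i * cnj (v $ j))" for i j
    by (simp add: h_def outer_def smat_nth)
  have "(\<Sum>k\<in>UNIV. h $ i $ k * cnj (h $ j $ k)) = (if i = j then 1 else 0)" for i j
  proof -
    have "h $ i $ k * cnj (h $ j $ k) =
        (if i = k then if j = k then 1 else 0 else 0) + (if i = k then cnj (z - 1) * (cnj (v $ j) * v $ k) else 0) +
        (if j = k then (z - 1) * (v $ i * cnj (v $ k)) else 0) +
        ((z - 1) * cnj (z - 1)) * (v $ i * cnj (v $ j)) * (v $ k * cnj (v $ k))" for k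
      by (simp add: h algebra_simps)
    then have "(\<Sum>k\<in>UNIV. h $ i $ k * cnj (h $ j $ k)) =
       (if i = j then 1 else 0) + cnj (z - 1) * (cnj (v $ j) * v $ i) + (z - 1) * (v $ i * cnj (v $ j)) +
        ((z - 1) * cnj (z - 1)) * (v $ i * cnj (v $ j))"
      by (simp add: sum.distrib sum_distrib_left[symmetric] v del: complex_cnj_diff)
    also have "\<dots> = (if i = j then 1 else 0) + (z * cnj z - 1) * (v $ i * cnj (v $ j))"
      by (simp add: algebra_simps)
    finally show ?thesis by (simp add: zz)
  qed
  then have 1: "h ** conj_transpose h = smat 1"
    by (simp add: vec_eq_iff conj_transpose_def matrix_matrix_mult_def smat_nth)
  then have "conj_transpose h ** h = smat 1" by (simp add: matrix_left_right_inverse)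
  with 1 show "h \<in> unitary_group" by (simp add: unitary_group_def)
  have "(\<Sum>i\<in>UNIV. v $ i * ((z - 1) * cnj (v $ i))) = (z - 1) * (\<Sum>i\<in>UNIV. v $ i * cnj (v $ i))"
    by (simp add: sum_distrib_left mult_ac)
  then show "mdet h = z" unfolding h_def mdet_identity_plus_rank_one using v by simp
qed

lemma unitary_preserves_norm:
  assumes "g \<in> unitary_group"
  shows "(\<Sum>i\<in>UNIV. (g *v x) $ i * cnj ((g *v x) $ i)) = (\<Sum>i\<in>UNIV. x $ i * cnj (x $ i))"
proof -
  have "(conj_transpose g ** g) $ j $ k = (if j = k then 1 else 0)" for j k
    using assms by (simp add: unitary_group_def smat_nth)
  then have gg: "(\<Sum>i\<in>UNIV. cnj (g $ i $ j) * g $ i $ k) = (if j = k then 1 else 0)" for j k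
    by (simp add: matrix_matrix_mult_def conj_transpose_def)
  have "(\<Sum>i\<in>UNIV. (g *v x) $ i * cnj ((g *v x) $ i)) =
      (\<Sum>i\<in>UNIV. \<Sum>k\<in>UNIV. \<Sum>j\<in>UNIV. x $ k * cnj (x $ j) * (cnj (g $ i $ j) * g $ i $ k))"
    by (simp add: matrix_vector_mult_def sum_product mult_ac)
  also have "\<dots> = (\<Sum>k\<in>UNIV. \<Sum>j\<in>UNIV. \<Sum>i\<in>UNIV. x $ k * cnj (x $ j) * (cnj (g $ i $ j) * g $ i $ k))"
    by (subst sum.swap, rule sum.cong[OF refl], subst sum.swap) simp
  also have "\<dots> = (\<Sum>k\<in>UNIV. \<Sum>j\<in>UNIV. x $ k * cnj (x $ j) * (if j = k then 1 else 0))"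
    by (simp only: sum_distrib_left[symmetric] gg)
  also have "\<dots> = (\<Sum>i\<in>UNIV. x $ i * cnj (x $ i))" by (simp add: if_distrib cong: if_cong)
  finally show ?thesis .
qed

lemma unitary_eigenvalue_norm:
  fixes g :: "complex^'n^'n"
  assumes g: "g \<in> unitary_group" and "mdet (smat c - g) = 0"
  shows "norm c = 1"
proof -
  have "\<not> invertible (smat c - g)" using assms(2) by (simp add: invertible_det_nz)
  then have "\<not> (\<exists>B. B ** (smat c - g) = smat 1)"
    unfolding invertible_def using matrix_left_right_inverse by blast
  then obtain x where x: "(smat c - g) *v x = 0" "x \<noteq> 0"
    unfolding matrix_left_invertible_ker by blast
  have "g *v x = c *s x"
  proof -
    have "(smat c - g) *v x = smat c *v x - g *v x"
      by (simp add: matrix_vector_mult_diff_rdistrib)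
    moreover have "smat c *v x = c *s x"
      by (simp add: vec_eq_iff matrix_vector_mult_def smat_nth if_distrib if_distribR cong: if_cong)
    ultimately show ?thesis using x by simp
  qed
  define S where "S = (\<Sum>i\<in>UNIV. (norm (x $ i))\<^sup>2)"
  have S: "(\<Sum>i\<in>UNIV. x $ i * cnj (x $ i)) = of_real S"
    unfolding S_def by (simp only: of_real_sum complex_norm_square)
  have "S > 0"
  proof -
    obtain i where "x $ i \<noteq> 0" using x(2) by (auto simp: vec_eq_iff)
    then show ?thesis unfolding S_def by (intro sum_pos2[of _ i]) auto
  qed
  have "(\<Sum>i\<in>UNIV. (c * x $ i) * cnj (c * x $ i)) = of_real S"
    using unitary_preserves_norm[OF g, of x] S \<open>g *v x = c *s x\<close> by simp
  moreover have "(\<Sum>i\<in>UNIV. (c * x $ i) * cnj (c * x $ i)) = c * cnj c * (\<Sum>i\<in>UNIV. x $ i * cnj (x $ i))"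
    by (simp add: sum_distrib_left mult_ac)
  ultimately have "c * cnj c * of_real S = of_real S" by (simp add: S)
  then have "c * cnj c = 1" using \<open>S > 0\<close> by simp
  then have "(norm c)\<^sup>2 = 1" by (metis complex_norm_square of_real_eq_1_iff)
  then show ?thesis using norm_ge_zero[of c] by (auto simp: power2_eq_1_iff)
qed

lemma norm_eigs:
  fixes g :: "complex^'n^'n"
  assumes "g \<in> unitary_group" "a < CARD('n)"
  shows "norm (eigs g a) = 1"
  by (rule unitary_eigenvalue_norm[OF assms(1)]) (use assms(2) in \<open>auto simp: mdet_smat_minus\<close>)

lemma mdet_unitary_nonzero: "g \<in> unitary_group \<Longrightarrow> mdet g \<noteq> 0"
  using invertible_det_nz[of g] by (auto simp: unitary_group_def invertible_def)

lemma mdet_conj_transpose_unitary: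
  assumes "g \<in> unitary_group"
  shows "mdet (conj_transpose g) = inverse (mdet g)"
proof -
  have "mdet g * mdet (conj_transpose g) = 1"
    using assms by (simp add: unitary_group_def det_mul[symmetric])
  then show ?thesis by (simp add: inverse_unique)
qed

text \<open>Since g g* = 1, the matrix 1 - \<alpha> g* equals (g - \<alpha>) g*, which brings the
  factor back to the eigenvalues of g itself.\<close>

lemma mdet_one_minus_conj_transpose:
  fixes g :: "complex^'n^'n"
  assumes g: "g \<in> unitary_group"
  shows "mdet (smat 1 - smat \<alpha> ** conj_transpose g) = (\<Prod>a<CARD('n). 1 - \<alpha> * inverse (eigs g a))"
proof -
  have "smat 1 - smat \<alpha> ** conj_transpose g = (g - smat \<alpha>) ** conj_transpose g"
    using g by (simp add: unitary_group_def matrix_diff_mult)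
  also have "g - smat \<alpha> = smat (-1) ** (smat \<alpha> - g)"
    by (simp add: vec_eq_iff)
  finally have "mdet (smat 1 - smat \<alpha> ** conj_transpose g) =
      (-1) ^ CARD('n) * (\<Prod>a<CARD('n). \<alpha> - eigs g a) * (\<Prod>a<CARD('n). inverse (eigs g a))"
    using prod_inversef[of "eigs g" "{..<CARD('n)}"]
    by (simp only: det_mul mdet_smat mdet_smat_minus mdet_conj_transpose_unitary[OF g] mdet_eigs[of g] o_def)
  also have "\<dots> = (\<Prod>a<CARD('n). (-1) * (\<alpha> - eigs g a) * inverse (eigs g a))"
    unfolding prod.distrib by simp
  also have "\<dots> = (\<Prod>a<CARD('n). 1 - \<alpha> * inverse (eigs g a))"
  proof (rule prod.cong)
    fix a assume "a \<in> {..<CARD('n)}"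
    then have "eigs g a \<noteq> 0" using norm_eigs[OF g, of a] by auto
    then show "(-1) * (\<alpha> - eigs g a) * inverse (eigs g a) = 1 - \<alpha> * inverse (eigs g a)"
      by (simp add: field_simps)
  qed simp
  finally show ?thesis .
qed

lemma matrix_mult_diff:
  fixes A :: "'a::ring_1^'n^'m"
  shows "A ** (B - C) = A ** B - A ** C"
  by (simp add: matrix_matrix_mult_def vec_eq_iff right_diff_distrib sum_subtractf)

lemma matrix_add_mult:
  fixes A B :: "'a::ring_1^'n^'m"
  shows "(A + B) ** C = A ** C + B ** C"
  by (simp add: matrix_matrix_mult_def vec_eq_iff distrib_right sum.distrib)

subsection \<open>Resolvents\<close>

lemma matrix_inv_nonsingular:
  fixes M :: "'a::field^'n^'n"
  assumes "mdet M \<noteq> 0"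
  shows "M ** matrix_inv M = smat 1" "matrix_inv M ** M = smat 1"
proof -
  have "\<exists>B. M ** B = smat 1 \<and> B ** M = smat 1"
    using assms by (simp add: invertible_det_nz[symmetric] invertible_def)
  then have "M ** matrix_inv M = smat 1 \<and> matrix_inv M ** M = smat 1"
    unfolding matrix_inv_def by (rule someI_ex)
  then show "M ** matrix_inv M = smat 1" "matrix_inv M ** M = smat 1" by auto
qed

lemma matrix_inv_cramer:
  fixes M :: "'a::field^'n^'n"
  assumes "mdet M \<noteq> 0"
  shows "matrix_inv M $ k $ j =
    mdet (\<chi> i l. if l = k then if i = j then 1 else 0 else M $ i $ l) / mdet M"
proof -
  define x where "x = (\<chi> i. matrix_inv M $ i $ j)"
  have "M *v x = axis j 1"
  proof -
    have "(M *v x) $ i = (M ** matrix_inv M) $ i $ j" for i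
      by (simp add: matrix_vector_mult_def matrix_matrix_mult_def x_def)
    then show ?thesis by (simp add: matrix_inv_nonsingular[OF assms] vec_eq_iff smat_nth axis_def)
  qed
  then have "x = (\<chi> k. mdet (\<chi> i l. if l = k then axis j 1 $ i else M $ i $ l) / mdet M)"
    by (simp add: cramer[OF assms])
  then have "x $ k = mdet (\<chi> i l. if l = k then axis j 1 $ i else M $ i $ l) / mdet M" by simp
  then show ?thesis unfolding axis_def vec_lambda_beta by (simp add: x_def)
qed

lemma pderiv_sum: "pderiv (sum f A) = (\<Sum>a\<in>A. pderiv (f a))"
  by (induction A rule: infinite_finite_induct) (simp_all add: pderiv_add)

lemma pderiv_mdet:
  fixes A :: "'a::idom poly^'n^'n"
  shows "pderiv (mdet A) = (\<Sum>k\<in>UNIV. mdet (\<chi> i. if i = k then \<chi> j. pderiv (A $ i $ j) else A $ i))"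
proof -
  have "pderiv (mdet A) =
      (\<Sum>p | p permutes UNIV. \<Sum>k\<in>UNIV. of_int (sign p) * ((\<Prod>i\<in>UNIV - {k}. A $ i $ p i) * pderiv (A $ k $ p k)))"
    unfolding Determinants.det_def pderiv_sum
    by (rule sum.cong) (auto simp: pderiv_mult pderiv_prod sum_distrib_left of_int_poly sign_def pderiv_minus sum_negf)
  also have "\<dots> = (\<Sum>k\<in>UNIV. \<Sum>p | p permutes UNIV.
      of_int (sign p) * ((\<Prod>i\<in>UNIV - {k}. A $ i $ p i) * pderiv (A $ k $ p k)))"
    by (rule sum.swap)
  also have "\<dots> = (\<Sum>k\<in>UNIV. mdet (\<chi> i. if i = k then \<chi> j. pderiv (A $ i $ j) else A $ i))"
  proof (rule sum.cong[OF refl])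
    fix k :: 'n
    have "(\<Prod>i\<in>UNIV. (\<chi> i. if i = k then \<chi> j. pderiv (A $ i $ j) else A $ i) $ i $ p i) =
        (\<Prod>i\<in>UNIV - {k}. A $ i $ p i) * pderiv (A $ k $ p k)" for p
      by (subst prod.remove[of _ k]) (auto simp: mult.commute intro!: prod.cong)
    then show "(\<Sum>p | p permutes UNIV. of_int (sign p) * ((\<Prod>i\<in>UNIV - {k}. A $ i $ p i) * pderiv (A $ k $ p k))) =
        mdet (\<chi> i. if i = k then \<chi> j. pderiv (A $ i $ j) else A $ i)"
      by (simp only: Determinants.det_def)
  qed
  finally show ?thesis .
qed

definition resolvent :: "complex \<Rightarrow> complex^'n^'n \<Rightarrow> complex^'n^'n" where
  "resolvent w g = matrix_inv (smat w - g)"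

text \<open>On an eigenvector of g with eigenvalue x this acts as x / (w - x), the quotient
  occurring in \<open>ratio_sum\<close>.\<close>

definition gres :: "complex \<Rightarrow> complex^'n^'n \<Rightarrow> complex^'n^'n" where
  "gres w g = g ** resolvent w g"

text \<open>Two computations of p'(w) for the characteristic polynomial p. Differentiating row by
  row gives determinants with row k replaced by the k-th unit vector, which by Cramer's rule are
  det(w - g) times the diagonal entries of the resolvent; the factorisation over the eigenvalues
  gives the other side.\<close>

lemma sum_diag_resolvent:
  fixes g :: "complex^'n^'n"
  assumes nz: "mdet (smat w - g) \<noteq> 0"
  shows "(\<Sum>k\<in>UNIV. resolvent w g $ k $ k) = (\<Sum>a<CARD('n). 1 / (w - eigs g a))"
proof -
  let ?M = "smat w - g" and ?p = "char_poly_mat g"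
  have diag: "mdet (\<chi> i. if i = k then axis k 1 else ?M $ i) = resolvent w g $ k $ k * mdet ?M" for k
  proof -
    define x where "x = resolvent w g $ k"
    have "(\<Sum>i\<in>UNIV. x $ i *s mrow i ?M) = axis k 1"
    proof -
      have "(\<Sum>i\<in>UNIV. x $ i *s mrow i ?M) $ j = (resolvent w g ** ?M) $ k $ j" for j
        by (simp add: x_def matrix_matrix_mult_def Finite_Cartesian_Product.row_def)
      then show ?thesis
        by (simp add: vec_eq_iff resolvent_def matrix_inv_nonsingular[OF nz] smat_nth axis_def eq_commute)
    qed
    moreover have "mrow i ?M = ?M $ i" for i
      by (simp add: Finite_Cartesian_Product.row_def vec_eq_iff)
    ultimately show ?thesis
      using cramer_lemma_transpose[of k x ?M] by (simp only: x_def)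
  qed
  have "poly (pderiv ?p) w = (\<Sum>k\<in>UNIV. mdet (\<chi> i. if i = k then axis k 1 else ?M $ i))"
    unfolding char_poly_mat_def pderiv_mdet poly_sum poly_mdet
    by (intro sum.cong refl arg_cong[where f = mdet])
      (auto simp: vec_eq_iff smat_nth axis_def pderiv_pCons)
  then have 1: "poly (pderiv ?p) w = (\<Sum>k\<in>UNIV. resolvent w g $ k $ k) * mdet ?M"
    by (simp add: diag sum_distrib_right)
  have ne: "w - eigs g a \<noteq> 0" if "a < CARD('n)" for a
    using nz that by (auto simp: mdet_smat_minus)
  have "((\<lambda>z. \<Prod>a<CARD('n). z - eigs g a) has_field_derivative
      (\<Prod>a<CARD('n). w - eigs g a) * (\<Sum>a<CARD('n). 1 / (w - eigs g a))) (at w)"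
  proof (rule has_field_derivative_prod_log)
    fix a assume "a \<in> {..<CARD('n)}"
    then have "w - eigs g a \<noteq> 0" using ne by simp
    then show "((\<lambda>z. z - eigs g a) has_field_derivative (w - eigs g a) * (1 / (w - eigs g a))) (at w)"
      by (auto intro!: derivative_eq_intros)
  qed
  moreover have "(\<lambda>z. \<Prod>a<CARD('n). z - eigs g a) = poly ?p"
    by (rule ext) (simp add: poly_char_poly_eigs)
  ultimately have "poly (pderiv ?p) w = mdet ?M * (\<Sum>a<CARD('n). 1 / (w - eigs g a))"
    using DERIV_unique[OF poly_DERIV[of ?p w]] by (simp add: mdet_smat_minus)
  then show ?thesis using 1 nz by (simp add: mult.commute)
qed

lemma gres_eq:
  assumes "mdet (smat w - g) \<noteq> 0"
  shows "gres w g = smat w ** resolvent w g - smat 1"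
proof -
  have "g = smat w - (smat w - g)" by simp
  then have "gres w g = (smat w - (smat w - g)) ** resolvent w g" by (simp add: gres_def)
  also have "\<dots> = smat w ** resolvent w g - (smat w - g) ** resolvent w g"
    by (rule matrix_diff_mult)
  finally show ?thesis by (simp add: resolvent_def matrix_inv_nonsingular[OF assms])
qed

lemma sum_diag_gres:
  fixes g :: "complex^'n^'n"
  assumes nz: "mdet (smat w - g) \<noteq> 0"
  shows "(\<Sum>k\<in>UNIV. gres w g $ k $ k) = (\<Sum>a<CARD('n). eigs g a / (w - eigs g a))"
proof -
  have ne: "w - eigs g a \<noteq> 0" if "a < CARD('n)" for a
    using nz that by (auto simp: mdet_smat_minus)
  have "(\<Sum>k\<in>UNIV. gres w g $ k $ k) = w * (\<Sum>k\<in>UNIV. resolvent w g $ k $ k) - of_nat CARD('n)"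
    by (simp add: gres_eq[OF nz] smat_nth sum_subtractf sum_distrib_left)
  also have "\<dots> = (\<Sum>a<CARD('n). w * (1 / (w - eigs g a)) - 1)"
    by (simp add: sum_diag_resolvent[OF nz] sum_subtractf sum_distrib_left)
  also have "\<dots> = (\<Sum>a<CARD('n). eigs g a / (w - eigs g a))"
    by (rule sum.cong) (use ne in \<open>auto simp: field_simps\<close>)
  finally show ?thesis .
qed

text \<open>The resolvent identity R(w) - R(w') = (w' - w) R(w) R(w') reduces the trace of the
  product to single traces, which are known. Here w and w' must differ.\<close>

lemma sum_diag_gres_mult:
  fixes g :: "complex^'n^'n"
  assumes nz: "mdet (smat w - g) \<noteq> 0" "mdet (smat w' - g) \<noteq> 0" and "w \<noteq> w'"
  shows "(\<Sum>i\<in>UNIV. \<Sum>j\<in>UNIV. gres w g $ i $ j * gres w' g $ j $ i) =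
    (\<Sum>a<CARD('n). eigs g a / (w - eigs g a) * (eigs g a / (w' - eigs g a)))"
proof -
  let ?X = "resolvent w g" and ?Y = "resolvent w' g"
  have ne: "w - eigs g a \<noteq> 0" "w' - eigs g a \<noteq> 0" if "a < CARD('n)" for a
    using nz that by (auto simp: mdet_smat_minus)
  have res: "?X - ?Y = smat (w' - w) ** (?X ** ?Y)"
  proof -
    have "smat (w' - w) = (smat w' - g) - (smat w - g)"
      by (simp add: vec_eq_iff smat_nth)
    then have "?X ** smat (w' - w) ** ?Y = ?X ** (smat w' - g) ** ?Y - ?X ** (smat w - g) ** ?Y"
      by (simp only: matrix_diff_mult matrix_mult_diff)
    also have "\<dots> = ?X - ?Y"
      by (simp add: matrix_mul_assoc[symmetric] resolvent_def matrix_inv_nonsingular nz)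
    finally have "?X - ?Y = ?X ** smat (w' - w) ** ?Y" ..
    also have "?X ** smat (w' - w) = smat (w' - w) ** ?X" by (simp add: vec_eq_iff)
    finally show ?thesis by (simp add: matrix_mul_assoc)
  qed
  have trXY: "(w' - w) * (\<Sum>i\<in>UNIV. \<Sum>j\<in>UNIV. ?X $ i $ j * ?Y $ j $ i) =
      (\<Sum>k\<in>UNIV. ?X $ k $ k) - (\<Sum>k\<in>UNIV. ?Y $ k $ k)"
  proof -
    have "(\<Sum>k\<in>UNIV. ?X $ k $ k) - (\<Sum>k\<in>UNIV. ?Y $ k $ k) = (\<Sum>k\<in>UNIV. (?X - ?Y) $ k $ k)"
      by (simp add: sum_subtractf)
    also have "\<dots> = (w' - w) * (\<Sum>i\<in>UNIV. (?X ** ?Y) $ i $ i)"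
      unfolding res by (simp add: sum_distrib_left)
    finally show ?thesis by (simp add: matrix_matrix_mult_def)
  qed
  have "(\<Sum>i\<in>UNIV. \<Sum>j\<in>UNIV. gres w g $ i $ j * gres w' g $ j $ i) =
     (\<Sum>i\<in>UNIV. \<Sum>j\<in>UNIV. w * w' * (?X $ i $ j * ?Y $ j $ i) - (if i = j then w * ?X $ i $ j else 0)
       - (if i = j then w' * ?Y $ j $ i else 0) + (if i = j then 1 else 0))"
    unfolding gres_eq[OF nz(1)] gres_eq[OF nz(2)]
    by (intro sum.cong refl) (auto simp: smat_nth algebra_simps)
  also have "\<dots> = w * w' * (\<Sum>i\<in>UNIV. \<Sum>j\<in>UNIV. ?X $ i $ j * ?Y $ j $ i)
     - w * (\<Sum>k\<in>UNIV. ?X $ k $ k) - w' * (\<Sum>k\<in>UNIV. ?Y $ k $ k) + of_nat CARD('n)"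
    by (simp add: sum.distrib sum_subtractf sum_distrib_left)
  also have "(\<Sum>i\<in>UNIV. \<Sum>j\<in>UNIV. ?X $ i $ j * ?Y $ j $ i) =
      ((\<Sum>k\<in>UNIV. ?X $ k $ k) - (\<Sum>k\<in>UNIV. ?Y $ k $ k)) / (w' - w)"
    using trXY \<open>w \<noteq> w'\<close> by (simp add: field_simps)
  also have "w * w' * (((\<Sum>k\<in>UNIV. ?X $ k $ k) - (\<Sum>k\<in>UNIV. ?Y $ k $ k)) / (w' - w))
     - w * (\<Sum>k\<in>UNIV. ?X $ k $ k) - w' * (\<Sum>k\<in>UNIV. ?Y $ k $ k) + of_nat CARD('n) =
     (\<Sum>a<CARD('n). w * w' * ((1 / (w - eigs g a) - 1 / (w' - eigs g a)) / (w' - w))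
       - w * (1 / (w - eigs g a)) - w' * (1 / (w' - eigs g a)) + 1)"
    unfolding sum_diag_resolvent[OF nz(1)] sum_diag_resolvent[OF nz(2)]
    by (simp add: sum.distrib sum_subtractf sum_distrib_left sum_divide_distrib diff_divide_distrib right_diff_distrib)
  also have "\<dots> = (\<Sum>a<CARD('n). eigs g a / (w - eigs g a) * (eigs g a / (w' - eigs g a)))"
  proof (rule sum.cong[OF refl])
    fix a assume "a \<in> {..<CARD('n)}"
    then have *: "w - eigs g a \<noteq> 0" "w' - eigs g a \<noteq> 0" using ne by auto
    have r: "(1 / (w - eigs g a) - 1 / (w' - eigs g a)) / (w' - w) = 1 / ((w - eigs g a) * (w' - eigs g a))"
      using * \<open>w \<noteq> w'\<close> by (simp add: divide_simps)
    show "w * w' * ((1 / (w - eigs g a) - 1 / (w' - eigs g a)) / (w' - w))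
       - w * (1 / (w - eigs g a)) - w' * (1 / (w' - eigs g a)) + 1 =
       eigs g a / (w - eigs g a) * (eigs g a / (w' - eigs g a))"
      unfolding r using * by (simp add: divide_simps) (simp add: algebra_simps)
  qed
  finally show ?thesis .
qed

text \<open>With M = w - g, the matrix w - h g is (1 + v y) M for the row vector y = -(z - 1) v* g
  M^(-1), and the rank one formula applies. The result is affine in z, so a product of r such
  determinants is a polynomial in z - 1.\<close>

lemma mdet_reflection_update:
  fixes v :: "complex^'n" and z :: complex
  assumes nz: "mdet (smat w - g) \<noteq> 0"
  defines "h \<equiv> smat 1 + outer v (\<chi> j. (z - 1) * cnj (v $ j))"
  shows "mdet (smat w - h ** g) =
    mdet (smat w - g) * (1 - (z - 1) * (\<Sum>a\<in>UNIV. \<Sum>b\<in>UNIV. cnj (v $ a) * gres w g $ a $ b * v $ b))"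
proof -
  define y where "y = (\<chi> b. - (z - 1) * (\<Sum>a\<in>UNIV. cnj (v $ a) * gres w g $ a $ b))"
  let ?M = "smat w - g"
  have gM: "gres w g ** ?M = g"
    using matrix_inv_nonsingular[OF nz] by (simp add: gres_def resolvent_def matrix_mul_assoc[symmetric])
  have "(\<Sum>b\<in>UNIV. y $ b * ?M $ b $ j) = - (z - 1) * (\<Sum>a\<in>UNIV. cnj (v $ a) * g $ a $ j)" for j
  proof -
    have "(\<Sum>b\<in>UNIV. y $ b * ?M $ b $ j) =
        (\<Sum>b\<in>UNIV. \<Sum>a\<in>UNIV. - (z - 1) * (cnj (v $ a) * (gres w g $ a $ b * ?M $ b $ j)))"
      unfolding y_def by (simp add: sum_distrib_left sum_distrib_right mult_ac)
    also have "\<dots> = (\<Sum>a\<in>UNIV. - (z - 1) * (cnj (v $ a) * (\<Sum>b\<in>UNIV. gres w g $ a $ b * ?M $ b $ j)))"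
      by (subst sum.swap) (simp add: sum_distrib_left)
    also have "(\<lambda>a. \<Sum>b\<in>UNIV. gres w g $ a $ b * ?M $ b $ j) = (\<lambda>a. (gres w g ** ?M) $ a $ j)"
      by (simp add: matrix_matrix_mult_def)
    finally show ?thesis by (simp only: gM sum_distrib_left)
  qed
  then have O1: "(outer v y ** ?M) $ i $ j = - (z - 1) * v $ i * (\<Sum>a\<in>UNIV. cnj (v $ a) * g $ a $ j)" for i j
    by (simp only: outer_def matrix_matrix_mult_def vec_lambda_beta mult.assoc sum_distrib_left[symmetric]) simp
  have O2: "(outer v (\<chi> j. (z - 1) * cnj (v $ j)) ** g) $ i $ j =
      (z - 1) * v $ i * (\<Sum>a\<in>UNIV. cnj (v $ a) * g $ a $ j)" for i j
    by (simp add: outer_def matrix_matrix_mult_def sum_distrib_left mult_ac)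
  have "outer v y ** ?M = - (outer v (\<chi> j. (z - 1) * cnj (v $ j)) ** g)"
    unfolding vec_eq_iff vector_uminus_component O1 O2 by (simp add: algebra_simps)
  then have "smat w - h ** g = (smat 1 + outer v y) ** ?M"
    by (simp add: h_def matrix_add_mult)
  then have "mdet (smat w - h ** g) = (1 + (\<Sum>i\<in>UNIV. v $ i * y $ i)) * mdet ?M"
    by (simp only: det_mul mdet_identity_plus_rank_one)
  also have "(\<Sum>i\<in>UNIV. v $ i * y $ i) =
      - (z - 1) * (\<Sum>b\<in>UNIV. \<Sum>a\<in>UNIV. cnj (v $ a) * gres w g $ a $ b * v $ b)"
    by (simp add: y_def sum_distrib_left sum_distrib_right mult_ac)
  also have "(\<Sum>b\<in>UNIV. \<Sum>a\<in>UNIV. cnj (v $ a) * gres w g $ a $ b * v $ b) =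
      (\<Sum>a\<in>UNIV. \<Sum>b\<in>UNIV. cnj (v $ a) * gres w g $ a $ b * v $ b)" by (rule sum.swap)
  finally show ?thesis by (simp add: algebra_simps)
qed

subsection \<open>Continuity and compactness\<close>

lemma continuous_on_matrix_nth: "continuous_on S (\<lambda>g :: complex^'n^'m. g $ i $ j)"
  by (intro continuous_intros)

lemma continuous_on_mdet:
  fixes M :: "'a::topological_space \<Rightarrow> complex^'n^'n"
  assumes "\<And>i j. continuous_on S (\<lambda>x. M x $ i $ j)"
  shows "continuous_on S (\<lambda>x. mdet (M x))"
  unfolding Determinants.det_def by (intro continuous_intros assms)

lemma continuous_on_mdet_smat_minus: "continuous_on S (\<lambda>g :: complex^'n^'n. mdet (smat w - g))"
  by (rule continuous_on_mdet) (simp, intro continuous_intros continuous_on_matrix_nth)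

lemma mdet_smat_minus_nonzero:
  "g \<in> unitary_group \<Longrightarrow> norm w = 2 \<Longrightarrow> mdet (smat w - g) \<noteq> 0"
  using unitary_eigenvalue_norm by fastforce

text \<open>Cramer's rule writes the entries as quotients of determinants, and det(w - g) has no
  zero on the unitary group because all eigenvalues have absolute value 1.\<close>

lemma continuous_on_gres:
  assumes "norm w = 2"
  shows "continuous_on unitary_group (\<lambda>g :: complex^'n^'n. gres w g $ a $ b)"
proof -
  have nz: "mdet (smat w - g) \<noteq> 0" if "g \<in> unitary_group" for g :: "complex^'n^'n"
    using mdet_smat_minus_nonzero[OF that assms] .
  have adj: "continuous_on unitary_group (\<lambda>g :: complex^'n^'n.
      mdet (\<chi> i l. if l = c then if i = b then 1 else 0 else (smat w - g) $ i $ l))" for c :: 'n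
  proof (rule continuous_on_mdet)
    fix i j :: 'n
    show "continuous_on unitary_group (\<lambda>g :: complex^'n^'n.
        (\<chi> i l. if l = c then if i = b then 1 else 0 else (smat w - g) $ i $ l) $ i $ j)"
      by (cases "j = c") (auto intro!: continuous_intros)
  qed
  have "continuous_on unitary_group (\<lambda>g :: complex^'n^'n. \<Sum>c\<in>UNIV. g $ a $ c *
      (mdet (\<chi> i l. if l = c then if i = b then 1 else 0 else (smat w - g) $ i $ l) / mdet (smat w - g)))"
    by (intro continuous_intros continuous_on_mdet_smat_minus adj) (use nz in auto)
  moreover have "gres w g $ a $ b = (\<Sum>c\<in>UNIV. g $ a $ c *
      (mdet (\<chi> i l. if l = c then if i = b then 1 else 0 else (smat w - g) $ i $ l) / mdet (smat w - g)))"
    if "g \<in> unitary_group" for g :: "complex^'n^'n"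
    unfolding gres_def matrix_matrix_mult_def vec_lambda_beta resolvent_def
    by (simp only: matrix_inv_cramer[OF nz[OF that]])
  ultimately show ?thesis by (simp cong: continuous_on_cong)
qed

lemma continuous_on_coeff_prod:
  fixes p :: "'i \<Rightarrow> 'a::topological_space \<Rightarrow> complex poly"
  assumes "\<And>i k. i \<in> I \<Longrightarrow> continuous_on S (\<lambda>x. coeff (p i x) k)"
  shows "continuous_on S (\<lambda>x. coeff (\<Prod>i\<in>I. p i x) k)"
  using assms
proof (induction I arbitrary: k rule: infinite_finite_induct)
  case (insert i I)
  then show ?case
    by (simp add: coeff_mult) (intro continuous_intros; auto)
qed auto

lemma compact_unitary_group: "compact (unitary_group :: (complex^'n^'n) set)"
proof -
  have "unitary_group = (\<Inter>i j. {g :: complex^'n^'n. (g ** conj_transpose g) $ i $ j = smat 1 $ i $ j} \<inter>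
      {g. (conj_transpose g ** g) $ i $ j = smat 1 $ i $ j})"
    by (auto simp: unitary_group_def vec_eq_iff)
  moreover have "closed \<dots>"
    unfolding matrix_matrix_mult_def conj_transpose_def vec_lambda_beta
    by (intro closed_INT ballI closed_Int closed_Collect_eq continuous_intros)
  moreover have "bounded (unitary_group :: (complex^'n^'n) set)"
    unfolding bounded_iff
  proof (intro exI ballI)
    fix g :: "complex^'n^'n" assume g: "g \<in> unitary_group"
    have le: "norm (g $ i $ j) \<le> 1" for i j
    proof -
      have "(g ** conj_transpose g) $ i $ i = 1" using g by (simp add: unitary_group_def smat_nth)
      then have "(\<Sum>k\<in>UNIV. of_real ((norm (g $ i $ k))\<^sup>2)) = (1 :: complex)"
        by (simp only: complex_norm_square) (simp add: matrix_matrix_mult_def conj_transpose_def)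
      then have "(\<Sum>k\<in>UNIV. (norm (g $ i $ k))\<^sup>2) = 1"
        by (simp only: of_real_sum[symmetric] of_real_eq_1_iff)
      moreover have "(norm (g $ i $ j))\<^sup>2 \<le> (\<Sum>k\<in>UNIV. (norm (g $ i $ k))\<^sup>2)"
        by (rule member_le_sum) auto
      ultimately show ?thesis using power2_le_imp_le[of "norm (g $ i $ j)" 1] by simp
    qed
    have "norm g \<le> (\<Sum>i\<in>UNIV. norm (g $ i))"
      unfolding norm_vec_def by (rule L2_set_le_sum) simp
    also have "\<dots> \<le> (\<Sum>i\<in>(UNIV :: 'n set). \<Sum>j\<in>(UNIV :: 'n set). 1)"
    proof (rule sum_mono)
      fix i
      have "norm (g $ i) \<le> (\<Sum>j\<in>UNIV. norm (g $ i $ j))"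
        unfolding norm_vec_def[of "g $ i"] by (rule L2_set_le_sum) simp
      also have "\<dots> \<le> (\<Sum>j\<in>(UNIV :: 'n set). 1)" by (rule sum_mono) (rule le)
      finally show "norm (g $ i) \<le> (\<Sum>j\<in>(UNIV :: 'n set). 1)" .
    qed
    finally show "norm g \<le> (\<Sum>i\<in>(UNIV :: 'n set). \<Sum>j\<in>(UNIV :: 'n set). 1)" .
  qed
  ultimately show ?thesis by (simp add: compact_eq_bounded_closed)
qed

subsection \<open>Integration against Haar measure\<close>

lemma coeff_prod_linear:
  fixes q :: "'i \<Rightarrow> complex"
  assumes "finite I"
  shows "coeff (\<Prod>i\<in>I. [:1, - q i:]) 0 = 1"
    "coeff (\<Prod>i\<in>I. [:1, - q i:]) 1 = - (\<Sum>i\<in>I. q i)"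
    "2 * coeff (\<Prod>i\<in>I. [:1, - q i:]) 2 = (\<Sum>i\<in>I. q i)\<^sup>2 - (\<Sum>i\<in>I. (q i)\<^sup>2)"
proof -
  have "coeff (\<Prod>i\<in>I. [:1, - q i:]) 0 = 1 \<and>
    coeff (\<Prod>i\<in>I. [:1, - q i:]) 1 = - (\<Sum>i\<in>I. q i) \<and>
    2 * coeff (\<Prod>i\<in>I. [:1, - q i:]) 2 = (\<Sum>i\<in>I. q i)\<^sup>2 - (\<Sum>i\<in>I. (q i)\<^sup>2)"
    using assms
  proof (induction I rule: finite_induct)
    case empty
    then show ?case by simp
  next
    case (insert i I)
    let ?P = "\<Prod>i\<in>I. [:1, - q i:]"
    have "coeff ([:1, - q i:] * ?P) 0 = coeff ?P 0"
      "coeff ([:1, - q i:] * ?P) 1 = coeff ?P 1 - q i * coeff ?P 0"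
      "coeff ([:1, - q i:] * ?P) 2 = coeff ?P 2 - q i * coeff ?P 1"
      by (simp_all add: numeral_2_eq_2)
    with insert show ?case
      by (simp add: algebra_simps power2_eq_square)
  qed
  then show "coeff (\<Prod>i\<in>I. [:1, - q i:]) 0 = 1"
    "coeff (\<Prod>i\<in>I. [:1, - q i:]) 1 = - (\<Sum>i\<in>I. q i)"
    "2 * coeff (\<Prod>i\<in>I. [:1, - q i:]) 2 = (\<Sum>i\<in>I. q i)\<^sup>2 - (\<Sum>i\<in>I. (q i)\<^sup>2)" by auto
qed

text \<open>Comparing Taylor coefficients at \<open>z = 1\<close>; no differentiation under the integral is needed
  because the integrand is polynomial in \<open>z\<close>.\<close>

lemma integral_taylor_coeffs:
  fixes p :: "'a \<Rightarrow> complex poly"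
  assumes int: "\<And>k. integrable M (\<lambda>g. coeff (p g) k)"
    and deg: "\<And>g. g \<in> space M \<Longrightarrow> degree (p g) \<le> d"
    and eq: "\<And>z. norm z = 1 \<Longrightarrow> (LINT g|M. poly (p g) (z - 1)) = z ^ k * L"
  shows "(LINT g|M. coeff (p g) j) = of_nat (k choose j) * L"
proof -
  define c where "c = (\<lambda>j. LINT g|M. coeff (p g) j)"
  define Q where "Q = (\<Sum>j\<le>d. monom (c j) j)"
  define Q' where "Q' = smult L ([:1, 1:] ^ k)"
  have "poly Q y = poly Q' y" if "norm (y + 1) = 1" for y
  proof -
    have "poly Q' y = (y + 1) ^ k * L" by (simp add: Q'_def poly_power add.commute mult.commute)
    also have "\<dots> = (LINT g|M. poly (p g) y)" using eq[OF that] by simp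
    also have "\<dots> = (LINT g|M. (\<Sum>j\<le>d. coeff (p g) j * y ^ j))"
    proof (rule Bochner_Integration.integral_cong[OF refl])
      fix g assume "g \<in> space M"
      then show "poly (p g) y = (\<Sum>j\<le>d. coeff (p g) j * y ^ j)"
        unfolding poly_altdef
        by (intro sum.mono_neutral_left) (use deg in \<open>auto simp: coeff_eq_0\<close>)
    qed
    also have "\<dots> = (\<Sum>j\<le>d. c j * y ^ j)"
      using int by (simp add: c_def)
    finally show ?thesis by (simp add: Q_def poly_sum poly_monom)
  qed
  then have "(\<lambda>z. z - 1) ` sphere 0 1 \<subseteq> {y. poly (Q - Q') y = 0}" by auto
  moreover have "infinite ((\<lambda>z :: complex. z - 1) ` sphere 0 1)"
  proof -
    have "infinite (sphere (0 :: complex) 1)"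
    proof -
      have "inj (\<lambda>k :: nat. cis (inverse (real (Suc k))))"
      proof (rule injI)
        fix i j :: nat assume "cis (inverse (real (Suc i))) = cis (inverse (real (Suc j)))"
        then have c: "cos (inverse (real (Suc i))) = cos (inverse (real (Suc j)))"
          by (simp add: complex_eq_iff)
        have le: "inverse (real (Suc k)) \<le> pi" "0 \<le> inverse (real (Suc k))" for k
        proof -
          have "inverse (real (Suc k)) \<le> 1" by (rule inverse_le_1_iff[THEN iffD2]) simp
          then show "inverse (real (Suc k)) \<le> pi" using pi_gt3 by linarith
          show "0 \<le> inverse (real (Suc k))" by simp
        qed
        have "inverse (real (Suc i)) = inverse (real (Suc j))"
          by (rule cos_inj_pi[OF le(2) le(1) le(2) le(1) c])
        then show "i = j" by (simp only: inverse_eq_iff_eq of_nat_eq_iff nat.inject)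
      qed
      then have "infinite (range (\<lambda>k :: nat. cis (inverse (real (Suc k)))))"
        by (rule range_inj_infinite)
      moreover have "range (\<lambda>k :: nat. cis (inverse (real (Suc k)))) \<subseteq> sphere 0 1" by auto
      ultimately show ?thesis using finite_subset by blast
    qed
    moreover have "inj_on (\<lambda>z :: complex. z - 1) (sphere 0 1)" by (auto simp: inj_on_def)
    ultimately show ?thesis using finite_image_iff by blast
  qed
  ultimately have "Q - Q' = 0"
    using poly_roots_finite[of "Q - Q'"] finite_subset by blast
  then have "coeff Q j = coeff Q' j" by simp
  moreover have "coeff Q j = (if j \<le> d then c j else 0)"
    by (simp add: Q_def coeff_sum if_distrib cong: if_cong)
  moreover have "c j = 0" if "j > d"
    unfolding c_def using deg that
    by (intro integral_eq_zero_AE AE_I2) (metis coeff_eq_0 le_less_trans)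
  moreover have "coeff Q' j = of_nat (k choose j) * L"
  proof (cases "j \<le> k")
    case True
    then show ?thesis by (simp add: Q'_def coeff_linear_poly_power)
  next
    case False
    then have "coeff ([:1, 1 :: complex:] ^ k) j = 0"
      by (intro coeff_eq_0) (simp add: degree_linear_power)
    then show ?thesis using False by (simp add: Q'_def binomial_eq_0)
  qed
  ultimately have "c j = of_nat (k choose j) * L" by (cases "j \<le> d") auto
  then show ?thesis by (simp add: c_def)
qed

locale haar_unitary =
  fixes \<mu> :: "(complex^'n^'n) measure"
  assumes haar: "haar_prob_measure \<mu>"
begin

lemma sets_haar: "sets \<mu> = sets (restrict_space borel unitary_group)"
  using haar by (simp add: haar_prob_measure_def)

lemma space_haar: "space \<mu> = unitary_group"
  using sets_eq_imp_space_eq[OF sets_haar] by (simp add: space_restrict_space)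

lemma finite_measure_haar: "finite_measure \<mu>"
  by (rule finite_measureI) (use haar in \<open>simp add: haar_prob_measure_def\<close>)

lemma measurable_continuous:
  fixes f :: "complex^'n^'n \<Rightarrow> 'b::topological_space"
  assumes "continuous_on unitary_group f"
  shows "f \<in> borel_measurable \<mu>"
  using borel_measurable_continuous_on_restrict[OF assms] measurable_cong_sets[OF sets_haar refl] by blast

lemma integrable_continuous:
  fixes f :: "complex^'n^'n \<Rightarrow> complex"
  assumes "continuous_on unitary_group f"
  shows "integrable \<mu> f"
proof -
  have "bounded (f ` unitary_group)"
    by (rule compact_imp_bounded[OF compact_continuous_image[OF assms compact_unitary_group]])
  then obtain B where "\<And>g. g \<in> unitary_group \<Longrightarrow> norm (f g) \<le> B"
    by (auto simp: bounded_iff)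
  then show ?thesis
    by (intro finite_measure.integrable_const_bound[OF finite_measure_haar, of _ B] AE_I2
        measurable_continuous assms) (simp add: space_haar)
qed

lemma integral_invariant:
  fixes f :: "complex^'n^'n \<Rightarrow> complex"
  assumes h: "h \<in> unitary_group" and f: "continuous_on unitary_group f"
  shows "(LINT g|\<mu>. f (h ** g)) = (LINT g|\<mu>. f g)"
proof -
  have "continuous_on unitary_group (\<lambda>g. h ** g)"
    unfolding matrix_matrix_mult_def by (intro continuous_intros)
  then have "(\<lambda>g. h ** g) \<in> borel_measurable \<mu>" by (rule measurable_continuous)
  then have "(\<lambda>g. h ** g) \<in> measurable \<mu> (restrict_space borel unitary_group)"
    by (intro measurable_restrict_space2) (auto simp: space_haar unitary_mult[OF h])
  then have meas: "(\<lambda>g. h ** g) \<in> measurable \<mu> \<mu>"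
    using measurable_cong_sets[OF refl sets_haar] by blast
  have hh: "h ** conj_transpose h = smat 1" "conj_transpose h ** h = smat 1"
    using h by (auto simp: unitary_group_def)
  have "distr \<mu> \<mu> (\<lambda>g. h ** g) = \<mu>"
  proof (rule measure_eqI)
    fix E assume "E \<in> sets (distr \<mu> \<mu> (\<lambda>g. h ** g))"
    then have E: "E \<in> sets \<mu>" by simp
    then have sub: "E \<subseteq> unitary_group" using sets.sets_into_space[of E \<mu>] by (simp add: space_haar)
    \<comment> \<open>\<open>haar_prob_measure\<close> speaks of images of sets whereas
      \<open>distr\<close> uses preimages. The preimage under multiplication by h is the image under
      multiplication by its inverse.\<close>
    have "(\<lambda>g. h ** g) -` E \<inter> space \<mu> = (\<lambda>g. conj_transpose h ** g) ` E"
    proof (intro equalityI subsetI)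
      fix g assume "g \<in> (\<lambda>g. h ** g) -` E \<inter> space \<mu>"
      then have "h ** g \<in> E" "g = conj_transpose h ** (h ** g)"
        by (auto simp: matrix_mul_assoc hh)
      then show "g \<in> (\<lambda>g. conj_transpose h ** g) ` E" by blast
    next
      fix g assume "g \<in> (\<lambda>g. conj_transpose h ** g) ` E"
      then show "g \<in> (\<lambda>g. h ** g) -` E \<inter> space \<mu>"
        using sub unitary_mult[OF unitary_conj_transpose[OF h]]
        by (auto simp: matrix_mul_assoc hh space_haar)
    qed
    then have "emeasure (distr \<mu> \<mu> (\<lambda>g. h ** g)) E = emeasure \<mu> ((\<lambda>g. conj_transpose h ** g) ` E)"
      by (simp add: emeasure_distr[OF meas E])
    also have "\<dots> = emeasure \<mu> E"
      using haar unitary_conj_transpose[OF h] E by (simp add: haar_prob_measure_def)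
    finally show "emeasure (distr \<mu> \<mu> (\<lambda>g. h ** g)) E = emeasure \<mu> E" .
  qed simp
  then have "(LINT g|\<mu>. f g) = (LINT g|distr \<mu> \<mu> (\<lambda>g. h ** g). f g)" by simp
  also have "\<dots> = (LINT g|\<mu>. f (h ** g))"
    by (rule integral_distr[OF meas measurable_continuous[OF f]])
  finally show ?thesis ..
qed

end

subsection \<open>Moments of products of characteristic polynomials\<close>

definition char_prod :: "nat \<Rightarrow> nat \<Rightarrow> (nat \<Rightarrow> complex) \<Rightarrow> complex^'n^'n \<Rightarrow> complex" where
  "char_prod m r w g = (\<Prod>i<r. mdet (smat (w i) - g)) * inverse (mdet g) ^ m"

lemma char_prod_eigs:
  fixes g :: "complex^'n^'n"
  shows "char_prod m r w g = (\<Prod>a<CARD('n). root_factor m r w (eigs g a))"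
proof -
  have "(\<Prod>i<r. mdet (smat (w i) - g)) = (\<Prod>a<CARD('n). \<Prod>i<r. w i - eigs g a)"
    unfolding mdet_smat_minus by (rule prod.swap)
  moreover have "inverse (mdet g) ^ m = (\<Prod>a<CARD('n). inverse (eigs g a) ^ m)"
    by (simp only: mdet_eigs prod_inversef[unfolded o_def, symmetric] prod_power_distrib)
  ultimately show ?thesis by (simp add: char_prod_def root_factor_def prod.distrib mult.commute)
qed

lemma continuous_on_char_prod: "continuous_on unitary_group (char_prod m r w :: complex^'n^'n \<Rightarrow> complex)"
proof -
  have "continuous_on unitary_group (mdet :: complex^'n^'n \<Rightarrow> complex)"
    by (rule continuous_on_mdet) (rule continuous_on_matrix_nth)
  then show ?thesis
    unfolding char_prod_def[abs_def]
    by (intro continuous_intros continuous_on_mdet_smat_minus) (auto simp: mdet_unitary_nonzero)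
qed

lemma two_choose_two: "2 * of_nat (m choose 2) = (of_nat m * (of_nat m - 1) :: complex)"
  by (induction m) (auto simp: numeral_2_eq_2 algebra_simps)

lemma degree_prod_linear_le:
  assumes "finite I"
  shows "degree (smult c (\<Prod>i\<in>I. [:1, - q i:]) :: complex poly) \<le> card I"
proof -
  have "degree (smult c (\<Prod>i\<in>I. [:1, - q i:])) \<le> degree (\<Prod>i\<in>I. [:1, - q i:])"
    by (rule degree_smult_le)
  also have "\<dots> \<le> (\<Sum>i\<in>I. degree [:1, - q i:])"
    using degree_prod_sum_le[OF assms, of "\<lambda>i. [:1, - q i:]"] by (simp add: o_def)
  also have "\<dots> \<le> (\<Sum>i\<in>I. 1)" by (rule sum_mono) simp
  finally show ?thesis by simp
qed

text \<open>In the expanded squares only \<alpha>^2 and the product of \<beta> and \<gamma> are free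
  of the phase. The first and second powers of the phase and of its conjugate sum to 0 over the
  fourth roots of unity.\<close>

lemma fourth_roots_average:
  fixes \<alpha> \<beta> \<gamma> :: complex
  shows "((\<alpha> + 1 * \<beta> + cnj 1 * \<gamma>) / 2)\<^sup>2 + ((\<alpha> + \<i> * \<beta> + cnj \<i> * \<gamma>) / 2)\<^sup>2 +
    ((\<alpha> + (- 1) * \<beta> + cnj (- 1) * \<gamma>) / 2)\<^sup>2 + ((\<alpha> + (- \<i>) * \<beta> + cnj (- \<i>) * \<gamma>) / 2)\<^sup>2 =
    \<alpha>\<^sup>2 + 2 * (\<beta> * \<gamma>)"
  by (simp add: power2_eq_square field_simps)

section \<open>Moments obtained from rank one reflections\<close>

context haar_unitary
begin

abbreviation char_mean :: "nat \<Rightarrow> nat \<Rightarrow> (nat \<Rightarrow> complex) \<Rightarrow> complex" where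
  "char_mean m r w \<equiv> LINT g|\<mu>. char_prod m r w g"

lemma integrable_char_prod_mult:
  assumes "continuous_on unitary_group f"
  shows "integrable \<mu> (\<lambda>g. char_prod m r w g * f g)"
  by (intro integrable_continuous continuous_on_mult continuous_on_char_prod assms)

text \<open>The factor z^m compensates det(h)^(-m). Twice the second Taylor coefficient of z^m at 1
  is m (m - 1), and twice that of the product of the 1 - (z - 1) q_i is the sum of q_i q_j over
  ordered pairs of distinct indices.\<close>

lemma reflection_moments:
  fixes v :: "complex^'n"
  assumes v: "(\<Sum>a\<in>UNIV. v $ a * cnj (v $ a)) = 1" and w: "\<And>i. norm (w i) = 2"
  defines "q \<equiv> \<lambda>i g. \<Sum>a\<in>UNIV. \<Sum>b\<in>UNIV. cnj (v $ a) * gres (w i) g $ a $ b * v $ b"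
  shows "(LINT g|\<mu>. char_prod m r w g * ((\<Sum>i<r. q i g)\<^sup>2 - (\<Sum>i<r. (q i g)\<^sup>2))) =
      of_nat m * (of_nat m - 1) * char_mean m r w"
proof -
  define p where "p = (\<lambda>g. smult (char_prod m r w g) (\<Prod>i<r. [:1, - q i g:]))"
  have cq: "continuous_on unitary_group (q i)" for i
    unfolding q_def by (intro continuous_intros continuous_on_gres w)
  have ccoeff: "continuous_on unitary_group (\<lambda>g. coeff [:1, - q i g:] k)" for i k
    by (cases k; cases "k - 1") (auto intro!: continuous_intros cq)
  have int: "integrable \<mu> (\<lambda>g. coeff (p g) k)" for k
    unfolding p_def coeff_smult
    by (intro integrable_char_prod_mult continuous_on_coeff_prod ccoeff)
  have deg: "degree (p g) \<le> r" for g
    unfolding p_def using degree_prod_linear_le[of "{..<r}"] by simp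
  have "(LINT g|\<mu>. poly (p g) (z - 1)) = z ^ m * char_mean m r w" if z: "norm z = 1" for z
  proof -
    define h where "h = smat 1 + outer v (\<chi> j. (z - 1) * cnj (v $ j))"
    have h: "h \<in> unitary_group" "mdet h = z"
      unfolding h_def by (rule unitary_reflection[OF v z])+
    have "z \<noteq> 0" using z by auto
    have "poly (p g) (z - 1) = z ^ m * char_prod m r w (h ** g)" if g: "g \<in> unitary_group" for g
    proof -
      have "mdet (smat (w i) - h ** g) = mdet (smat (w i) - g) * (1 - (z - 1) * q i g)" for i
        unfolding h_def q_def by (rule mdet_reflection_update[OF mdet_smat_minus_nonzero[OF g w]])
      then have "char_prod m r w (h ** g) = (\<Prod>i<r. mdet (smat (w i) - g)) * (\<Prod>i<r. 1 - (z - 1) * q i g) *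
          inverse (z * mdet g) ^ m"
        by (simp add: char_prod_def prod.distrib det_mul h)
      then show ?thesis
        using \<open>z \<noteq> 0\<close> by (simp add: p_def poly_prod char_prod_def power_mult_distrib field_simps)
    qed
    then have "(LINT g|\<mu>. poly (p g) (z - 1)) = (LINT g|\<mu>. z ^ m * char_prod m r w (h ** g))"
      by (intro Bochner_Integration.integral_cong) (auto simp: space_haar)
    also have "\<dots> = z ^ m * (LINT g|\<mu>. char_prod m r w (h ** g))" by simp
    also have "(LINT g|\<mu>. char_prod m r w (h ** g)) = char_mean m r w"
      by (rule integral_invariant[OF h(1) continuous_on_char_prod])
    finally show ?thesis .
  qed
  from integral_taylor_coeffs[OF int deg this, of 2]
  have "(LINT g|\<mu>. 2 * coeff (p g) 2) = 2 * of_nat (m choose 2) * char_mean m r w"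
    by simp
  moreover have "2 * coeff (p g) 2 = char_prod m r w g * ((\<Sum>i<r. q i g)\<^sup>2 - (\<Sum>i<r. (q i g)\<^sup>2))" for g
    unfolding p_def coeff_smult mult.left_commute[of 2] coeff_prod_linear(3)[OF finite_lessThan] ..
  ultimately show ?thesis by (simp only: two_choose_two)
qed

text \<open>A polarised second Taylor coefficient: a sum over ordered pairs of distinct roots, the
  only pairs to which \<open>sum_diag_gres_mult\<close> applies.\<close>

definition gpair :: "nat \<Rightarrow> (nat \<Rightarrow> complex) \<Rightarrow> 'n \<Rightarrow> 'n \<Rightarrow> 'n \<Rightarrow> 'n \<Rightarrow> complex^'n^'n \<Rightarrow> complex" where
  "gpair r w a b c d g = (\<Sum>i<r. gres (w i) g $ a $ b) * (\<Sum>i<r. gres (w i) g $ c $ d) -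
     (\<Sum>i<r. gres (w i) g $ a $ b * gres (w i) g $ c $ d)"

lemma continuous_on_gpair:
  assumes "\<And>i. norm (w i) = 2"
  shows "continuous_on unitary_group (gpair r w a b c d)"
  unfolding gpair_def[abs_def] by (intro continuous_intros continuous_on_gres assms)

lemma gpair_diagonal_moment:
  assumes w: "\<And>i. norm (w i) = 2"
  shows "(LINT g|\<mu>. char_prod m r w g * gpair r w a a a a g) =
      of_nat m * (of_nat m - 1) * char_mean m r w"
proof -
  have "axis a 1 $ c * cnj (axis a 1 $ c) = (if c = a then 1 else 0 :: complex)" for c
    by (simp add: axis_def)
  then have v: "(\<Sum>c\<in>UNIV. axis a 1 $ c * cnj (axis a 1 $ c)) = (1 :: complex)" by simp
  have "cnj (axis a 1 $ c) * gres (w i) g $ c $ d * axis a 1 $ d =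
      (if d = a then if c = a then gres (w i) g $ a $ a else 0 else 0)"
    for i c d and g :: "complex^'n^'n"
    by (simp add: axis_def)
  then have "(\<Sum>c\<in>UNIV. \<Sum>d\<in>UNIV. cnj (axis a 1 $ c) * gres (w i) g $ c $ d * axis a 1 $ d) = gres (w i) g $ a $ a"
    for i and g :: "complex^'n^'n"
    by simp
  then show ?thesis
    using reflection_moments[OF v w, of m r] by (simp add: gpair_def power2_eq_square)
qed

text \<open>Take v = (e_a + \<omega> e_b) / sqrt 2 for the four fourth roots of unity \<omega> and
  add up (fact \<open>pw\<close>). This reads 4 \<kappa> = 2 \<kappa> + 2 X, where X is the wanted
  integral and 2 \<kappa> on the right comes from the diagonal moments at a and b.\<close>

lemma gpair_off_diagonal_moment:
  assumes w: "\<And>i. norm (w i) = 2" and ab: "a \<noteq> b"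
  shows "(LINT g|\<mu>. char_prod m r w g * (gpair r w a a b b g + gpair r w a b b a g)) =
      of_nat m * (of_nat m - 1) * char_mean m r w"
proof -
  define \<kappa> where "\<kappa> = of_nat m * (of_nat m - 1) * char_mean m r w"
  define X where "X = (\<lambda>i c d (g :: complex^'n^'n). gres (w i) g $ c $ d)"
  define q where "q = (\<lambda>\<omega> i g. (X i a a g + X i b b g + \<omega> * X i a b g + cnj \<omega> * X i b a g) / 2)"
  define V where "V = (\<lambda>\<omega> g. (\<Sum>i<r. q \<omega> i g)\<^sup>2 - (\<Sum>i<r. (q \<omega> i g)\<^sup>2))"
  have mom: "(LINT g|\<mu>. char_prod m r w g * V \<omega> g) = \<kappa>" if "\<omega> * cnj \<omega> = 1" for \<omega>
  proof -
    define k :: complex where "k = of_real (1 / sqrt 2)"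
    have k: "cnj k = k" "k * k = 1 / 2"
      by (simp add: k_def) (simp add: k_def flip: of_real_mult)
    define v :: "complex^'n" where "v = (\<chi> c. (if c = a then k else 0) + (if c = b then k * \<omega> else 0))"
    have "v $ c * cnj (v $ c) = (if c = a then 1 / 2 else 0) + (if c = b then 1 / 2 else 0)" for c
    proof -
      have "k * \<omega> * (k * cnj \<omega>) = (k * k) * (\<omega> * cnj \<omega>)" by (simp only: mult_ac)
      then have "k * \<omega> * (k * cnj \<omega>) = 1 / 2" by (simp only: k that) simp
      then show ?thesis using ab by (auto simp: v_def k)
    qed
    then have v: "(\<Sum>c\<in>UNIV. v $ c * cnj (v $ c)) = 1" by (simp add: sum.distrib)
    have "(\<Sum>c\<in>UNIV. \<Sum>d\<in>UNIV. cnj (v $ c) * gres (w i) g $ c $ d * v $ d) = q \<omega> i g" for i g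
    proof -
      have vr: "(\<Sum>d\<in>UNIV. f d * v $ d) = f a * k + f b * (k * \<omega>)" for f :: "'n \<Rightarrow> complex"
      proof -
        have "f d * v $ d = (if d = a then f a * k else 0) + (if d = b then f b * (k * \<omega>) else 0)" for d
          using ab by (auto simp: v_def)
        then show ?thesis by (simp add: sum.distrib)
      qed
      have vl: "(\<Sum>c\<in>UNIV. cnj (v $ c) * f c) = k * f a + k * cnj \<omega> * f b" for f :: "'n \<Rightarrow> complex"
      proof -
        have "cnj (v $ c) * f c = (if c = a then k * f a else 0) + (if c = b then k * cnj \<omega> * f b else 0)" for c
          using ab by (auto simp: v_def k)
        then show ?thesis by (simp add: sum.distrib)
      qed
      have "(\<Sum>c\<in>UNIV. \<Sum>d\<in>UNIV. cnj (v $ c) * gres (w i) g $ c $ d * v $ d) =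
          (\<Sum>c\<in>UNIV. cnj (v $ c) * (\<Sum>d\<in>UNIV. gres (w i) g $ c $ d * v $ d))"
        by (simp add: sum_distrib_left mult.assoc)
      also have "\<dots> = k * (X i a a g * k + X i a b g * (k * \<omega>)) + k * cnj \<omega> * (X i b a g * k + X i b b g * (k * \<omega>))"
        unfolding vr vl X_def ..
      also have "\<dots> = (k * k) * (X i a a g + (\<omega> * cnj \<omega>) * X i b b g + \<omega> * X i a b g + cnj \<omega> * X i b a g)"
        by (simp add: algebra_simps)
      finally show ?thesis by (simp add: q_def k that)
    qed
    then show ?thesis
      unfolding \<kappa>_def V_def using reflection_moments[OF v w, of m r] by simp
  qed
  have cX: "continuous_on unitary_group (X i c d)" for i c d
    unfolding X_def by (rule continuous_on_gres[OF w])
  have cV: "continuous_on unitary_group (V \<omega>)" for \<omega>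
    unfolding V_def q_def by (intro continuous_intros cX) simp_all
  note int = integrable_char_prod_mult[OF continuous_on_gpair[OF w]]
  have pw: "V 1 g + V \<i> g + V (- 1) g + V (- \<i>) g =
      gpair r w a a a a g + gpair r w b b b b g + 2 * (gpair r w a a b b g + gpair r w a b b a g)" for g
  proof -
    have sumq: "(\<Sum>i<r. q \<omega> i g) = ((\<Sum>i<r. X i a a g + X i b b g) + \<omega> * (\<Sum>i<r. X i a b g) +
        cnj \<omega> * (\<Sum>i<r. X i b a g)) / 2" for \<omega>
      by (simp add: q_def sum_divide_distrib[symmetric] sum.distrib sum_distrib_left)
    have "V 1 g + V \<i> g + V (- 1) g + V (- \<i>) g =
       (\<Sum>i<r. q 1 i g)\<^sup>2 + (\<Sum>i<r. q \<i> i g)\<^sup>2 + (\<Sum>i<r. q (- 1) i g)\<^sup>2 + (\<Sum>i<r. q (- \<i>) i g)\<^sup>2 -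
       (\<Sum>i<r. (q 1 i g)\<^sup>2 + (q \<i> i g)\<^sup>2 + (q (- 1) i g)\<^sup>2 + (q (- \<i>) i g)\<^sup>2)"
      unfolding V_def sum.distrib by (simp add: algebra_simps)
    also have "\<dots> = ((\<Sum>i<r. X i a a g + X i b b g)\<^sup>2 + 2 * ((\<Sum>i<r. X i a b g) * (\<Sum>i<r. X i b a g))) -
        (\<Sum>i<r. (X i a a g + X i b b g)\<^sup>2 + 2 * (X i a b g * X i b a g))"
      unfolding sumq fourth_roots_average unfolding q_def fourth_roots_average ..
    also have "\<dots> = gpair r w a a a a g + gpair r w b b b b g + 2 * (gpair r w a a b b g + gpair r w a b b a g)"
    proof -
      have "(\<Sum>i<r. (X i a a g + X i b b g)\<^sup>2 + 2 * (X i a b g * X i b a g)) =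
          (\<Sum>i<r. X i a a g * X i a a g) + (\<Sum>i<r. X i b b g * X i b b g) +
          2 * (\<Sum>i<r. X i a a g * X i b b g) + 2 * (\<Sum>i<r. X i a b g * X i b a g)"
        unfolding sum_distrib_left sum.distrib[symmetric]
        by (rule sum.cong) (simp_all add: power2_eq_square algebra_simps)
      then show ?thesis
        unfolding gpair_def sum.distrib X_def[symmetric] by (simp add: X_def power2_eq_square algebra_simps)
    qed
    finally show ?thesis .
  qed
  have "4 * \<kappa> = (LINT g|\<mu>. char_prod m r w g * V 1 g) + (LINT g|\<mu>. char_prod m r w g * V \<i> g) +
      (LINT g|\<mu>. char_prod m r w g * V (- 1) g) + (LINT g|\<mu>. char_prod m r w g * V (- \<i>) g)"
    by (simp add: mom)
  also have "\<dots> = (LINT g|\<mu>. char_prod m r w g * (V 1 g + V \<i> g + V (- 1) g + V (- \<i>) g))"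
    by (simp add: distrib_left integrable_char_prod_mult[OF cV])
  also have "\<dots> = (LINT g|\<mu>. char_prod m r w g * gpair r w a a a a g) +
      (LINT g|\<mu>. char_prod m r w g * gpair r w b b b b g) +
      2 * (LINT g|\<mu>. char_prod m r w g * (gpair r w a a b b g + gpair r w a b b a g))"
    unfolding pw by (simp add: distrib_left int mult.left_commute[of _ 2])
  also have "\<dots> = 2 * \<kappa> + 2 * (LINT g|\<mu>. char_prod m r w g * (gpair r w a a b b g + gpair r w a b b a g))"
    by (simp add: gpair_diagonal_moment[OF w] \<kappa>_def)
  finally show ?thesis by (simp add: \<kappa>_def mult.assoc)
qed

text \<open>Every index pair contributes the same moment, and the N pairs with a = b contribute it
  twice, whence N^2 + N. Summing over a and b is the contraction that turns matrix entries into
  traces.\<close>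

lemma gpair_total_moment:
  assumes w: "\<And>i. norm (w i) = 2"
  shows "(LINT g|\<mu>. char_prod m r w g * (\<Sum>a\<in>UNIV. \<Sum>b\<in>UNIV. gpair r w a a b b g + gpair r w a b b a g)) =
      of_nat m * (of_nat m - 1) * of_nat CARD('n) * (of_nat CARD('n) + 1) * char_mean m r w"
proof -
  define \<kappa> where "\<kappa> = of_nat m * (of_nat m - 1) * char_mean m r w"
  note int = integrable_char_prod_mult[OF continuous_on_gpair[OF w]]
  have "(LINT g|\<mu>. char_prod m r w g * (\<Sum>a\<in>UNIV. \<Sum>b\<in>UNIV. gpair r w a a b b g + gpair r w a b b a g)) =
      (\<Sum>a\<in>UNIV. \<Sum>b\<in>UNIV. LINT g|\<mu>. char_prod m r w g * (gpair r w a a b b g + gpair r w a b b a g))"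
    by (simp add: sum_distrib_left distrib_left int)
  also have "\<dots> = (\<Sum>a\<in>(UNIV :: 'n set). \<Sum>b\<in>(UNIV :: 'n set). \<kappa> + (if a = b then \<kappa> else 0))"
  proof (intro sum.cong refl)
    fix a b :: 'n
    show "(LINT g|\<mu>. char_prod m r w g * (gpair r w a a b b g + gpair r w a b b a g)) =
        \<kappa> + (if a = b then \<kappa> else 0)"
    proof (cases "a = b")
      case True
      have "(LINT g|\<mu>. char_prod m r w g * (gpair r w b b b b g + gpair r w b b b b g)) =
          (LINT g|\<mu>. char_prod m r w g * gpair r w b b b b g) + (LINT g|\<mu>. char_prod m r w g * gpair r w b b b b g)"
        unfolding distrib_left by (rule Bochner_Integration.integral_add[OF int int])
      then show ?thesis using True by (simp only: gpair_diagonal_moment[OF w] \<kappa>_def refl if_True)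
    qed (simp add: gpair_off_diagonal_moment[OF w] \<kappa>_def)
  qed
  also have "\<dots> = of_nat CARD('n) * (of_nat CARD('n) + 1) * \<kappa>"
    by (simp add: sum.distrib algebra_simps)
  finally show ?thesis by (simp add: \<kappa>_def mult_ac)
qed

end

section \<open>Moments obtained from scalar matrices, and the quadratic moment\<close>

lemma continuous_on_coeff_mdet:
  fixes M :: "'a::topological_space \<Rightarrow> complex poly^'n^'n"
  assumes "\<And>i j k. continuous_on S (\<lambda>x. coeff (M x $ i $ j) k)"
  shows "continuous_on S (\<lambda>x. coeff (mdet (M x)) k)"
proof -
  have "coeff (mdet (M x)) k =
      (\<Sum>p | p permutes UNIV. of_int (sign p) * coeff (\<Prod>i\<in>UNIV. M x $ i $ p i) k)" for x
    unfolding Determinants.det_def coeff_sum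
    by (rule sum.cong) (auto simp: sign_def)
  then show ?thesis
    by (simp only:) (intro continuous_intros continuous_on_coeff_prod assms)
qed

context haar_unitary
begin

text \<open>Here h is the scalar z with det h = z^N, so m is replaced by m N, and the linear factors
  are indexed by all pairs of an eigenvalue and a root. \<open>S2\<close> is twice the second Taylor
  coefficient divided by \<open>char_prod\<close>.\<close>

lemma scalar_moments:
  fixes r :: nat
  assumes w: "\<And>i. norm (w i) = 2"
  defines "S2 \<equiv> \<lambda>g :: complex^'n^'n. (ratio_sum CARD('n) r w (eigs g))\<^sup>2 -
      (\<Sum>a<CARD('n). \<Sum>i<r. (eigs g a / (w i - eigs g a))\<^sup>2)"
  shows "integrable \<mu> (\<lambda>g. char_prod m r w g * ratio_sum CARD('n) r w (eigs g))"
    "(LINT g|\<mu>. char_prod m r w g * ratio_sum CARD('n) r w (eigs g)) =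
      - of_nat m * of_nat CARD('n) * char_mean m r w"
    "integrable \<mu> (\<lambda>g. char_prod m r w g * S2 g)"
    "(LINT g|\<mu>. char_prod m r w g * S2 g) =
      of_nat m * of_nat CARD('n) * (of_nat m * of_nat CARD('n) - 1) * char_mean m r w"
proof -
  let ?N = "CARD('n)"
  define I where "I = {..<?N} \<times> {..<r}"
  define q where "q = (\<lambda>(g :: complex^'n^'n) (a, i). eigs g a / (w i - eigs g a))"
  \<comment> \<open>Determinants of matrices with linear polynomial entries have coefficients that
    are visibly continuous in g. Only on the unitary group, and only pointwise, does
    \<open>p_eq\<close> identify them with coefficients of a product over eigenvalues.\<close>
  define P where "P = (\<lambda>g :: complex^'n^'n. (\<Prod>i<r. mdet (\<chi> a b. [:(smat (w i) - g) $ a $ b, - g $ a $ b:])))"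
  define p where "p = (\<lambda>g. smult (inverse (mdet g) ^ m) (P g))"
  have p_eq: "p g = smult (char_prod m r w g) (\<Prod>t\<in>I. [:1, - q g t:])" if g: "g \<in> unitary_group" for g
  proof -
    have "poly (P g) y = (\<Prod>i<r. mdet (smat (w i) - g)) * (\<Prod>t\<in>I. 1 - y * q g t)" for y
    proof -
      have "(\<chi> a b. poly ((\<chi> a b. [:(smat (w i) - g) $ a $ b, - g $ a $ b:]) $ a $ b) y) =
          smat (w i) - smat (1 + y) ** g" for i
        by (simp add: vec_eq_iff algebra_simps)
      then have "poly (P g) y = (\<Prod>i<r. \<Prod>a<?N. w i - (1 + y) * eigs g a)"
        by (simp only: P_def poly_prod poly_mdet mdet_smat_minus_smult)
      also have "\<dots> = (\<Prod>i<r. \<Prod>a<?N. (w i - eigs g a) * (1 - y * q g (a, i)))"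
      proof (intro prod.cong refl)
        fix i a assume "a \<in> {..<?N}"
        then have "w i - eigs g a \<noteq> 0" using norm_eigs[OF g, of a] w[of i] by auto
        then have "(w i - eigs g a) * q g (a, i) = eigs g a" by (simp add: q_def)
        moreover have "(w i - eigs g a) * (1 - y * q g (a, i)) =
            (w i - eigs g a) - y * ((w i - eigs g a) * q g (a, i))"
          by (simp only: right_diff_distrib mult_1_right mult.left_commute)
        ultimately show "w i - (1 + y) * eigs g a = (w i - eigs g a) * (1 - y * q g (a, i))"
          by (simp add: distrib_right)
      qed
      also have "\<dots> = (\<Prod>i<r. mdet (smat (w i) - g)) * (\<Prod>i<r. \<Prod>a<?N. 1 - y * q g (a, i))"
        by (simp add: prod.distrib mdet_smat_minus)
      also have "(\<Prod>i<r. \<Prod>a<?N. 1 - y * q g (a, i)) = (\<Prod>a<?N. \<Prod>i<r. 1 - y * q g (a, i))"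
        by (rule prod.swap)
      also have "\<dots> = (\<Prod>t\<in>I. 1 - y * q g t)"
        unfolding I_def by (simp add: prod.cartesian_product)
      finally show ?thesis .
    qed
    then have "poly (p g) = poly (smult (char_prod m r w g) (\<Prod>t\<in>I. [:1, - q g t:]))"
      by (intro ext) (simp add: p_def char_prod_def poly_prod)
    then show ?thesis by (simp only: poly_eq_poly_eq_iff)
  qed
  have cont: "continuous_on unitary_group (\<lambda>g. coeff (p g) k)" for k
  proof -
    have "continuous_on unitary_group (mdet :: complex^'n^'n \<Rightarrow> complex)"
      by (rule continuous_on_mdet) (rule continuous_on_matrix_nth)
    then have 1: "continuous_on unitary_group (\<lambda>g :: complex^'n^'n. inverse (mdet g) ^ m)"
      by (intro continuous_intros) (auto simp: mdet_unitary_nonzero)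
    have "continuous_on unitary_group (\<lambda>g :: complex^'n^'n.
        coeff ((\<chi> a b. [:(smat (w i) - g) $ a $ b, - g $ a $ b:]) $ a $ b) k)" for i a b k
      by (cases k; cases "k - 1") (auto intro!: continuous_intros)
    then have "continuous_on unitary_group (\<lambda>g. coeff (P g) k)" for k
      unfolding P_def by (intro continuous_on_coeff_prod continuous_on_coeff_mdet)
    then show ?thesis unfolding p_def coeff_smult by (intro continuous_on_mult 1)
  qed
  have deg: "degree (p g) \<le> card I" if "g \<in> space \<mu>" for g
    using degree_prod_linear_le[of I "char_prod m r w g" "q g"] that p_eq[of g]
    by (simp add: I_def space_haar)
  have "(LINT g|\<mu>. poly (p g) (z - 1)) = z ^ (m * ?N) * char_mean m r w" if z: "norm z = 1" for z
  proof -
    have "z \<noteq> 0" using z by auto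
    have "poly (p g) (z - 1) = z ^ (m * ?N) * char_prod m r w (smat z ** g)" for g
    proof -
      have M: "(\<chi> a b. poly ((\<chi> a b. [:(smat (w i) - g) $ a $ b, - g $ a $ b:]) $ a $ b) (z - 1)) =
          smat (w i) - smat z ** g" for i
        by (simp add: vec_eq_iff algebra_simps)
      have "poly (P g) (z - 1) = (\<Prod>i<r. mdet (smat (w i) - smat z ** g))"
        by (simp only: P_def poly_prod poly_mdet M)
      moreover have "z ^ (m * ?N) * inverse (z ^ ?N * mdet g) ^ m = inverse (mdet g) ^ m"
        using \<open>z \<noteq> 0\<close> by (simp add: power_mult_distrib power_mult[symmetric] field_simps)
      ultimately show ?thesis by (simp add: p_def char_prod_def mdet_smult mult_ac)
    qed
    then have "(LINT g|\<mu>. poly (p g) (z - 1)) = z ^ (m * ?N) * (LINT g|\<mu>. char_prod m r w (smat z ** g))"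
      by simp
    also have "(LINT g|\<mu>. char_prod m r w (smat z ** g)) = char_mean m r w"
      by (rule integral_invariant[OF unitary_smat[OF z] continuous_on_char_prod])
    finally show ?thesis .
  qed
  note taylor = integral_taylor_coeffs[OF integrable_continuous[OF cont] deg this]
  have sumq: "(\<Sum>t\<in>I. q g t) = ratio_sum ?N r w (eigs g)"
    "(\<Sum>t\<in>I. (q g t)\<^sup>2) = (\<Sum>a<?N. \<Sum>i<r. (eigs g a / (w i - eigs g a))\<^sup>2)" for g
    unfolding I_def ratio_sum_def q_def by (simp_all add: sum.cartesian_product split_def)
  have finI: "finite I" by (simp add: I_def)
  have c1: "coeff (p g) 1 = - (char_prod m r w g * ratio_sum ?N r w (eigs g))" if "g \<in> unitary_group" for g
    unfolding p_eq[OF that] coeff_smult coeff_prod_linear(2)[OF finI] sumq by simp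
  have c2: "2 * coeff (p g) 2 = char_prod m r w g * S2 g" if "g \<in> unitary_group" for g
    unfolding p_eq[OF that] coeff_smult mult.left_commute[of 2] coeff_prod_linear(3)[OF finI] sumq S2_def ..
  have i1: "integrable \<mu> (\<lambda>g. - coeff (p g) 1)"
    and i2: "integrable \<mu> (\<lambda>g. 2 * coeff (p g) 2)"
    using integrable_continuous[OF cont] by auto
  have cong: "integrable \<mu> f = integrable \<mu> f'" "integral\<^sup>L \<mu> f = integral\<^sup>L \<mu> f'"
    if "\<And>g. g \<in> unitary_group \<Longrightarrow> f g = f' g" for f f' :: "complex^'n^'n \<Rightarrow> complex"
    using that by (auto intro!: Bochner_Integration.integrable_cong Bochner_Integration.integral_cong simp: space_haar)
  show "integrable \<mu> (\<lambda>g. char_prod m r w g * ratio_sum ?N r w (eigs g))"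
    using i1 by (rule cong(1)[THEN iffD1, rotated]) (simp only: c1 minus_minus)
  show "integrable \<mu> (\<lambda>g. char_prod m r w g * S2 g)"
    using i2 by (rule cong(1)[THEN iffD1, rotated]) (simp add: c2)
  have "(LINT g|\<mu>. char_prod m r w g * ratio_sum ?N r w (eigs g)) = (LINT g|\<mu>. - coeff (p g) 1)"
    by (rule cong(2)) (simp only: c1 minus_minus)
  also have "\<dots> = - of_nat m * of_nat ?N * char_mean m r w"
    using taylor[of 1] by simp
  finally show "(LINT g|\<mu>. char_prod m r w g * ratio_sum ?N r w (eigs g)) =
      - of_nat m * of_nat ?N * char_mean m r w" .
  have "(LINT g|\<mu>. char_prod m r w g * S2 g) = (LINT g|\<mu>. 2 * coeff (p g) 2)"
    by (rule cong(2)) (simp add: c2)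
  also have "\<dots> = 2 * of_nat ((m * ?N) choose 2) * char_mean m r w"
    using taylor[of 2] by simp
  finally show "(LINT g|\<mu>. char_prod m r w g * S2 g) =
      of_nat m * of_nat ?N * (of_nat m * of_nat ?N - 1) * char_mean m r w"
    by (simp only: two_choose_two of_nat_mult)
qed

text \<open>The first contraction gives products of two traces, the second traces of products, both
  over distinct roots. In terms of eigenvalues their sum splits into the quantity \<open>S2\<close>
  of \<open>scalar_moments\<close> and \<open>ratio_quad\<close>.\<close>

lemma sum_gpair_eigs:
  assumes w: "\<And>i. norm (w i) = 2" "inj_on w {..<r}" and g: "g \<in> unitary_group"
  shows "(\<Sum>a\<in>UNIV. \<Sum>b\<in>UNIV. gpair r w a a b b g + gpair r w a b b a g) =
    ((ratio_sum CARD('n) r w (eigs g))\<^sup>2 - (\<Sum>a<CARD('n). \<Sum>i<r. (eigs g a / (w i - eigs g a))\<^sup>2)) +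
    ratio_quad CARD('n) r w (eigs g)"
proof -
  let ?N = "CARD('n)"
  define t where "t = (\<lambda>i a. eigs g a / (w i - eigs g a))"
  define X where "X = (\<lambda>i a b. gres (w i) g $ a $ b)"
  have nz: "mdet (smat (w i) - g) \<noteq> 0" for i by (rule mdet_smat_minus_nonzero[OF g w(1)])
  have tr: "(\<Sum>a\<in>UNIV. X i a a) = (\<Sum>a<?N. t i a)" for i
    unfolding X_def t_def by (rule sum_diag_gres[OF nz])
  have tr2: "(\<Sum>a\<in>UNIV. \<Sum>b\<in>UNIV. X i a b * X j b a) = (\<Sum>a<?N. t i a * t j a)"
    if "i < r" "j < r" "i \<noteq> j" for i j
    unfolding X_def t_def
    by (rule sum_diag_gres_mult[OF nz nz]) (use inj_onD[OF w(2), of i j] that in auto)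
  have offdiag: "(\<Sum>i<r. f i) * (\<Sum>i<r. h i) - (\<Sum>i<r. f i * h i) = (\<Sum>i<r. \<Sum>j\<in>{..<r} - {i}. f i * h j)"
    for f h :: "nat \<Rightarrow> complex"
    by (simp add: sum_product sum_diff1 sum_subtractf)
  have gp: "gpair r w a b c d g = (\<Sum>i<r. \<Sum>j\<in>{..<r} - {i}. X i a b * X j c d)" for a b c d
    unfolding gpair_def X_def by (rule offdiag)
  have 1: "(\<Sum>a\<in>UNIV. \<Sum>b\<in>UNIV. gpair r w a a b b g) =
      (\<Sum>i<r. \<Sum>j\<in>{..<r} - {i}. (\<Sum>a<?N. t i a) * (\<Sum>a<?N. t j a))"
  proof -
    have "(\<Sum>a\<in>UNIV. \<Sum>b\<in>UNIV. gpair r w a a b b g) =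
       (\<Sum>i<r. \<Sum>j\<in>{..<r} - {i}. \<Sum>a\<in>UNIV. \<Sum>b\<in>UNIV. X i a a * X j b b)"
      unfolding gp by (simp only: sum.swap[of _ "{..<r}"] sum.swap[of _ "{..<r} - {_}"])
    then show ?thesis by (simp only: sum_product[symmetric] tr)
  qed
  have 2: "(\<Sum>a\<in>UNIV. \<Sum>b\<in>UNIV. gpair r w a b b a g) =
      (\<Sum>i<r. \<Sum>j\<in>{..<r} - {i}. \<Sum>a<?N. t i a * t j a)"
  proof -
    have "(\<Sum>a\<in>UNIV. \<Sum>b\<in>UNIV. gpair r w a b b a g) =
       (\<Sum>i<r. \<Sum>j\<in>{..<r} - {i}. \<Sum>a\<in>UNIV. \<Sum>b\<in>UNIV. X i a b * X j b a)"
      unfolding gp by (simp only: sum.swap[of _ "{..<r}"] sum.swap[of _ "{..<r} - {_}"])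
    also have "\<dots> = (\<Sum>i<r. \<Sum>j\<in>{..<r} - {i}. \<Sum>a<?N. t i a * t j a)"
      by (intro sum.cong refl tr2) auto
    finally show ?thesis .
  qed
  have 3: "(\<Sum>i<r. \<Sum>j\<in>{..<r} - {i}. \<Sum>a<?N. t i a * t j a) =
      (\<Sum>a<?N. (\<Sum>i<r. t i a)\<^sup>2) - (\<Sum>a<?N. \<Sum>i<r. (t i a)\<^sup>2)"
  proof -
    have "(\<Sum>i<r. \<Sum>j\<in>{..<r} - {i}. \<Sum>a<?N. t i a * t j a) = (\<Sum>a<?N. \<Sum>i<r. \<Sum>j\<in>{..<r} - {i}. t i a * t j a)"
      by (simp only: sum.swap[of _ "{..<?N}"])
    also have "\<dots> = (\<Sum>a<?N. (\<Sum>i<r. t i a) * (\<Sum>i<r. t i a) - (\<Sum>i<r. t i a * t i a))"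
      by (simp only: offdiag)
    finally show ?thesis by (simp add: sum_subtractf power2_eq_square)
  qed
  have rs: "(\<Sum>i<r. \<Sum>a<?N. t i a) = ratio_sum ?N r w (eigs g)"
    unfolding ratio_sum_def t_def by (rule sum.swap)
  have "(\<Sum>a\<in>UNIV. \<Sum>b\<in>UNIV. gpair r w a a b b g + gpair r w a b b a g) =
      ((ratio_sum ?N r w (eigs g))\<^sup>2 - (\<Sum>i<r. (\<Sum>a<?N. t i a)\<^sup>2)) +
      ((\<Sum>a<?N. (\<Sum>i<r. t i a)\<^sup>2) - (\<Sum>a<?N. \<Sum>i<r. (t i a)\<^sup>2))"
    unfolding sum.distrib 1 2 3 offdiag[symmetric] rs by (simp add: power2_eq_square)
  then show ?thesis by (simp add: ratio_quad_def t_def)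
qed

text \<open>Subtract the scalar moment from the contracted reflection moment: m (m - 1) N (N + 1) -
  m N (m N - 1) = m^2 N - m N^2.\<close>

lemma ratio_quad_moment:
  assumes w: "\<And>i. norm (w i) = 2" "inj_on w {..<r}"
  shows "integrable \<mu> (\<lambda>g. char_prod m r w g * ratio_quad CARD('n) r w (eigs g))"
    "(LINT g|\<mu>. char_prod m r w g * ratio_quad CARD('n) r w (eigs g)) =
      (of_nat m ^ 2 * of_nat CARD('n) - of_nat m * of_nat CARD('n) ^ 2) * char_mean m r w"
proof -
  define S2 where "S2 = (\<lambda>g :: complex^'n^'n. (ratio_sum CARD('n) r w (eigs g))\<^sup>2 -
      (\<Sum>a<CARD('n). \<Sum>i<r. (eigs g a / (w i - eigs g a))\<^sup>2))"
  define G where "G = (\<lambda>g. \<Sum>a\<in>UNIV. \<Sum>b\<in>UNIV. gpair r w a a b b g + gpair r w a b b a g)"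
  have i1: "integrable \<mu> (\<lambda>g. char_prod m r w g * S2 g)"
    unfolding S2_def by (rule scalar_moments(3)[OF w(1)])
  have i2: "integrable \<mu> (\<lambda>g. char_prod m r w g * G g)"
    unfolding G_def by (intro integrable_char_prod_mult continuous_intros continuous_on_gpair w)
  have eq: "char_prod m r w g * ratio_quad CARD('n) r w (eigs g) = char_prod m r w g * G g - char_prod m r w g * S2 g"
    if "g \<in> space \<mu>" for g
  proof -
    have "ratio_quad CARD('n) r w (eigs g) = G g - S2 g"
      using sum_gpair_eigs[OF w, of g] that unfolding space_haar G_def S2_def by simp
    then show ?thesis by (simp only: right_diff_distrib)
  qed
  show "integrable \<mu> (\<lambda>g. char_prod m r w g * ratio_quad CARD('n) r w (eigs g))"
  proof -
    have "integrable \<mu> (\<lambda>g. char_prod m r w g * ratio_quad CARD('n) r w (eigs g)) =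
        integrable \<mu> (\<lambda>g. char_prod m r w g * G g - char_prod m r w g * S2 g)"
      by (rule Bochner_Integration.integrable_cong[OF refl]) (rule eq)
    then show ?thesis using Bochner_Integration.integrable_diff[OF i2 i1] by simp
  qed
  have "(LINT g|\<mu>. char_prod m r w g * ratio_quad CARD('n) r w (eigs g)) =
      (LINT g|\<mu>. char_prod m r w g * G g - char_prod m r w g * S2 g)"
    by (rule Bochner_Integration.integral_cong[OF refl]) (rule eq)
  also have "\<dots> = (LINT g|\<mu>. char_prod m r w g * G g) - (LINT g|\<mu>. char_prod m r w g * S2 g)"
    by (rule Bochner_Integration.integral_diff[OF i2 i1])
  also have "\<dots> = (of_nat m ^ 2 * of_nat CARD('n) - of_nat m * of_nat CARD('n) ^ 2) * char_mean m r w"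
    unfolding G_def S2_def gpair_total_moment[OF w(1)] scalar_moments(4)[OF w(1)]
    by (simp add: algebra_simps power2_eq_square)
  finally show "(LINT g|\<mu>. char_prod m r w g * ratio_quad CARD('n) r w (eigs g)) =
      (of_nat m ^ 2 * of_nat CARD('n) - of_nat m * of_nat CARD('n) ^ 2) * char_mean m r w" .
qed

end

subsection \<open>Cauchy--Binet\<close>

lemma fdet_scale_cols: "fdet n (\<lambda>j k. c k * f j k) = (\<Prod>k<n. c k) * fdet n f"
  using fdet_scale_rows[of n c "\<lambda>j k. f k j"] fdet_transpose[of n "\<lambda>j k. c k * f j k"]
    fdet_transpose[of n f] by simp

lemma fdet_zero_row:
  assumes "j < n" "\<And>k. k < n \<Longrightarrow> f j k = 0"
  shows "fdet n f = 0"
proof -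
  have "(\<Prod>i<n. f i (p i)) = 0" if "p permutes {0..<n}" for p
    using assms permutes_in_image[OF that, of j] by (intro prod_zero) auto
  then show ?thesis unfolding fdet_leibniz by simp
qed

lemma fdet_zero_col:
  assumes "k < n" "\<And>j. j < n \<Longrightarrow> f j k = 0"
  shows "fdet n f = 0"
  using fdet_zero_row[of k n "\<lambda>j k. f k j"] fdet_transpose[of n f] assms by simp

text \<open>Strictly decreasing lists are canonical names for the n-element subsets of
  \<open>W\<close>, and are also the shape of a dominant weight plus staircase.\<close>

definition strict_lists :: "nat \<Rightarrow> int set \<Rightarrow> int list set" where
  "strict_lists n W = {s. length s = n \<and> sorted_wrt (>) s \<and> set s \<subseteq> W}"

lemma finite_strict_lists: "finite W \<Longrightarrow> finite (strict_lists n W)"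
  unfolding strict_lists_def
  by (rule finite_subset[OF _ finite_lists_length_eq[of W n]]) auto

lemma strict_list_distinct: "sorted_wrt (>) (s :: int list) \<Longrightarrow> distinct s"
  by (induction s) auto

lemma strict_list_eqI:
  fixes s s' :: "int list"
  assumes "sorted_wrt (>) s" "sorted_wrt (>) s'" "set s = set s'"
  shows "s = s'"
proof -
  have "sorted_wrt (<) (rev s)" "sorted_wrt (<) (rev s')"
    using assms(1,2) by (simp_all add: sorted_wrt_rev)
  then have "rev s = rev s'" using assms(3) by (intro strict_sorted_equal) auto
  then show ?thesis by simp
qed

text \<open>An injection of n indices into \<open>W\<close> amounts to its image, listed in
  decreasing order, together with the order in which the image is traversed.\<close>

lemma bij_betw_strict_lists_permutations:
  "bij_betw (\<lambda>(s, p). restrict (\<lambda>k. s ! p k) {..<n})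
     (strict_lists n W \<times> {p. p permutes {0..<n}})
     {\<phi> \<in> PiE {..<n} (\<lambda>_. W). inj_on \<phi> {..<n}}" (is "bij_betw ?\<Phi> ?D ?R")
proof (rule bij_betw_imageI)
  have plt: "p k < n" if "p permutes {0..<n}" "k < n" for p k
    using permutes_in_image[OF that(1), of k] that(2) by simp
  have img: "(\<lambda>k. s ! p k) ` {..<n} = set s" if "p permutes {0..<n}" "length s = n" for s p
  proof -
    have "(\<lambda>k. s ! p k) ` {..<n} = (!) s ` (p ` {0..<n})" by (simp add: image_image atLeast0LessThan)
    also have "p ` {0..<n} = {0..<n}" by (rule permutes_image[OF that(1)])
    also have "(!) s ` {0..<n} = set s" using that(2) by (auto simp: set_conv_nth)
    finally show ?thesis .
  qed
  show "inj_on ?\<Phi> ?D"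
  proof (rule inj_onI, clarsimp)
    fix s p s' p'
    assume s: "s \<in> strict_lists n W" "s' \<in> strict_lists n W"
      and p: "p permutes {0..<n}" "p' permutes {0..<n}"
      and eq: "restrict (\<lambda>k. s ! p k) {..<n} = restrict (\<lambda>k. s' ! p' k) {..<n}"
    have eqk: "s ! p k = s' ! p' k" if "k < n" for k
      using fun_cong[OF eq, of k] that by simp
    have "(\<lambda>k. s ! p k) ` {..<n} = (\<lambda>k. s' ! p' k) ` {..<n}"
      by (rule image_cong) (auto simp: eqk)
    then have "set s = set s'"
      using img[OF p(1), of s] img[OF p(2), of s'] s by (simp add: strict_lists_def)
    then have ss: "s = s'" using s by (intro strict_list_eqI) (auto simp: strict_lists_def)
    have "p k = p' k" for k
    proof (cases "k < n")
      case True
      then show ?thesis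
        using eqk[OF True] plt[OF p(1) True] plt[OF p(2) True] s(1) strict_list_distinct[of s]
        by (simp add: ss[symmetric] strict_lists_def nth_eq_iff_index_eq)
    qed (use permutes_not_in[OF p(1), of k] permutes_not_in[OF p(2), of k] in simp)
    then show "s = s' \<and> p = p'" using ss by auto
  qed
  show "?\<Phi> ` ?D = ?R"
  proof (intro equalityI subsetI)
    fix \<phi> assume "\<phi> \<in> ?\<Phi> ` ?D"
    then obtain s p where \<phi>: "\<phi> = restrict (\<lambda>k. s ! p k) {..<n}"
      and s: "s \<in> strict_lists n W" and p: "p permutes {0..<n}" by auto
    have "\<phi> \<in> PiE {..<n} (\<lambda>_. W)"
      using s plt[OF p] by (auto simp: \<phi> strict_lists_def)
    moreover have "inj_on \<phi> {..<n}"
    proof (rule inj_onI)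
      fix i k assume "i \<in> {..<n}" "k \<in> {..<n}" "\<phi> i = \<phi> k"
      then have "p i = p k"
        using plt[OF p] s strict_list_distinct[of s]
        by (auto simp: \<phi> strict_lists_def nth_eq_iff_index_eq)
      then show "i = k" using permutes_inj[OF p] by (auto dest: injD)
    qed
    ultimately show "\<phi> \<in> ?R" by simp
  next
    fix \<phi> assume \<phi>: "\<phi> \<in> ?R"
    define s where "s = rev (sorted_list_of_set (\<phi> ` {..<n}))"
    have sets: "set s = \<phi> ` {..<n}" by (simp add: s_def)
    have len: "length s = n" using \<phi> by (simp add: s_def card_image)
    have "sorted_wrt (>) s" by (simp add: s_def sorted_wrt_rev)
    with sets len \<phi> have s: "s \<in> strict_lists n W" by (auto simp: strict_lists_def)
    define p where "p = (\<lambda>k. if k < n then SOME i. i < n \<and> s ! i = \<phi> k else k)"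
    have p1: "p k < n \<and> s ! p k = \<phi> k" if "k < n" for k
    proof -
      have "\<exists>i. i < n \<and> s ! i = \<phi> k"
        using sets len that by (metis imageI in_set_conv_nth lessThan_iff)
      from someI_ex[OF this] that show ?thesis by (simp add: p_def)
    qed
    have "inj_on p {0..<n}"
    proof (rule inj_onI)
      fix i k assume "i \<in> {0..<n}" "k \<in> {0..<n}" "p i = p k"
      then have "\<phi> i = \<phi> k" using p1[of i] p1[of k] by auto
      then show "i = k" using \<phi> \<open>i \<in> _\<close> \<open>k \<in> _\<close> by (auto dest: inj_onD)
    qed
    moreover have "p ` {0..<n} \<subseteq> {0..<n}" using p1 by auto
    ultimately have "bij_betw p {0..<n} {0..<n}"
      by (simp add: bij_betw_def endo_inj_surj)
    then have p: "p permutes {0..<n}" by (rule bij_imp_permutes) (simp add: p_def)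
    have "\<phi> = ?\<Phi> (s, p)"
    proof
      fix k
      show "\<phi> k = ?\<Phi> (s, p) k"
        using \<phi> p1[of k] by (cases "k < n") (auto simp: PiE_def extensional_def)
    qed
    then show "\<phi> \<in> ?\<Phi> ` ?D" using s p by blast
  qed
qed

text \<open>Expand by columns; a repeated index gives two equal columns and hence 0. When the
  injective choices are grouped by image, the sum over orderings is the Leibniz formula for the
  second minor. \<open>W\<close> is a finite window of the integers that index the Toeplitz
  matrices.\<close>

lemma cauchy_binet:
  fixes A :: "nat \<Rightarrow> int \<Rightarrow> 'a::comm_ring_1" and B :: "int \<Rightarrow> nat \<Rightarrow> 'a"
  assumes W: "finite W"
  shows "fdet n (\<lambda>j k. \<Sum>t\<in>W. A j t * B t k) =
    (\<Sum>s\<in>strict_lists n W. fdet n (\<lambda>j k. A j (s ! k)) * fdet n (\<lambda>j k. B (s ! j) k))"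
proof -
  let ?P = "PiE {..<n} (\<lambda>_. W)" and ?S = "strict_lists n W" and ?Q = "{p. p permutes {0..<n}}"
  define h where "h = (\<lambda>\<phi>. (\<Prod>k<n. B (\<phi> k) k) * fdet n (\<lambda>j k. A j (\<phi> k)))"
  have "fdet n (\<lambda>j k. \<Sum>t\<in>W. A j t * B t k) = (\<Sum>\<phi>\<in>?P. fdet n (\<lambda>j k. B (\<phi> k) k * A j (\<phi> k)))"
    using fdet_sum_cols[OF W, of n "\<lambda>t j k. B t k * A j t"] by (simp add: mult.commute)
  also have "\<dots> = (\<Sum>\<phi>\<in>?P. h \<phi>)" unfolding h_def by (simp only: fdet_scale_cols)
  also have "\<dots> = (\<Sum>\<phi>\<in>{\<phi> \<in> ?P. inj_on \<phi> {..<n}}. h \<phi>)"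
  proof (rule sum.mono_neutral_right)
    show "finite ?P" using W by (intro finite_PiE) auto
    show "\<forall>\<phi>\<in>?P - {\<phi> \<in> ?P. inj_on \<phi> {..<n}}. h \<phi> = 0"
    proof
      fix \<phi> assume "\<phi> \<in> ?P - {\<phi> \<in> ?P. inj_on \<phi> {..<n}}"
      then obtain i k where "i < n" "k < n" "i \<noteq> k" "\<phi> i = \<phi> k" by (auto simp: inj_on_def)
      then have "fdet n (\<lambda>j k. A j (\<phi> k)) = 0" by (intro fdet_identical_cols[of i n k]) auto
      then show "h \<phi> = 0" by (simp add: h_def)
    qed
  qed auto
  also have "\<dots> = (\<Sum>x\<in>?S \<times> ?Q. h ((\<lambda>(s, p). restrict (\<lambda>k. s ! p k) {..<n}) x))"
    by (rule sum.reindex_bij_betw[OF bij_betw_strict_lists_permutations, symmetric])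
  also have "\<dots> = (\<Sum>s\<in>?S. \<Sum>p\<in>?Q. h (restrict (\<lambda>k. s ! p k) {..<n}))"
    by (simp add: sum.cartesian_product split_def)
  also have "\<dots> = (\<Sum>s\<in>?S. fdet n (\<lambda>j k. A j (s ! k)) * fdet n (\<lambda>j k. B (s ! j) k))"
  proof (rule sum.cong[OF refl])
    fix s
    have "h (restrict (\<lambda>k. s ! p k) {..<n}) =
        fdet n (\<lambda>j k. A j (s ! k)) * (signof p * (\<Prod>k<n. B (s ! p k) k))" if "p \<in> ?Q" for p
    proof -
      have "fdet n (\<lambda>j k. A j (restrict (\<lambda>k. s ! p k) {..<n} k)) = fdet n (\<lambda>j k. A j (s ! p k))"
        by (rule fdet_cong) simp
      also have "\<dots> = signof p * fdet n (\<lambda>j k. A j (s ! k))"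
        using that fdet_permute_cols[of p n "\<lambda>j k. A j (s ! k)"] by simp
      finally show ?thesis by (simp add: h_def mult_ac)
    qed
    then have "(\<Sum>p\<in>?Q. h (restrict (\<lambda>k. s ! p k) {..<n})) =
        fdet n (\<lambda>j k. A j (s ! k)) * (\<Sum>p\<in>?Q. signof p * (\<Prod>k<n. B (s ! p k) k))"
      unfolding sum_distrib_left by (rule sum.cong[OF refl])
    also have "(\<Sum>p\<in>?Q. signof p * (\<Prod>k<n. B (s ! p k) k)) = fdet n (\<lambda>j k. B (s ! j) k)"
      using fdet_leibniz[of n "\<lambda>j k. B (s ! k) j"] fdet_transpose[of n "\<lambda>j k. B (s ! j) k"] by simp
    finally show "(\<Sum>p\<in>?Q. h (restrict (\<lambda>k. s ! p k) {..<n})) =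
        fdet n (\<lambda>j k. A j (s ! k)) * fdet n (\<lambda>j k. B (s ! j) k)" .
  qed
  finally show ?thesis .
qed

subsection \<open>Exponents\<close>

definition shifted :: "nat \<Rightarrow> int list \<Rightarrow> int list" where
  "shifted n l = map (\<lambda>k. staircase n k + l ! k) [0..<n]"

text \<open>Consecutive stairs differ by 1, so adding the staircase turns weakly decreasing into
  strictly decreasing sequences. Dominant weights thus index the minors in
  \<open>cauchy_binet\<close>.\<close>

lemma bij_betw_shifted:
  "bij_betw (shifted n) {l \<in> dominant_weights n. set (shifted n l) \<subseteq> W} (strict_lists n W)"
proof (rule bij_betw_byWitness[where f' = "\<lambda>s. map (\<lambda>k. s ! k - staircase n k) [0..<n]"])
  show "\<forall>l\<in>{l \<in> dominant_weights n. set (shifted n l) \<subseteq> W}.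
      map (\<lambda>k. shifted n l ! k - staircase n k) [0..<n] = l"
    by (auto simp: shifted_def dominant_weights_def intro!: nth_equalityI)
  show "\<forall>s\<in>strict_lists n W. shifted n (map (\<lambda>k. s ! k - staircase n k) [0..<n]) = s"
    by (auto simp: shifted_def strict_lists_def intro!: nth_equalityI)
  have tr: "transp ((\<ge>) :: int \<Rightarrow> _)" "transp ((>) :: int \<Rightarrow> _)" by (auto simp: transp_def)
  have st: "staircase n k = staircase n (Suc k) + 1" if "Suc k < n" for k
    using that by (simp add: staircase_def)
  show "shifted n ` {l \<in> dominant_weights n. set (shifted n l) \<subseteq> W} \<subseteq> strict_lists n W"
  proof clarify
    fix l assume l: "l \<in> dominant_weights n" and W: "set (shifted n l) \<subseteq> W"
    have "sorted_wrt (>) (shifted n l)"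
      unfolding sorted_wrt_iff_nth_Suc_transp[OF tr(2)]
    proof (intro allI impI)
      fix i assume i: "Suc i < length (shifted n l)"
      then have "l ! i \<ge> l ! Suc i"
        using l sorted_wrt_nth_less[of "(\<ge>)" l i "Suc i"] by (simp add: dominant_weights_def shifted_def)
      then show "shifted n l ! Suc i < shifted n l ! i"
        using i st[of i] by (simp add: shifted_def)
    qed
    then show "shifted n l \<in> strict_lists n W" using W by (simp add: strict_lists_def shifted_def)
  qed
  show "(\<lambda>s. map (\<lambda>k. s ! k - staircase n k) [0..<n]) ` strict_lists n W \<subseteq>
      {l \<in> dominant_weights n. set (shifted n l) \<subseteq> W}"
  proof clarify
    fix s assume s: "s \<in> strict_lists n W"
    let ?l = "map (\<lambda>k. s ! k - staircase n k) [0..<n]"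
    have "sorted_wrt (\<ge>) ?l"
      unfolding sorted_wrt_iff_nth_Suc_transp[OF tr(1)]
    proof (intro allI impI)
      fix i assume i: "Suc i < length ?l"
      then have "s ! i > s ! Suc i"
        using s sorted_wrt_nth_less[of "(>)" s i "Suc i"] by (simp add: strict_lists_def)
      then show "?l ! Suc i \<le> ?l ! i" using i st[of i] by simp
    qed
    moreover have "shifted n ?l = s"
      using s by (auto simp: shifted_def strict_lists_def intro!: nth_equalityI)
    ultimately show "?l \<in> dominant_weights n \<and> set (shifted n ?l) \<subseteq> W"
      using s by (auto simp: dominant_weights_def strict_lists_def)
  qed
qed

lemma staircase_image: "staircase n ` {..<n} = {0..<int n}"
proof (intro equalityI subsetI)
  fix x assume "x \<in> {0..<int n}"
  then show "x \<in> staircase n ` {..<n}"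
    by (intro image_eqI[of _ _ "n - 1 - nat x"]) (auto simp: staircase_def)
qed (auto simp: staircase_def)

lemma inj_staircase: "inj_on (staircase n) {..<n}"
  by (auto simp: inj_on_def staircase_def)

text \<open>The function \<open>x * (x - (n - 1))\<close> is nonpositive on \<open>{0..<n}\<close> and positive at all other
  integers, so \<open>{0..<n}\<close> is the only set of \<open>n\<close> integers with its sum and sum of squares.\<close>

lemma exponents_eq_interval:
  fixes e :: "nat \<Rightarrow> int"
  assumes inj: "inj_on e {..<n}" and s1: "(\<Sum>k<n. e k) = (\<Sum>k<n. staircase n k)"
    and s2: "(\<Sum>k<n. (e k)\<^sup>2) = (\<Sum>k<n. (staircase n k)\<^sup>2)"
  shows "e ` {..<n} = {0..<int n}"
proof -
  define \<phi> where "\<phi> = (\<lambda>x :: int. x * (x - (int n - 1)))"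
  let ?E = "e ` {..<n}" and ?I = "{0..<int n}"
  have "(\<Sum>x\<in>?E. \<phi> x) = (\<Sum>k<n. (e k)\<^sup>2) - (int n - 1) * (\<Sum>k<n. e k)"
    unfolding sum.reindex[OF inj] o_def \<phi>_def
    by (simp add: power2_eq_square algebra_simps sum_subtractf sum.distrib sum_distrib_left)
  moreover have "(\<Sum>x\<in>?I. \<phi> x) = (\<Sum>k<n. (staircase n k)\<^sup>2) - (int n - 1) * (\<Sum>k<n. staircase n k)"
    unfolding staircase_image[symmetric] sum.reindex[OF inj_staircase] o_def \<phi>_def
    by (simp add: power2_eq_square algebra_simps sum_subtractf sum.distrib sum_distrib_left)
  ultimately have eq: "(\<Sum>x\<in>?E. \<phi> x) = (\<Sum>x\<in>?I. \<phi> x)" using s1 s2 by simp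
  have "(\<Sum>x\<in>?E - ?I. \<phi> x) + (\<Sum>x\<in>?E \<inter> ?I. \<phi> x) = (\<Sum>x\<in>?I - ?E. \<phi> x) + (\<Sum>x\<in>?I \<inter> ?E. \<phi> x)"
    using eq sum.Int_Diff[of ?E \<phi> ?I] sum.Int_Diff[of ?I \<phi> ?E] by (simp add: add.commute)
  then have eq': "(\<Sum>x\<in>?E - ?I. \<phi> x) = (\<Sum>x\<in>?I - ?E. \<phi> x)" by (simp add: Int_commute)
  have "(\<Sum>x\<in>?I - ?E. \<phi> x) \<le> 0"
    by (rule sum_nonpos) (auto simp: \<phi>_def mult_le_0_iff)
  moreover have pos: "\<phi> x > 0" if "x \<in> ?E - ?I" for x
    using that by (auto simp: \<phi>_def zero_less_mult_iff)
  ultimately have "?E - ?I = {}"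
    using eq' sum_pos[of "?E - ?I" \<phi>] by fastforce
  then have "?E \<subseteq> ?I" by blast
  then show ?thesis by (rule card_subset_eq[rotated]) (simp_all add: card_image[OF inj])
qed

subsection \<open>Orthogonality of Schur functions\<close>

lemma schur_tendsto:
  assumes n: "length l = n" "n > 0" and x: "\<And>a. a < n \<Longrightarrow> x a \<noteq> 0"
  shows "(schur l \<longlongrightarrow> schur l x) (at x)"
proof -
  obtain T :: "(nat \<Rightarrow> nat) set" and c w m r where T:
    "finite T" "\<And>\<tau>. \<tau> \<in> T \<Longrightarrow> inj_on (w \<tau>) {..<r}" "\<And>\<tau> i. norm (w \<tau> i) = 2"
    "\<forall>x. (\<forall>a<n. x a \<noteq> 0) \<longrightarrow>
        schur l x = root_comb n m r T c w x"
    by (rule schur_expansion[OF n]) (rule that)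
  have "\<forall>\<^sub>F y in at x. y a \<in> - {0}" if "a < n" for a
    by (rule topological_tendstoD[OF tendsto_coordinate[of a x]]) (use x[OF that] in auto)
  then have "\<forall>\<^sub>F y in at x. \<forall>a\<in>{..<n}. y a \<in> - {0}"
    by (intro eventually_ball_finite) auto
  then have ev: "\<forall>\<^sub>F y in at x. root_comb n m r T c w y = schur l y"
    by eventually_elim (use T(4) in auto)
  have "((\<lambda>y. \<Sum>\<tau>\<in>T. c \<tau> * (\<Prod>a<n. root_factor m r (w \<tau>) (y a))) \<longlongrightarrow>
      root_comb n m r T c w x) (at x)"
    by (intro tendsto_sum tendsto_mult tendsto_const tendsto_prod tendsto_root_factor
        tendsto_coordinate) (use x in auto)
  from Lim_transform_eventually[OF this ev] show ?thesis using T(4) x by simp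
qed

lemma schur_constant:
  assumes n: "length l = n" and x: "\<And>a. a < n \<Longrightarrow> x a \<noteq> 0"
    and eq: "\<And>y. schur_num l y = schur_den n y * c"
  shows "schur l x = c"
  by (rule schur_eqI[OF n x, where f = "\<lambda>_. c"]) (auto simp: eq)

context haar_unitary
begin

text \<open>Integrate \<open>schur_euler\<close> term by term. The linear identity gives -m N + m N;
  in the quadratic one, inserting the means -m N for \<open>ratio_sum\<close> and m^2 N - m N^2 for
  \<open>ratio_quad\<close> makes \<open>casimir_factor\<close> 0. So the integral vanishes unless
  the exponents share sum and sum of squares with the staircase.\<close>

lemma schur_integral_euler:
  assumes l: "length l = CARD('n)"
  defines "e \<equiv> \<lambda>k. staircase CARD('n) k + l ! k"
  shows "integrable \<mu> (\<lambda>g. schur l (eigs g))"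
    "of_int ((\<Sum>k<CARD('n). e k) - (\<Sum>k<CARD('n). staircase CARD('n) k)) * (LINT g|\<mu>. schur l (eigs g)) = 0"
    "of_int ((\<Sum>k<CARD('n). (e k)\<^sup>2) - (\<Sum>k<CARD('n). (staircase CARD('n) k)\<^sup>2)) * (LINT g|\<mu>. schur l (eigs g)) = 0"
proof -
  let ?N = "CARD('n)"
  obtain T :: "(nat \<Rightarrow> nat) set" and c w m r where T:
    "finite T" "\<And>\<tau>. \<tau> \<in> T \<Longrightarrow> inj_on (w \<tau>) {..<r}" "\<And>\<tau> i. norm (w \<tau> i) = 2"
    "\<forall>x. (\<forall>a<?N. x a \<noteq> 0) \<longrightarrow>
        schur l x = root_comb ?N m r T c w x"
    by (rule schur_expansion[OF l]) (simp, rule that)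
  define F where "F = (\<lambda>\<tau> (g :: complex^'n^'n). char_prod m r (w \<tau>) g)"
  define L where "L = (\<lambda>\<tau>. LINT g|\<mu>. F \<tau> g)"
  have F: "(\<Prod>a<?N. root_factor m r (w \<tau>) (eigs g a)) = F \<tau> g" for \<tau> g
    unfolding F_def by (rule char_prod_eigs[symmetric])
  have nrm: "norm (eigs g a) = 1" if "g \<in> space \<mu>" "a < ?N" for g a
    using norm_eigs that by (auto simp: space_haar)
  have nz: "\<forall>a<?N. eigs g a \<noteq> 0" if "g \<in> space \<mu>" for g
    using nrm[OF that] by fastforce
  have sch: "schur l (eigs g) = (\<Sum>\<tau>\<in>T. c \<tau> * F \<tau> g)" if "g \<in> space \<mu>" for g
    using T(4) nz[OF that] by (simp add: F)
  note intF = integrable_continuous[OF continuous_on_char_prod, of m r]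
  have "integrable \<mu> (\<lambda>g. schur l (eigs g)) = integrable \<mu> (\<lambda>g. \<Sum>\<tau>\<in>T. c \<tau> * F \<tau> g)"
    by (rule Bochner_Integration.integrable_cong[OF refl]) (rule sch)
  then show "integrable \<mu> (\<lambda>g. schur l (eigs g))" unfolding F_def using intF by auto
  have iF: "integrable \<mu> (F \<tau>)" for \<tau> unfolding F_def by (rule intF)
  have iR: "integrable \<mu> (\<lambda>g. F \<tau> g * ratio_sum ?N r (w \<tau>) (eigs g))"
    and mR: "(LINT g|\<mu>. F \<tau> g * ratio_sum ?N r (w \<tau>) (eigs g)) = - of_nat m * of_nat ?N * L \<tau>" for \<tau>
    unfolding F_def L_def by (rule scalar_moments[OF T(3)])+
  have iQ: "integrable \<mu> (\<lambda>g. F \<tau> g * ratio_quad ?N r (w \<tau>) (eigs g))"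
    and mQ: "(LINT g|\<mu>. F \<tau> g * ratio_quad ?N r (w \<tau>) (eigs g)) =
      (of_nat m ^ 2 * of_nat ?N - of_nat m * of_nat ?N ^ 2) * L \<tau>" if "\<tau> \<in> T" for \<tau>
    unfolding F_def L_def by (rule ratio_quad_moment[OF T(3) T(2)[OF that]])+
  have ex: "schur l y = root_comb ?N m r T c w y"
    if "\<forall>a<?N. y a \<noteq> 0" for y using T(4) that by blast
  have euler: "of_int ((\<Sum>k<?N. e k) - (\<Sum>k<?N. staircase ?N k)) * schur l (eigs g) =
      (\<Sum>\<tau>\<in>T. c \<tau> * F \<tau> g * (- of_nat m * of_nat ?N - ratio_sum ?N r (w \<tau>) (eigs g)))"
    "of_int ((\<Sum>k<?N. (e k)\<^sup>2) - (\<Sum>k<?N. (staircase ?N k)\<^sup>2)) * schur l (eigs g) =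
      (\<Sum>\<tau>\<in>T. c \<tau> * F \<tau> g * casimir_factor ?N m r (w \<tau>) (eigs g))"
    if g: "g \<in> space \<mu>" for g
    unfolding e_def F[symmetric]
    by (rule schur_euler(1)[OF T(1,3) l ex nrm[OF g]], assumption+,
        rule schur_euler(2)[OF T(1,3) l ex nrm[OF g]], assumption+)
  have "of_int ((\<Sum>k<?N. e k) - (\<Sum>k<?N. staircase ?N k)) * (LINT g|\<mu>. schur l (eigs g)) =
      (LINT g|\<mu>. of_int ((\<Sum>k<?N. e k) - (\<Sum>k<?N. staircase ?N k)) * schur l (eigs g))" by simp
  also have "\<dots> = (LINT g|\<mu>. (\<Sum>\<tau>\<in>T. c \<tau> * ((- of_nat m * of_nat ?N) * F \<tau> g -
      F \<tau> g * ratio_sum ?N r (w \<tau>) (eigs g))))"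
  proof (rule Bochner_Integration.integral_cong[OF refl])
    fix g assume g: "g \<in> space \<mu>"
    show "of_int ((\<Sum>k<?N. e k) - (\<Sum>k<?N. staircase ?N k)) * schur l (eigs g) =
        (\<Sum>\<tau>\<in>T. c \<tau> * ((- of_nat m * of_nat ?N) * F \<tau> g - F \<tau> g * ratio_sum ?N r (w \<tau>) (eigs g)))"
      unfolding euler(1)[OF g] by (rule sum.cong) (simp_all add: algebra_simps)
  qed
  also have "\<dots> = (\<Sum>\<tau>\<in>T. c \<tau> * ((- of_nat m * of_nat ?N) * L \<tau> - (- of_nat m * of_nat ?N) * L \<tau>))"
    using iF iR by (simp add: mR L_def)
  finally show "of_int ((\<Sum>k<?N. e k) - (\<Sum>k<?N. staircase ?N k)) * (LINT g|\<mu>. schur l (eigs g)) = 0"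
    by simp
  have "of_int ((\<Sum>k<?N. (e k)\<^sup>2) - (\<Sum>k<?N. (staircase ?N k)\<^sup>2)) * (LINT g|\<mu>. schur l (eigs g)) =
      (LINT g|\<mu>. of_int ((\<Sum>k<?N. (e k)\<^sup>2) - (\<Sum>k<?N. (staircase ?N k)\<^sup>2)) * schur l (eigs g))" by simp
  also have "\<dots> = (LINT g|\<mu>. (\<Sum>\<tau>\<in>T. c \<tau> * (
      (of_nat m ^ 2 * of_nat ?N - of_nat m * of_nat ?N * (of_nat ?N - 1)) * F \<tau> g +
      (2 * of_nat m - 2 * of_nat ?N + 1) * (F \<tau> g * ratio_sum ?N r (w \<tau>) (eigs g)) +
      F \<tau> g * ratio_quad ?N r (w \<tau>) (eigs g))))"
  proof (rule Bochner_Integration.integral_cong[OF refl])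
    fix g assume g: "g \<in> space \<mu>"
    show "of_int ((\<Sum>k<?N. (e k)\<^sup>2) - (\<Sum>k<?N. (staircase ?N k)\<^sup>2)) * schur l (eigs g) =
        (\<Sum>\<tau>\<in>T. c \<tau> * (
      (of_nat m ^ 2 * of_nat ?N - of_nat m * of_nat ?N * (of_nat ?N - 1)) * F \<tau> g +
      (2 * of_nat m - 2 * of_nat ?N + 1) * (F \<tau> g * ratio_sum ?N r (w \<tau>) (eigs g)) +
      F \<tau> g * ratio_quad ?N r (w \<tau>) (eigs g)))"
      unfolding euler(2)[OF g] by (rule sum.cong) (simp_all add: casimir_factor_def algebra_simps)
  qed
  also have "\<dots> = (\<Sum>\<tau>\<in>T. c \<tau> * (
      (of_nat m ^ 2 * of_nat ?N - of_nat m * of_nat ?N * (of_nat ?N - 1)) * L \<tau> +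
      (2 * of_nat m - 2 * of_nat ?N + 1) * (- of_nat m * of_nat ?N * L \<tau>) +
      (of_nat m ^ 2 * of_nat ?N - of_nat m * of_nat ?N ^ 2) * L \<tau>))"
    using iF iR iQ by (simp add: mR mQ L_def)
  also have "\<dots> = (\<Sum>\<tau>\<in>T. 0)"
    by (rule sum.cong) (simp_all add: algebra_simps power2_eq_square)
  finally show "of_int ((\<Sum>k<?N. (e k)\<^sup>2) - (\<Sum>k<?N. (staircase ?N k)\<^sup>2)) * (LINT g|\<mu>. schur l (eigs g)) = 0"
    by simp
qed

lemma integral_one: "(LINT g|\<mu>. (c :: complex)) = c"
  using haar by (simp add: haar_prob_measure_def measure_def)

text \<open>Written as a determinant of Kronecker deltas so that the multilinear expansion in
  \<open>twisted_moment_toeplitz\<close> can be resummed column by column. Its value is the sign of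
  the permutation relating exponents and staircase, or 0 if there is none. Lists that are not
  dominant are included because that expansion produces them.\<close>

lemma schur_integral:
  assumes l: "length l = CARD('n)"
  shows "(LINT g|\<mu>. schur l (eigs g)) =
    fdet CARD('n) (\<lambda>j k. of_bool (staircase CARD('n) j = staircase CARD('n) k + l ! k))"
proof -
  let ?N = "CARD('n)"
  define e where "e = (\<lambda>k. staircase ?N k + l ! k)"
  have num: "schur_num l = alternant ?N e"
    unfolding schur_num_alternant l e_def ..
  have nz: "eigs g a \<noteq> 0" if "g \<in> space \<mu>" "a < ?N" for g a
    using norm_eigs[of g a] that by (auto simp: space_haar)
  have const: "(LINT g|\<mu>. schur l (eigs g)) = c" if "\<And>y. schur_num l y = schur_den ?N y * c" for c
  proof -
    have "(LINT g|\<mu>. schur l (eigs g)) = (LINT g|\<mu>. c)"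
      by (rule Bochner_Integration.integral_cong[OF refl], rule schur_constant[OF l]) (use nz that in auto)
    then show ?thesis by (simp only: integral_one)
  qed
  \<comment> \<open>If the exponents are a rearrangement of the staircase, the Schur function is the
    constant sign. Otherwise repeated exponents make it 0, while distinct ones fall under
    \<open>schur_integral_euler\<close> combined with \<open>exponents_eq_interval\<close>.\<close>
  show ?thesis
  proof (cases "inj_on e {..<?N} \<and> e ` {..<?N} = {0..<int ?N}")
    case True
    define p where "p = (\<lambda>k. if k < ?N then nat (int ?N - 1 - e k) else k)"
    have e: "0 \<le> e k \<and> e k < int ?N" if "k < ?N" for k using True that by force
    have ep: "e k = staircase ?N (p k)" "p k < ?N" if "k < ?N" for k
      using e[OF that] that by (auto simp: p_def staircase_def)
    have "inj_on p {0..<?N}"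
    proof (rule inj_onI)
      fix i k assume "i \<in> {0..<?N}" "k \<in> {0..<?N}" "p i = p k"
      then show "i = k" using ep(1)[of i] ep(1)[of k] inj_onD[of e "{..<?N}" i k] True by simp
    qed
    moreover have "p ` {0..<?N} \<subseteq> {0..<?N}" using ep by auto
    ultimately have "bij_betw p {0..<?N} {0..<?N}"
      by (simp add: bij_betw_def endo_inj_surj)
    then have p: "p permutes {0..<?N}" by (rule bij_imp_permutes) (simp add: p_def)
    have "alternant ?N e y = fdet ?N (\<lambda>j k. y j powi staircase ?N (p k))" for y
      unfolding alternant_def by (rule fdet_cong) (simp add: ep)
    then have "schur_num l y = schur_den ?N y * signof p" for y
      using fdet_permute_cols[OF p, of "\<lambda>j k. y j powi staircase ?N k"]
      by (simp add: num schur_den_alternant alternant_def)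
    then have "(LINT g|\<mu>. schur l (eigs g)) = signof p" by (rule const)
    moreover have "fdet ?N (\<lambda>j k. of_bool (staircase ?N j = e k)) = (signof p :: complex)"
    proof -
      have "fdet ?N (\<lambda>j k. of_bool (staircase ?N j = e k)) = fdet ?N (\<lambda>j k. of_bool (j = p k) :: complex)"
        by (rule fdet_cong) (use ep inj_staircase[of ?N] in \<open>auto dest: inj_onD\<close>)
      also have "\<dots> = signof p * fdet ?N (\<lambda>j k. of_bool (j = k))"
        using fdet_permute_cols[OF p, of "\<lambda>j k. of_bool (j = k)"] by simp
      also have "fdet ?N (\<lambda>j k. of_bool (j = k) :: complex) = 1"
        by (subst fdet_upper_triangular) auto
      finally show ?thesis by simp
    qed
    ultimately show ?thesis by (simp add: e_def)
  next
    case False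
    have "fdet ?N (\<lambda>j k. of_bool (staircase ?N j = e k)) = (0 :: complex)"
    proof (cases "inj_on e {..<?N}")
      case True
      have "card (e ` {..<?N}) = card {0..<int ?N}" by (simp add: card_image[OF True])
      then have "\<not> {0..<int ?N} \<subseteq> e ` {..<?N}"
        using False True card_subset_eq[of "e ` {..<?N}" "{0..<int ?N}"] by auto
      then obtain j where "j < ?N" "staircase ?N j \<notin> e ` {..<?N}"
        unfolding staircase_image[symmetric] by auto
      then show ?thesis by (intro fdet_zero_row[of j]) auto
    next
      case False
      then obtain i k where "i < ?N" "k < ?N" "i \<noteq> k" "e i = e k" by (auto simp: inj_on_def)
      then show ?thesis by (intro fdet_identical_cols[of i _ k]) auto
    qed
    moreover have "(LINT g|\<mu>. schur l (eigs g)) = 0"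
    proof (cases "inj_on e {..<?N}")
      case True
      show ?thesis
      proof (rule ccontr)
        assume "(LINT g|\<mu>. schur l (eigs g)) \<noteq> 0"
        then have "(\<Sum>k<?N. e k) = (\<Sum>k<?N. staircase ?N k)" "(\<Sum>k<?N. (e k)\<^sup>2) = (\<Sum>k<?N. (staircase ?N k)\<^sup>2)"
          using schur_integral_euler(2,3)[OF l] unfolding mult_eq_0_iff of_int_eq_0_iff by (auto simp: e_def)
        then show False using exponents_eq_interval[OF True] True False by simp
      qed
    next
      case False
      then show ?thesis by (intro const) (simp add: num alternant_not_inj)
    qed
    ultimately show ?thesis by (simp add: e_def)
  qed
qed

end

subsection \<open>Twisted moments as Toeplitz minors\<close>

text \<open>The product of all 1 - \<alpha> / x and 1 - \<beta> x, multiplied by x^(size A) to clear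
  denominators.\<close>

definition laurent_poly :: "complex multiset \<Rightarrow> complex multiset \<Rightarrow> complex poly" where
  "laurent_poly A B = (\<Prod>\<alpha>\<in>#A. [:- \<alpha>, 1:]) * (\<Prod>\<beta>\<in>#B. [:1, - \<beta>:])"

text \<open>The coefficient of \<open>x powi s\<close> in the product of all \<open>1 - \<alpha> / x\<close> and \<open>1 - \<beta> * x\<close>.\<close>

definition laurent_coeff :: "complex multiset \<Rightarrow> complex multiset \<Rightarrow> int \<Rightarrow> complex" where
  "laurent_coeff A B s =
     (if s + int (size A) \<ge> 0 then coeff (laurent_poly A B) (nat (s + int (size A))) else 0)"

lemma degree_laurent_poly: "degree (laurent_poly A B) \<le> size A + size B"
proof -
  have "degree (\<Prod>\<alpha>\<in>#A. [:- \<alpha>, 1:]) \<le> size A"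
  proof (induction A)
    case (add a A)
    then show ?case using degree_mult_le[of "[:- a, 1:]" "\<Prod>\<alpha>\<in>#A. [:- \<alpha>, 1:]"] by simp
  qed simp
  moreover have "degree (\<Prod>\<beta>\<in>#B. [:1, - \<beta>:]) \<le> size B"
  proof (induction B)
    case (add b B)
    have "degree [:1, - b:] \<le> 1" by simp
    with add show ?case using degree_mult_le[of "[:1, - b:]" "\<Prod>\<beta>\<in>#B. [:1, - \<beta>:]"] by (simp del: mult_pCons_left)
  qed simp
  ultimately show ?thesis
    unfolding laurent_poly_def by (intro order_trans[OF degree_mult_le] add_mono)
qed

lemma laurent_coeff_support:
  assumes "s \<notin> {- int (size A)..int (size B)}"
  shows "laurent_coeff A B s = 0"
proof (cases "s + int (size A) \<ge> 0")
  case True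
  then have "nat (s + int (size A)) > size A + size B" using assms by auto
  then have "nat (s + int (size A)) > degree (laurent_poly A B)" using degree_laurent_poly[of A B] by simp
  then show ?thesis by (simp add: laurent_coeff_def coeff_eq_0)
qed (simp add: laurent_coeff_def)

lemma laurent_expansion:
  assumes x: "x \<noteq> 0"
  shows "(\<Prod>\<alpha>\<in>#A. 1 - \<alpha> * inverse x) * (\<Prod>\<beta>\<in>#B. 1 - \<beta> * x) =
    (\<Sum>s\<in>{- int (size A)..int (size B)}. laurent_coeff A B s * x powi s)"
proof -
  have "(\<Prod>\<alpha>\<in>#A. 1 - \<alpha> * inverse x) = inverse x ^ size A * poly (\<Prod>\<alpha>\<in>#A. [:- \<alpha>, 1:]) x"
    by (induction A) (use x in \<open>auto simp: field_simps\<close>)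
  moreover have "(\<Prod>\<beta>\<in>#B. 1 - \<beta> * x) = poly (\<Prod>\<beta>\<in>#B. [:1, - \<beta>:]) x"
    by (induction B) (auto simp: algebra_simps)
  ultimately have "(\<Prod>\<alpha>\<in>#A. 1 - \<alpha> * inverse x) * (\<Prod>\<beta>\<in>#B. 1 - \<beta> * x) =
      inverse x ^ size A * poly (laurent_poly A B) x"
    by (simp add: laurent_poly_def)
  also have "poly (laurent_poly A B) x = (\<Sum>k\<le>size A + size B. coeff (laurent_poly A B) k * x ^ k)"
    unfolding poly_altdef
    by (rule sum.mono_neutral_left) (use degree_laurent_poly[of A B] in \<open>auto simp: coeff_eq_0\<close>)
  also have "inverse x ^ size A * \<dots> =
      (\<Sum>k\<le>size A + size B. coeff (laurent_poly A B) k * x powi (int k - int (size A)))"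
    unfolding sum_distrib_left
    by (rule sum.cong) (use x in \<open>auto simp: power_int_diff field_simps\<close>)
  also have "\<dots> = (\<Sum>s\<in>{- int (size A)..int (size B)}. laurent_coeff A B s * x powi s)"
    by (rule sum.reindex_bij_witness[of _ "\<lambda>s. nat (s + int (size A))" "\<lambda>k. int k - int (size A)"])
      (auto simp: laurent_coeff_def)
  finally show ?thesis .
qed

text \<open>Laurent products multiply when multisets are added. \<open>W\<close> may be any finite
  window containing all indices at which the first factor is nonzero, which makes the doubly
  infinite convolution a finite sum.\<close>

lemma laurent_coeff_convolution:
  assumes W: "finite W" "\<And>t. laurent_coeff A\<^sub>1 B\<^sub>1 (a - t) \<noteq> 0 \<Longrightarrow> t \<in> W"
  shows "(\<Sum>t\<in>W. laurent_coeff A\<^sub>1 B\<^sub>1 (a - t) * laurent_coeff A\<^sub>2 B\<^sub>2 (t - b)) =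
    laurent_coeff (A\<^sub>1 + A\<^sub>2) (B\<^sub>1 + B\<^sub>2) (a - b)"
proof -
  let ?f = "\<lambda>t. laurent_coeff A\<^sub>1 B\<^sub>1 (a - t) * laurent_coeff A\<^sub>2 B\<^sub>2 (t - b)"
  \<comment> \<open>\<open>K\<close> is the exponent a - b after clearing denominators, and
    \<open>R\<close> consists of the t for which both shifted exponents are nonnegative, so that the
    sum over \<open>R\<close> is a coefficient of a product of polynomials.\<close>
  define K where "K = a - b + int (size A\<^sub>1) + int (size A\<^sub>2)"
  define R where "R = {t. 0 \<le> a - t + int (size A\<^sub>1) \<and> 0 \<le> t - b + int (size A\<^sub>2)}"
  have finR: "finite R"
    by (rule finite_subset[of _ "{b - int (size A\<^sub>2)..a + int (size A\<^sub>1)}"]) (auto simp: R_def)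
  have "(\<Sum>t\<in>W. ?f t) = (\<Sum>t\<in>W \<inter> R. ?f t)"
    by (rule sum.mono_neutral_right) (use W in \<open>auto simp: R_def laurent_coeff_def\<close>)
  also have "\<dots> = (\<Sum>t\<in>R. ?f t)"
    by (rule sum.mono_neutral_left) (use W finR in auto)
  also have "\<dots> = laurent_coeff (A\<^sub>1 + A\<^sub>2) (B\<^sub>1 + B\<^sub>2) (a - b)"
  proof (cases "K \<ge> 0")
    case True
    have P: "laurent_poly (A\<^sub>1 + A\<^sub>2) (B\<^sub>1 + B\<^sub>2) = laurent_poly A\<^sub>1 B\<^sub>1 * laurent_poly A\<^sub>2 B\<^sub>2"
      by (simp add: laurent_poly_def mult_ac)
    have "(\<Sum>t\<in>R. ?f t) =
        (\<Sum>i\<le>nat K. coeff (laurent_poly A\<^sub>1 B\<^sub>1) i * coeff (laurent_poly A\<^sub>2 B\<^sub>2) (nat K - i))"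
    proof (rule sum.reindex_bij_witness[of _ "\<lambda>i. a + int (size A\<^sub>1) - int i" "\<lambda>t. nat (a - t + int (size A\<^sub>1))"])
      fix t assume t: "t \<in> R"
      then have "nat K - nat (a - t + int (size A\<^sub>1)) = nat (t - b + int (size A\<^sub>2))"
        by (simp add: R_def K_def nat_diff_distrib[symmetric] flip: nat_diff_distrib)
      then show "coeff (laurent_poly A\<^sub>1 B\<^sub>1) (nat (a - t + int (size A\<^sub>1))) *
          coeff (laurent_poly A\<^sub>2 B\<^sub>2) (nat K - nat (a - t + int (size A\<^sub>1))) = ?f t"
        using t by (simp add: laurent_coeff_def R_def)
    qed (use True in \<open>auto simp: R_def K_def\<close>)
    also have "\<dots> = coeff (laurent_poly (A\<^sub>1 + A\<^sub>2) (B\<^sub>1 + B\<^sub>2)) (nat K)"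
      by (simp add: P coeff_mult)
    finally show ?thesis using True by (simp add: laurent_coeff_def K_def add.assoc)
  next
    case False
    then have "R = {}" by (auto simp: R_def K_def)
    then show ?thesis using False by (simp add: laurent_coeff_def K_def)
  qed
  finally show ?thesis .
qed

section \<open>Products of Schur functions with Laurent polynomials, and their integrals\<close>

lemma prod_mset_prod_swap:
  "(\<Prod>\<alpha>\<in>#A. \<Prod>a\<in>I. f \<alpha> a :: 'a::comm_monoid_mult) = (\<Prod>a\<in>I. \<Prod>\<alpha>\<in>#A. f \<alpha> a)"
  by (induction A) (simp_all add: prod.distrib)

definition shift_weight :: "nat \<Rightarrow> int list \<Rightarrow> (nat \<Rightarrow> int) \<Rightarrow> int list" where
  "shift_weight n l \<phi> = map (\<lambda>k. l ! k + \<phi> k) [0..<n]"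

text \<open>Scaling row j of the alternant by a Laurent polynomial in x_j turns each column into a
  sum over s of columns with exponent raised by s; then expand by columns. Coinciding variables are
  reached by continuity.\<close>

lemma schur_mult_expansion:
  assumes n: "length l = n" "n > 0" and x: "\<And>a. a < n \<Longrightarrow> x a \<noteq> 0" and S: "finite S"
  shows "(\<Prod>a<n. \<Sum>s\<in>S. q s * x a powi s) * schur l x =
    (\<Sum>\<phi>\<in>PiE {..<n} (\<lambda>_. S). (\<Prod>k<n. q (\<phi> k)) * schur (shift_weight n l \<phi>) x)"
proof (rule eq_by_density_of_inj[where U = "- {0}" and n = n and x = x
    and f = "\<lambda>x. (\<Prod>a<n. \<Sum>s\<in>S. q s * x a powi s) * schur l x"
    and g = "\<lambda>x. \<Sum>\<phi>\<in>PiE {..<n} (\<lambda>_. S). (\<Prod>k<n. q (\<phi> k)) * schur (shift_weight n l \<phi>) x"])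
  have len: "length (shift_weight n l \<phi>) = n" for \<phi> by (simp add: shift_weight_def)
  show "((\<lambda>x. (\<Prod>a<n. \<Sum>s\<in>S. q s * x a powi s) * schur l x) \<longlongrightarrow>
      (\<Prod>a<n. \<Sum>s\<in>S. q s * x a powi s) * schur l x) (at x)"
    by (intro tendsto_mult tendsto_prod tendsto_sum tendsto_const tendsto_power_int tendsto_coordinate
        schur_tendsto[OF n]) (use x in auto)
  show "((\<lambda>x. \<Sum>\<phi>\<in>PiE {..<n} (\<lambda>_. S). (\<Prod>k<n. q (\<phi> k)) * schur (shift_weight n l \<phi>) x) \<longlongrightarrow>
      (\<Sum>\<phi>\<in>PiE {..<n} (\<lambda>_. S). (\<Prod>k<n. q (\<phi> k)) * schur (shift_weight n l \<phi>) x)) (at x)"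
    by (intro tendsto_sum tendsto_mult tendsto_const schur_tendsto[OF len n(2)]) (use x in auto)
  fix y :: "nat \<Rightarrow> complex" assume y: "inj_on y {..<n}" and "\<And>a. a < n \<Longrightarrow> y a \<in> - {0}"
  then have y0: "y a \<noteq> 0" if "a < n" for a using that by auto
  define e where "e = (\<lambda>k. staircase n k + l ! k)"
  have "(\<Prod>a<n. \<Sum>s\<in>S. q s * y a powi s) * alternant n e y =
      fdet n (\<lambda>j k. (\<Sum>s\<in>S. q s * y j powi s) * y j powi e k)"
    unfolding alternant_def by (rule fdet_scale_rows[symmetric])
  also have "\<dots> = fdet n (\<lambda>j k. \<Sum>s\<in>S. q s * y j powi (e k + s))"
    by (rule fdet_cong) (simp add: sum_distrib_left power_int_add y0 mult_ac)
  also have "\<dots> = (\<Sum>\<phi>\<in>PiE {..<n} (\<lambda>_. S). fdet n (\<lambda>j k. q (\<phi> k) * y j powi (e k + \<phi> k)))"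
    by (rule fdet_sum_cols[OF S])
  also have "\<dots> = (\<Sum>\<phi>\<in>PiE {..<n} (\<lambda>_. S). (\<Prod>k<n. q (\<phi> k)) * schur_num (shift_weight n l \<phi>) y)"
  proof (rule sum.cong[OF refl])
    fix \<phi>
    have "fdet n (\<lambda>j k. y j powi (e k + \<phi> k)) = schur_num (shift_weight n l \<phi>) y"
      unfolding schur_num_alternant len alternant_def
      by (rule fdet_cong) (simp add: e_def shift_weight_def add.assoc)
    then show "fdet n (\<lambda>j k. q (\<phi> k) * y j powi (e k + \<phi> k)) =
        (\<Prod>k<n. q (\<phi> k)) * schur_num (shift_weight n l \<phi>) y"
      by (simp add: fdet_scale_cols)
  qed
  finally have "(\<Prod>a<n. \<Sum>s\<in>S. q s * y a powi s) * alternant n e y / schur_den n y =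
      (\<Sum>\<phi>\<in>PiE {..<n} (\<lambda>_. S). (\<Prod>k<n. q (\<phi> k)) * schur_num (shift_weight n l \<phi>) y) / schur_den n y"
    by simp
  then show "(\<Prod>a<n. \<Sum>s\<in>S. q s * y a powi s) * schur l y =
      (\<Sum>\<phi>\<in>PiE {..<n} (\<lambda>_. S). (\<Prod>k<n. q (\<phi> k)) * schur (shift_weight n l \<phi>) y)"
    using y by (simp add: schur_def len n e_def schur_num_alternant sum_divide_distrib)
qed (use x in auto)

context haar_unitary
begin

text \<open>Each shifted Schur function integrates to a determinant of deltas. Resumming column by
  column, the delta in row j and column k selects the single Laurent coefficient with index \<rho>_j
  - \<rho>_k - l_k.\<close>

lemma twisted_moment_toeplitz:
  assumes l: "length l = CARD('n)"
  shows "twisted_moment \<mu> A B l =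
    fdet CARD('n) (\<lambda>j k. laurent_coeff A B (staircase CARD('n) j - (staircase CARD('n) k + l ! k)))"
proof -
  let ?N = "CARD('n)" and ?q = "laurent_coeff A B"
  define S where "S = {- int (size A)..int (size B)}"
  have S: "finite S" by (simp add: S_def)
  have len: "length (shift_weight ?N l \<phi>) = ?N" for \<phi> by (simp add: shift_weight_def)
  have "twisted_moment \<mu> A B l = (LINT g|\<mu>. (\<Sum>\<phi>\<in>PiE {..<?N} (\<lambda>_. S).
      (\<Prod>k<?N. ?q (\<phi> k)) * schur (shift_weight ?N l \<phi>) (eigs g)))"
    unfolding twisted_moment_def
  proof (rule Bochner_Integration.integral_cong[OF refl])
    fix g assume "g \<in> space \<mu>"
    then have g: "g \<in> unitary_group" by (simp add: space_haar)
    have nz: "eigs g a \<noteq> 0" if "a < ?N" for a using norm_eigs[OF g that] by auto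
    have "(\<Prod>\<alpha>\<in>#A. mdet (smat 1 - smat \<alpha> ** conj_transpose g)) * (\<Prod>\<beta>\<in>#B. mdet (smat 1 - smat \<beta> ** g)) =
        (\<Prod>a<?N. (\<Prod>\<alpha>\<in>#A. 1 - \<alpha> * inverse (eigs g a)) * (\<Prod>\<beta>\<in>#B. 1 - \<beta> * eigs g a))"
      unfolding mdet_one_minus_conj_transpose[OF g] mdet_smat_minus_smult[where g = g] prod_mset_prod_swap prod.distrib ..
    also have "\<dots> = (\<Prod>a<?N. \<Sum>s\<in>S. ?q s * eigs g a powi s)"
      by (rule prod.cong[OF refl]) (simp add: laurent_expansion[OF nz] S_def)
    finally show "(\<Prod>\<alpha>\<in>#A. mdet (smat 1 - smat \<alpha> ** conj_transpose g)) *
        (\<Prod>\<beta>\<in>#B. mdet (smat 1 - smat \<beta> ** g)) * schur_eigenvalues l g =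
        (\<Sum>\<phi>\<in>PiE {..<?N} (\<lambda>_. S). (\<Prod>k<?N. ?q (\<phi> k)) * schur (shift_weight ?N l \<phi>) (eigs g))"
      by (simp only: schur_eigenvalues_eigs schur_mult_expansion[OF l zero_less_card_finite nz S])
  qed
  also have "\<dots> = (\<Sum>\<phi>\<in>PiE {..<?N} (\<lambda>_. S). (\<Prod>k<?N. ?q (\<phi> k)) *
      (LINT g|\<mu>. schur (shift_weight ?N l \<phi>) (eigs g)))"
    using schur_integral_euler(1)[OF len] by simp
  also have "\<dots> = (\<Sum>\<phi>\<in>PiE {..<?N} (\<lambda>_. S). fdet ?N (\<lambda>j k. ?q (\<phi> k) *
      of_bool (staircase ?N j = staircase ?N k + l ! k + \<phi> k)))"
  proof (rule sum.cong[OF refl])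
    fix \<phi>
    have "fdet ?N (\<lambda>j k. of_bool (staircase ?N j = staircase ?N k + shift_weight ?N l \<phi> ! k)) =
        fdet ?N (\<lambda>j k. of_bool (staircase ?N j = staircase ?N k + l ! k + \<phi> k) :: complex)"
      by (rule fdet_cong) (simp add: shift_weight_def add.assoc)
    then show "(\<Prod>k<?N. ?q (\<phi> k)) * (LINT g|\<mu>. schur (shift_weight ?N l \<phi>) (eigs g)) =
        fdet ?N (\<lambda>j k. ?q (\<phi> k) * of_bool (staircase ?N j = staircase ?N k + l ! k + \<phi> k))"
      unfolding schur_integral[OF len] fdet_scale_cols by simp
  qed
  also have "\<dots> = fdet ?N (\<lambda>j k. \<Sum>s\<in>S. ?q s * of_bool (staircase ?N j = staircase ?N k + l ! k + s))"
    by (rule fdet_sum_cols[OF S, symmetric])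
  also have "\<dots> = fdet ?N (\<lambda>j k. ?q (staircase ?N j - (staircase ?N k + l ! k)))"
  proof (rule fdet_cong)
    fix j k
    let ?d = "staircase ?N j - (staircase ?N k + l ! k)"
    have "(\<Sum>s\<in>S. ?q s * of_bool (staircase ?N j = staircase ?N k + l ! k + s)) =
        (\<Sum>s\<in>S. if s = ?d then ?q ?d else 0)"
      by (rule sum.cong) auto
    also have "\<dots> = ?q ?d"
      using S laurent_coeff_support[of ?d A B] by (auto simp: S_def)
    finally show "(\<Sum>s\<in>S. ?q s * of_bool (staircase ?N j = staircase ?N k + l ! k + s)) = ?q ?d" .
  qed
  finally show ?thesis .
qed

text \<open>The reversal in -l is undone by reversing rows and columns, whose two signs cancel. A
  transposition then moves the weight to the row index, the form of the second minor in
  \<open>cauchy_binet\<close>.\<close>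

lemma twisted_moment_neg_weight:
  assumes l: "length l = CARD('n)"
  shows "twisted_moment \<mu> A B (neg_weight l) =
    fdet CARD('n) (\<lambda>j k. laurent_coeff A B (staircase CARD('n) j + l ! j - staircase CARD('n) k))"
proof -
  let ?N = "CARD('n)" and ?q = "laurent_coeff A B"
  define p where "p = (\<lambda>k. if k < ?N then ?N - 1 - k else k)"
  have "bij_betw p {0..<?N} {0..<?N}"
    by (rule bij_betwI[of _ _ _ p]) (auto simp: p_def)
  then have p: "p permutes {0..<?N}" by (rule bij_imp_permutes) (simp add: p_def)
  have plt: "p k < ?N" if "k < ?N" for k using that by (simp add: p_def)
  have st: "staircase ?N j - staircase ?N k = staircase ?N (p k) - staircase ?N (p j)"
    if "j < ?N" "k < ?N" for j k using that by (auto simp: p_def staircase_def)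
  have neg: "neg_weight l ! k = - l ! p k" if "k < ?N" for k
    using that l by (simp add: neg_weight_def rev_nth p_def)
  have "twisted_moment \<mu> A B (neg_weight l) =
      fdet ?N (\<lambda>j k. ?q (staircase ?N j - (staircase ?N k + neg_weight l ! k)))"
    by (rule twisted_moment_toeplitz) (simp add: neg_weight_def l)
  also have "\<dots> = fdet ?N (\<lambda>j k. ?q (staircase ?N (p k) + l ! p k - staircase ?N (p j)))"
  proof (rule fdet_cong)
    fix j k assume "j < ?N" "k < ?N"
    then have "staircase ?N j - (staircase ?N k + neg_weight l ! k) =
        staircase ?N (p k) + l ! p k - staircase ?N (p j)"
      using st[of j k] neg[of k] by simp
    then show "?q (staircase ?N j - (staircase ?N k + neg_weight l ! k)) =
        ?q (staircase ?N (p k) + l ! p k - staircase ?N (p j))" by simp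
  qed
  also have "\<dots> = signof p * (signof p * fdet ?N (\<lambda>j k. ?q (staircase ?N k + l ! k - staircase ?N j)))"
    using fdet_permute_rows[OF p, of "\<lambda>j k. ?q (staircase ?N (p k) + l ! p k - staircase ?N j)"]
      fdet_permute_cols[OF p, of "\<lambda>j k. ?q (staircase ?N k + l ! k - staircase ?N j)"] by simp
  also have "\<dots> = fdet ?N (\<lambda>j k. ?q (staircase ?N k + l ! k - staircase ?N j))"
    by (simp add: sign_def)
  also have "\<dots> = fdet ?N (\<lambda>j k. ?q (staircase ?N j + l ! j - staircase ?N k))"
    by (rule fdet_transpose)
  finally show ?thesis .
qed

end

theorem theorem1p1:
  fixes \<mu> :: "(complex^'n^'n) measure"
    and A B A\<^sub>1 A\<^sub>2 B\<^sub>1 B\<^sub>2 :: "complex multiset"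
  assumes "haar_prob_measure \<mu>"
    and "A = A\<^sub>1 + A\<^sub>2"
    and "B = B\<^sub>1 + B\<^sub>2"
  shows "finite {l \<in> dominant_weights CARD('n).
           twisted_moment \<mu> A\<^sub>1 B\<^sub>1 l * twisted_moment \<mu> A\<^sub>2 B\<^sub>2 (neg_weight l) \<noteq> 0} \<and>
         twisted_moment \<mu> A B (replicate CARD('n) 0) =
           (\<Sum>\<^sub>\<infinity>l\<in>dominant_weights CARD('n).
              twisted_moment \<mu> A\<^sub>1 B\<^sub>1 l * twisted_moment \<mu> A\<^sub>2 B\<^sub>2 (neg_weight l))"
proof -
  interpret haar_unitary \<mu> by unfold_locales (rule assms(1))
  let ?N = "CARD('n)" and ?\<rho> = "staircase CARD('n)"
  define q1 where "q1 = laurent_coeff A\<^sub>1 B\<^sub>1"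
  define q2 where "q2 = laurent_coeff A\<^sub>2 B\<^sub>2"
  \<comment> \<open>For t outside this window q1(\<rho>_j - t) is 0 for all j. A weight whose
    shifted list leaves the window therefore has a zero column in its first minor, which gives the
    finiteness.\<close>
  define W where "W = (\<Union>j<?N. {?\<rho> j - int (size B\<^sub>1)..?\<rho> j + int (size A\<^sub>1)})"
  define f where "f = (\<lambda>l. twisted_moment \<mu> A\<^sub>1 B\<^sub>1 l * twisted_moment \<mu> A\<^sub>2 B\<^sub>2 (neg_weight l))"
  define D where "D = {l \<in> dominant_weights ?N. set (shifted ?N l) \<subseteq> W}"
  have W: "finite W" by (simp add: W_def)
  have inW: "t \<in> W" if "j < ?N" "q1 (?\<rho> j - t) \<noteq> 0" for j t
    using laurent_coeff_support[of "?\<rho> j - t" A\<^sub>1 B\<^sub>1] that by (force simp: W_def q1_def)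
  have finD: "finite D"
    using bij_betw_finite[OF bij_betw_shifted[of ?N W]] finite_strict_lists[OF W] by (simp add: D_def)
  have f_eq: "f l = fdet ?N (\<lambda>j k. q1 (?\<rho> j - shifted ?N l ! k)) *
      fdet ?N (\<lambda>j k. q2 (shifted ?N l ! j - ?\<rho> k))" if "l \<in> dominant_weights ?N" for l
  proof -
    have l: "length l = ?N" using that by (simp add: dominant_weights_def)
    have "twisted_moment \<mu> A\<^sub>1 B\<^sub>1 l = fdet ?N (\<lambda>j k. q1 (?\<rho> j - shifted ?N l ! k))"
      unfolding twisted_moment_toeplitz[OF l] by (rule fdet_cong) (simp add: q1_def shifted_def)
    moreover have "twisted_moment \<mu> A\<^sub>2 B\<^sub>2 (neg_weight l) = fdet ?N (\<lambda>j k. q2 (shifted ?N l ! j - ?\<rho> k))"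
      unfolding twisted_moment_neg_weight[OF l] by (rule fdet_cong) (simp add: q2_def shifted_def)
    ultimately show ?thesis by (simp add: f_def)
  qed
  have zero: "f l = 0" if "l \<in> dominant_weights ?N - D" for l
  proof -
    from that obtain t where t: "t \<in> set (shifted ?N l)" "t \<notin> W" by (auto simp: D_def)
    then obtain k where k: "k < ?N" "t = shifted ?N l ! k"
      by (auto simp: in_set_conv_nth shifted_def)
    have "fdet ?N (\<lambda>j k. q1 (?\<rho> j - shifted ?N l ! k)) = 0"
      by (rule fdet_zero_col[OF k(1)]) (use inW t(2) k(2) in blast)
    then show ?thesis using f_eq that by simp
  qed
  have "{l \<in> dominant_weights ?N. f l \<noteq> 0} \<subseteq> D" using zero by blast
  then have fin: "finite {l \<in> dominant_weights ?N. f l \<noteq> 0}" by (rule finite_subset) (rule finD)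
  have "(\<Sum>\<^sub>\<infinity>l\<in>dominant_weights ?N. f l) = (\<Sum>\<^sub>\<infinity>l\<in>D. f l)"
    by (rule infsum_cong_neutral) (use zero in \<open>auto simp: D_def\<close>)
  also have "\<dots> = (\<Sum>l\<in>D. f l)" using finD by (rule infsum_finite)
  also have "\<dots> = (\<Sum>l\<in>D. fdet ?N (\<lambda>j k. q1 (?\<rho> j - shifted ?N l ! k)) *
      fdet ?N (\<lambda>j k. q2 (shifted ?N l ! j - ?\<rho> k)))"
    by (rule sum.cong) (auto simp: f_eq D_def)
  also have "\<dots> = (\<Sum>s\<in>strict_lists ?N W. fdet ?N (\<lambda>j k. q1 (?\<rho> j - s ! k)) *
      fdet ?N (\<lambda>j k. q2 (s ! j - ?\<rho> k)))"
    unfolding D_def by (rule sum.reindex_bij_betw[OF bij_betw_shifted])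
  also have "\<dots> = fdet ?N (\<lambda>j k. \<Sum>t\<in>W. q1 (?\<rho> j - t) * q2 (t - ?\<rho> k))"
    by (rule cauchy_binet[OF W, symmetric])
  \<comment> \<open>The convolution in each entry is the Laurent coefficient of the multiset sums,
    and weight 0 adds nothing to the index.\<close>
  also have "\<dots> = fdet ?N (\<lambda>j k. laurent_coeff A B (?\<rho> j - ?\<rho> k))"
    unfolding q1_def q2_def assms(2,3)
    by (rule fdet_cong, rule laurent_coeff_convolution[OF W]) (use inW in \<open>auto simp: q1_def\<close>)
  also have "\<dots> = fdet ?N (\<lambda>j k. laurent_coeff A B (?\<rho> j - (?\<rho> k + replicate ?N 0 ! k)))"
    by (rule fdet_cong) simp
  also have "\<dots> = twisted_moment \<mu> A B (replicate ?N 0)"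
    by (rule twisted_moment_toeplitz[symmetric]) simp
  finally show ?thesis using fin by (simp add: f_def)
qed

end
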